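(* If $L$ is an augmented alternating link, then its involutory quandle $IQ(L)$ is not left-orderable.
   Context: A quandle is a set $Q$ with a binary operation $*$ such that $x*x=x$; for all $x,y$ there is a unique $z$ with $z*y=x$; and $(x*y)*z=(x*z)*(y*z)$. It is involutory if $(x*y)*y=x$ for all $x,y$. A left-order on $Q$ is a strict linear order $<$ such that $x<y$ implies $z*x<z*y$ for all $x,y,z\in Q$. $Q$ is left-orderable if it has a left-order; by convention a trivial quandle (one with $x*y=x$ for all $x,y$), in particular the one-element quandle, is not considered left-orderable. For a diagram $D$ of a link $L$, the involutory quandle $IQ(L)$ is the involutory quandle generated by the arcs of $D$ with, for each crossing with over-arc $y$ and under-arcs $x,z$, the relation $z=x*y$. It is an invariant of the unoriented link $L$. Augmented alternating links: let $D$ be a reduced alternating diagram of a non-trivial non-split alternating link $L_0$. Let $J$ be an embedded circle in the complement of $L_0$ in $S^3$ which meets the projection plane in two points and bounds a disk that lies in a plane perpendicular to the projection plane and contains exactly two points of $D$ in its interior. The link $L_0\cup J$ is called an augmentation of $L_0$. If moreover $L_0$ is prime and is not isotopic to a torus link $T(2,k)$ for any integer $k$, then $L_0\cup J$ is called an augmented alternating link. *)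

theory Defs
  imports Main "HOL-Library.Multiset"
begin

section \<open>Quandles and left-orders\<close>

record 'a magma_struct =
  elems :: "'a set"
  act :: "'a \<Rightarrow> 'a \<Rightarrow> 'a"

definition quandle :: "'a magma_struct \<Rightarrow> bool" where
  "quandle Q \<longleftrightarrow>
     (\<forall>x\<in>elems Q. \<forall>y\<in>elems Q. act Q x y \<in> elems Q) \<and>
     (\<forall>x\<in>elems Q. act Q x x = x) \<and>
     (\<forall>x\<in>elems Q. \<forall>y\<in>elems Q. \<exists>!z. z \<in> elems Q \<and> act Q z y = x) \<and>
     (\<forall>x\<in>elems Q. \<forall>y\<in>elems Q. \<forall>z\<in>elems Q.
        act Q (act Q x y) z = act Q (act Q x z) (act Q y z))"

definition involutory_quandle :: "'a magma_struct \<Rightarrow> bool" where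
  "involutory_quandle Q \<longleftrightarrow>
     quandle Q \<and> (\<forall>x\<in>elems Q. \<forall>y\<in>elems Q. act Q (act Q x y) y = x)"

definition trivial_quandle :: "'a magma_struct \<Rightarrow> bool" where
  "trivial_quandle Q \<longleftrightarrow> (\<forall>x\<in>elems Q. \<forall>y\<in>elems Q. act Q x y = x)"

definition left_order :: "'a magma_struct \<Rightarrow> ('a \<Rightarrow> 'a \<Rightarrow> bool) \<Rightarrow> bool" where
  "left_order Q lt \<longleftrightarrow>
     (\<forall>x\<in>elems Q. \<not> lt x x) \<and>
     (\<forall>x\<in>elems Q. \<forall>y\<in>elems Q. \<forall>z\<in>elems Q. lt x y \<longrightarrow> lt y z \<longrightarrow> lt x z) \<and>
     (\<forall>x\<in>elems Q. \<forall>y\<in>elems Q. x = y \<or> lt x y \<or> lt y x) \<and>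
     (\<forall>x\<in>elems Q. \<forall>y\<in>elems Q. \<forall>z\<in>elems Q.
        lt x y \<longrightarrow> lt (act Q z x) (act Q z y))"

definition left_orderable :: "'a magma_struct \<Rightarrow> bool" where
  "left_orderable Q \<longleftrightarrow> \<not> trivial_quandle Q \<and> (\<exists>lt. left_order Q lt)"


section \<open>Involutory quandles given by generators and relations\<close>

datatype 'g qterm = Gen 'g | Op "'g qterm" "'g qterm"

definition terms_over :: "'g set \<Rightarrow> 'g qterm set" where
  "terms_over G = {t. set_qterm t \<subseteq> G}"

text \<open>A triple \<open>(x, y, z)\<close> in \<open>R\<close> stands for the defining relation \<open>z = x * y\<close>.\<close>

inductive iq_eq :: "'g set \<Rightarrow> ('g \<times> 'g \<times> 'g) set \<Rightarrow> 'g qterm \<Rightarrow> 'g qterm \<Rightarrow> bool"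
  for G :: "'g set" and R :: "('g \<times> 'g \<times> 'g) set" where
  refl: "s \<in> terms_over G \<Longrightarrow> iq_eq G R s s"
| sym: "iq_eq G R s t \<Longrightarrow> iq_eq G R t s"
| trans: "iq_eq G R s t \<Longrightarrow> iq_eq G R t u \<Longrightarrow> iq_eq G R s u"
| cong: "iq_eq G R s s' \<Longrightarrow> iq_eq G R t t' \<Longrightarrow> iq_eq G R (Op s t) (Op s' t')"
| idem: "s \<in> terms_over G \<Longrightarrow> iq_eq G R (Op s s) s"
| invol: "s \<in> terms_over G \<Longrightarrow> t \<in> terms_over G \<Longrightarrow> iq_eq G R (Op (Op s t) t) s"
| distrib: "s \<in> terms_over G \<Longrightarrow> t \<in> terms_over G \<Longrightarrow> u \<in> terms_over G \<Longrightarrow>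
    iq_eq G R (Op (Op s t) u) (Op (Op s u) (Op t u))"
| relation: "(x, y, z) \<in> R \<Longrightarrow> x \<in> G \<Longrightarrow> y \<in> G \<Longrightarrow> z \<in> G \<Longrightarrow>
    iq_eq G R (Gen z) (Op (Gen x) (Gen y))"

definition iq_class :: "'g set \<Rightarrow> ('g \<times> 'g \<times> 'g) set \<Rightarrow> 'g qterm \<Rightarrow> 'g qterm set" where
  "iq_class G R t = {s. iq_eq G R t s}"

definition presented_iq ::
    "'g set \<Rightarrow> ('g \<times> 'g \<times> 'g) set \<Rightarrow> 'g qterm set magma_struct" where
  "presented_iq G R =
     \<lparr>elems = iq_class G R ` terms_over G,
      act = (\<lambda>A B. {u. \<exists>s\<in>A. \<exists>t\<in>B. iq_eq G R (Op s t) u})\<rparr>"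

lemma terms_over_Op: "Op s t \<in> terms_over G \<longleftrightarrow> s \<in> terms_over G \<and> t \<in> terms_over G"
  by (auto simp: terms_over_def)

lemma iq_eq_terms: "iq_eq G R s t \<Longrightarrow> s \<in> terms_over G \<and> t \<in> terms_over G"
  by (induction rule: iq_eq.induct) (auto simp: terms_over_def)

lemma iq_class_eq_iff:
  assumes "s \<in> terms_over G"
  shows "iq_class G R s = iq_class G R t \<longleftrightarrow> iq_eq G R s t"
  using assms unfolding iq_class_def
  by (blast intro: iq_eq.refl iq_eq.sym iq_eq.trans)

lemma act_iq_class:
  assumes "s \<in> terms_over G" "t \<in> terms_over G"
  shows "act (presented_iq G R) (iq_class G R s) (iq_class G R t) = iq_class G R (Op s t)"
  using assms unfolding presented_iq_def iq_class_def
  by (auto intro: iq_eq.refl iq_eq.trans iq_eq.cong)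

lemma involutory_quandle_presented_iq: "involutory_quandle (presented_iq G R)"
proof -
  let ?c = "iq_class G R" and ?T = "terms_over G"
  have elems: "elems (presented_iq G R) = ?c ` ?T"
    by (simp add: presented_iq_def)
  have invol: "?c (Op (Op s t) t) = ?c s" if "s \<in> ?T" "t \<in> ?T" for s t
    using that by (simp add: iq_class_eq_iff terms_over_Op iq_eq.invol)
  have idem: "?c (Op s s) = ?c s" if "s \<in> ?T" for s
    using that by (simp add: iq_class_eq_iff terms_over_Op iq_eq.idem)
  have distrib: "?c (Op (Op s t) u) = ?c (Op (Op s u) (Op t u))"
    if "s \<in> ?T" "t \<in> ?T" "u \<in> ?T" for s t u
    using that by (simp add: iq_class_eq_iff terms_over_Op iq_eq.distrib)
  have right_div: "\<exists>!A. A \<in> ?c ` ?T \<and> act (presented_iq G R) A (?c t) = ?c s"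
    if s: "s \<in> ?T" and t: "t \<in> ?T" for s t
  proof (rule ex1I[of _ "?c (Op s t)"])
    show "?c (Op s t) \<in> ?c ` ?T \<and> act (presented_iq G R) (?c (Op s t)) (?c t) = ?c s"
      using s t by (simp add: act_iq_class terms_over_Op invol)
  next
    fix A assume A: "A \<in> ?c ` ?T \<and> act (presented_iq G R) A (?c t) = ?c s"
    then obtain u where u: "u \<in> ?T" "A = ?c u" by blast
    have "?c (Op u t) = ?c s" using A u t by (simp add: act_iq_class)
    then have "act (presented_iq G R) (?c (Op u t)) (?c t)
             = act (presented_iq G R) (?c s) (?c t)" by simp
    then show "A = ?c (Op s t)"
      using u s t by (simp add: act_iq_class terms_over_Op invol)
  qed
  have ops: "act (presented_iq G R) (?c s) (?c t) = ?c (Op s t)" "Op s t \<in> ?T"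
    if "s \<in> ?T" "t \<in> ?T" for s t
    using that by (simp_all add: act_iq_class terms_over_Op)
  show ?thesis
    unfolding involutory_quandle_def quandle_def elems
  proof (intro conjI ballI; elim imageE)
    fix A B C s t u
    assume "A = ?c s" "B = ?c t" "C = ?c u" and T: "s \<in> ?T" "t \<in> ?T" "u \<in> ?T"
    then show "act (presented_iq G R) (act (presented_iq G R) A B) C =
               act (presented_iq G R) (act (presented_iq G R) A C) (act (presented_iq G R) B C)"
      using distrib[OF T] by (simp add: ops)
  qed (simp_all add: right_div ops invol idem)
qed


section \<open>Planar link diagrams\<close>

text \<open>
  Links are unoriented and are represented by planar diagrams on the sphere, in the form of
  unoriented planar diagram codes.  Edges carry natural numbers as labels.
  \<open>Cross a b c d\<close> is a crossing whose four incident edges are, in counterclockwise order,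
  \<open>a, b, c, d\<close>; the strand \<open>a\<close>--\<open>c\<close> passes under the strand \<open>b\<close>--\<open>d\<close>.
  \<open>Joint a b\<close> is a point in the interior of a strand, where the edges \<open>a\<close> and \<open>b\<close> are glued; it
  has no geometric content, but with it crossingless circles (\<open>Joint a a\<close>) and local
  modifications of diagrams can be written down.
\<close>

datatype piece = Cross nat nat nat nat | Joint nat nat

type_synonym pd = "piece list"

fun ends :: "piece \<Rightarrow> nat list" where
  "ends (Cross a b c d) = [a, b, c, d]"
| "ends (Joint a b) = [a, b]"

fun map_piece :: "(nat \<Rightarrow> nat) \<Rightarrow> piece \<Rightarrow> piece" where
  "map_piece f (Cross a b c d) = Cross (f a) (f b) (f c) (f d)"
| "map_piece f (Joint a b) = Joint (f a) (f b)"

text \<open>A dart \<open>(i, k)\<close> is the edge end at position \<open>k\<close> of the \<open>i\<close>-th piece.\<close>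

definition darts :: "pd \<Rightarrow> (nat \<times> nat) set" where
  "darts D = {(i, k). i < length D \<and> k < length (ends (D ! i))}"

definition label :: "pd \<Rightarrow> nat \<times> nat \<Rightarrow> nat" where
  "label D d = ends (D ! fst d) ! snd d"

definition edges :: "pd \<Rightarrow> nat set" where
  "edges D = label D ` darts D"

definition edges_have_two_ends :: "pd \<Rightarrow> bool" where
  "edges_have_two_ends D \<longleftrightarrow> (\<forall>e\<in>edges D. card {d \<in> darts D. label D d = e} = 2)"

definition mate :: "pd \<Rightarrow> nat \<times> nat \<Rightarrow> nat \<times> nat" where
  "mate D d = (THE d'. d' \<in> darts D \<and> d' \<noteq> d \<and> label D d' = label D d)"

definition rot :: "pd \<Rightarrow> nat \<times> nat \<Rightarrow> nat \<times> nat" where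
  "rot D d = (fst d, Suc (snd d) mod length (ends (D ! fst d)))"

text \<open>
  The faces of the map on the (closed, possibly disconnected) surface determined by the code are
  the orbits of \<open>rot \<circ> mate\<close>.  Each dart \<open>d\<close> determines one corner, between \<open>d\<close> and its
  clockwise neighbour; \<open>face D d\<close> is the face containing that corner.
\<close>

definition face :: "pd \<Rightarrow> nat \<times> nat \<Rightarrow> (nat \<times> nat) set" where
  "face D d = {((rot D \<circ> mate D) ^^ n) d | n. True}"

definition faces :: "pd \<Rightarrow> (nat \<times> nat) set set" where
  "faces D = face D ` darts D"

definition adjacent_darts :: "pd \<Rightarrow> ((nat \<times> nat) \<times> (nat \<times> nat)) set" where
  "adjacent_darts D =
     {(d, d'). d \<in> darts D \<and> d' \<in> darts D \<and> (fst d = fst d' \<or> label D d = label D d')}"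

text \<open>Connected components of the underlying graph (not components of the link).\<close>

definition graph_components :: "pd \<Rightarrow> (nat \<times> nat) set set" where
  "graph_components D = (\<lambda>d. {d'. (d, d') \<in> (adjacent_darts D)\<^sup>*}) ` darts D"

text \<open>
  Planarity: Euler's formula \<open>V - E + F = 2 C\<close>.  As every connected component satisfies
  \<open>V - E + F \<le> 2\<close>, this says that each component lies on a sphere.  The relative position of the
  components of a disconnected diagram is not recorded; it does not affect the link, since the
  components can be pulled apart vertically.
\<close>

definition planar :: "pd \<Rightarrow> bool" where
  "planar D \<longleftrightarrow>
     int (length D) - int (card (edges D)) + int (card (faces D))
       = 2 * int (card (graph_components D))"

definition link_diagram :: "pd \<Rightarrow> bool" where
  "link_diagram D \<longleftrightarrow> edges_have_two_ends D \<and> planar D"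


section \<open>Isotopy of links\<close>

inductive planar_move :: "pd \<Rightarrow> pd \<Rightarrow> bool" where
  permute: "mset D = mset E \<Longrightarrow> planar_move D E"
| rename: "inj_on f (edges D) \<Longrightarrow> planar_move D (map (map_piece f) D)"
| turn_Cross: "planar_move (Cross a b c d # D) (Cross c d a b # D)"
| turn_Joint: "planar_move (Joint a b # D) (Joint b a # D)"
| remove_Joint: "a \<noteq> b \<Longrightarrow>
    planar_move (Joint a b # D) (map (map_piece (\<lambda>x. if x = b then a else x)) D)"

text \<open>
  The Reidemeister moves.  They are only applied between planar diagrams (see below); then the
  monogon, bigon or triangle on the left-hand side really is a face, i.e. a disk, so that every
  instance is a genuine Reidemeister move.  In \<open>R3\<close> the six outer ends are \<open>p1, \<dots>, p6\<close> in
  counterclockwise order, the strands \<open>p1\<close>--\<open>p4\<close>, \<open>p2\<close>--\<open>p5\<close>, \<open>p3\<close>--\<open>p6\<close> contain the inner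
  edges \<open>a\<close>, \<open>b\<close>, \<open>c\<close> respectively, and \<open>p1\<close>--\<open>p4\<close> is the top strand.  The two versions of
  \<open>R1\<close> and of \<open>R3\<close> are mirror images of each other.
\<close>

inductive reidemeister_move :: "pd \<Rightarrow> pd \<Rightarrow> bool" where
  R1: "reidemeister_move (Cross e e a b # D) (Joint a b # D)"
| R1': "reidemeister_move (Cross a e e b # D) (Joint a b # D)"
| R2: "reidemeister_move
    (Cross n p r m # Cross s q n m # D)
    (Joint p q # Joint r s # D)"
| R3: "reidemeister_move
    (Cross p2 a b p1 # Cross p3 p4 c a # Cross p6 b c p5 # D)
    (Cross p5 a b p4 # Cross p6 p1 c a # Cross p3 b c p2 # D)"
| R3': "reidemeister_move
    (Cross p2 a b p1 # Cross p3 p4 c a # Cross p5 p6 b c # D)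
    (Cross p5 a b p4 # Cross p6 p1 c a # Cross p2 p3 b c # D)"

definition between_diagrams :: "(pd \<Rightarrow> pd \<Rightarrow> bool) \<Rightarrow> pd \<Rightarrow> pd \<Rightarrow> bool" where
  "between_diagrams M D E \<longleftrightarrow> link_diagram D \<and> link_diagram E \<and> (M D E \<or> M E D)"

text \<open>Two codes of the same diagram on the sphere.\<close>

definition same_diagram :: "pd \<Rightarrow> pd \<Rightarrow> bool" where
  "same_diagram = (between_diagrams planar_move)\<^sup>*\<^sup>*"

text \<open>
  By Reidemeister's theorem this is ambient isotopy of the (tame, unoriented) links in the
  3-sphere represented by the two diagrams.
\<close>

definition isotopic :: "pd \<Rightarrow> pd \<Rightarrow> bool" where
  "isotopic = (between_diagrams (\<lambda>D E. planar_move D E \<or> reidemeister_move D E))\<^sup>*\<^sup>*"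


section \<open>Classes of links\<close>

definition unlink :: "nat \<Rightarrow> pd" where
  "unlink n = map (\<lambda>i. Joint i i) [0..<n]"

definition unknot :: pd where
  "unknot = [Joint 0 0]"

definition trivial_link :: "pd \<Rightarrow> bool" where
  "trivial_link D \<longleftrightarrow> (\<exists>n. isotopic D (unlink n))"

text \<open>\<open>D1\<close> and \<open>D2\<close> have disjoint edge labels since all edges of \<open>D1 @ D2\<close> have two ends.\<close>

definition split_link :: "pd \<Rightarrow> bool" where
  "split_link D \<longleftrightarrow>
     (\<exists>D1 D2. D1 \<noteq> [] \<and> D2 \<noteq> [] \<and> link_diagram D1 \<and> link_diagram D2 \<and>
        link_diagram (D1 @ D2) \<and> isotopic D (D1 @ D2))"

text \<open>
  Connected sum: cut one edge of \<open>D1\<close> and one edge of \<open>D2\<close> (at a joint), and reconnect the four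
  ends crosswise.  Unoriented links have two ways of doing so; both arise, because
  \<open>Joint c d\<close> and \<open>Joint d c\<close> denote the same point.
\<close>

definition connected_sum :: "pd \<Rightarrow> pd \<Rightarrow> pd \<Rightarrow> bool" where
  "connected_sum D1 D2 D \<longleftrightarrow>
     link_diagram D1 \<and> link_diagram D2 \<and> link_diagram D \<and> edges D1 \<inter> edges D2 = {} \<and>
     (\<exists>a b c d E1 E2. D1 = Joint a b # E1 \<and> D2 = Joint c d # E2 \<and>
        D = Joint a c # Joint b d # E1 @ E2)"

definition prime_link :: "pd \<Rightarrow> bool" where
  "prime_link D \<longleftrightarrow>
     \<not> isotopic D unknot \<and>
     (\<forall>D1 D2 D'. connected_sum D1 D2 D' \<and> isotopic D D' \<longrightarrow>
        isotopic D1 unknot \<or> isotopic D2 unknot)"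

text \<open>
  \<open>T(2,k)\<close> as the closure of the 2-braid with \<open>\<bar>k\<bar>\<close> crossings, whose sign is that of \<open>k\<close>.  The
  left and right strands below the \<open>i\<close>-th crossing are labelled \<open>2 i\<close> and \<open>2 i + 1\<close>.
\<close>

definition torus_link_2 :: "int \<Rightarrow> pd" where
  "torus_link_2 k =
     (if k = 0 then [Joint 0 0, Joint 1 1]
      else let n = nat \<bar>k\<bar> in
        map (\<lambda>i. let l = 2 * i; r = 2 * i + 1; l' = 2 * (Suc i mod n); r' = l' + 1
                 in if k > 0 then Cross l r r' l' else Cross r r' l' l) [0..<n])"


section \<open>Reduced alternating diagrams\<close>

definition under_ends :: "pd \<Rightarrow> nat list" where
  "under_ends D = concat (map (\<lambda>p. case p of Cross a b c d \<Rightarrow> [a, c] | Joint a b \<Rightarrow> []) D)"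

definition over_ends :: "pd \<Rightarrow> nat list" where
  "over_ends D = concat (map (\<lambda>p. case p of Cross a b c d \<Rightarrow> [b, d] | Joint a b \<Rightarrow> []) D)"

text \<open>
  Along each component over- and undercrossings alternate iff every edge joins an overcrossing to
  an undercrossing.  Joints are allowed only as crossingless circles, so that edges are the edges
  of the actual link projection.
\<close>

definition alternating_diagram :: "pd \<Rightarrow> bool" where
  "alternating_diagram D \<longleftrightarrow>
     (\<forall>e\<in>edges D. Joint e e \<in> set D \<or>
        (count_list (under_ends D) e = 1 \<and> count_list (over_ends D) e = 1))"

text \<open>At each crossing the four corners belong to four distinct regions.\<close>

definition reduced_diagram :: "pd \<Rightarrow> bool" where
  "reduced_diagram D \<longleftrightarrow>
     (\<forall>i<length D. (\<exists>a b c d. D ! i = Cross a b c d) \<longrightarrow>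
        inj_on (\<lambda>k. face D (i, k)) {..<4})"


section \<open>Augmentations\<close>

text \<open>
  The disk bounded by the circle \<open>J\<close> meets the projection plane in a segment, drawn horizontally,
  which crosses the diagram \<open>D\<close> in two points: the joints \<open>Joint u1 v1\<close> (left) and
  \<open>Joint u2 v2\<close> (right), where \<open>u1, u2\<close> leave upwards and \<open>v1, v2\<close> downwards.  Tilting \<open>J\<close>
  slightly gives a diagram of the augmentation in which the front half of \<open>J\<close> (edges
  \<open>l, f, r\<close>) passes over the two strands, and, further down, the back half (edges \<open>l, g, r\<close>)
  passes under them; \<open>m1, m2\<close> are the parts of the strands seen inside \<open>J\<close>.  Planarity of the
  result forces the two joints to be joined by a segment not meeting \<open>D\<close> in between.  The two
  points may lie on the same edge of \<open>D\<close>.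
\<close>

definition augmentation :: "pd \<Rightarrow> pd \<Rightarrow> bool" where
  "augmentation D L \<longleftrightarrow> link_diagram L \<and>
     (\<exists>u1 v1 u2 v2 m1 m2 l f r g E.
        same_diagram D (Joint u1 v1 # Joint u2 v2 # E) \<and>
        L = Cross u1 l m1 f # Cross u2 f m2 r #
            Cross g m1 l v1 # Cross r m2 g v2 # E)"

definition augmented_alternating_link :: "pd \<Rightarrow> bool" where
  "augmented_alternating_link L \<longleftrightarrow>
     (\<exists>D L'. link_diagram D \<and> reduced_diagram D \<and> alternating_diagram D \<and>
        \<not> trivial_link D \<and> \<not> split_link D \<and> prime_link D \<and>
        (\<forall>k. \<not> isotopic D (torus_link_2 k)) \<and>
        augmentation D L' \<and> link_diagram L \<and> isotopic L L')"


section \<open>The involutory quandle of a link\<close>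

text \<open>Arcs: edges are joined to one arc through overcrossings and joints.\<close>

definition arc_steps :: "pd \<Rightarrow> (nat \<times> nat) set" where
  "arc_steps D = {(b, d) | a b c d. Cross a b c d \<in> set D} \<union> {(a, b) | a b. Joint a b \<in> set D}"

definition arc_of :: "pd \<Rightarrow> nat \<Rightarrow> nat set" where
  "arc_of D e = {e'. (e, e') \<in> (arc_steps D \<union> (arc_steps D)\<inverse>)\<^sup>*}"

definition arcs :: "pd \<Rightarrow> nat set set" where
  "arcs D = arc_of D ` edges D"

definition IQ :: "pd \<Rightarrow> nat set qterm set magma_struct" where
  "IQ D = presented_iq (arcs D)
     {(arc_of D a, arc_of D b, arc_of D c) | a b c d. Cross a b c d \<in> set D}"

end

theory Submission
  imports Defs
begin

text \<open>A left-order turns every crossing into a betweenness condition.  If \<open>z = x * y\<close> in an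
involutory quandle and \<open>x < y\<close>, then \<open>x = x * x < x * y = z\<close>; together with the same
computation for \<open>x = z * y\<close> this gives \<open>x = y = z\<close>, or \<open>x < y < z\<close>, or \<open>z < y < x\<close>
(\<open>left_order_between\<close>).  In an alternating diagram every strand between two neighbouring
crossings leaves one of them below and enters the other one above.  So the crossings are the
vertices of a digraph with two arrows out of and two arrows into each vertex, and the colour of a
crossing, i.e. of its over-arc, lies between the colours of its two successors.  Such a function
is constant on every component: the vertices where it is minimal are closed under successors, and
in a digraph of this kind they are then also closed under predecessors (\<open>rigidity\<close>).

The circle \<open>J\<close> of the augmentation cuts the diagram at two points.  Let \<open>j\<close> be the colour of
its front half, and \<open>u\<^sub>i\<close>, \<open>v\<^sub>i\<close> the colours above and below the \<open>i\<close>-th point.  The four crossings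
of \<open>J\<close> say that \<open>v\<^sub>i = u\<^sub>i * j\<close> and that the back half has the colour \<open>j * v\<^sub>1 = j * v\<^sub>2\<close>.  Left
multiplications are strictly increasing, so \<open>v\<^sub>1 = v\<^sub>2 = v\<close> and \<open>u\<^sub>1 = u\<^sub>2 = u\<close>.  Moreover
\<open>u \<noteq> v\<close>, since otherwise \<open>u = j\<close>, although \<open>J\<close> and the rest of the link are different
components.  Thus the alternating diagram is coloured as usual, except that the colour jumps
between \<open>u\<close> and \<open>v\<close> at the two points.  If both points lie on the same strand, the jumps
cancel.  If they lie on different strands and both jumps go up, or both go down, along the
direction of the arrows, a jump contradicts rigidity.  If one goes up and the other one down,
exchanging the targets of the two arrows (which cuts the diagram open along the disk of \<open>J\<close>)
gives a digraph of the same kind without jumps.  Hence in all remaining cases the colour is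
constant on a component of the digraph, possibly after the exchange
(\<open>cut_colouring_not_universal\<close>).

This is impossible, because the colouring of a diagram in its involutory quandle is universal:
every colouring in a dihedral quandle \<open>\<int>/n\<close> factors through it, and a component has a
colouring in some \<open>\<int>/n\<close> that is not constant (\<open>nonconstant_fox\<close>).  The latter is a form
of the fact that the determinant of a link exceeds 1 if it has a connected reduced alternating
diagram with at least one crossing.  For vertices \<open>a \<noteq> b\<close> there are integers \<open>t > 0\<close> and \<open>Y\<close> such that twice the value of \<open>Y\<close> minus
its values at the two successors is \<open>t\<close> at \<open>a\<close>, \<open>- t\<close> at \<open>b\<close> and \<open>0\<close> elsewhere; modulo \<open>t\<close>
this is a colouring.  If all these colourings were constant, division by \<open>t\<close> would give integral
solutions for \<open>t = 1\<close>.  The set where such a solution is maximal contains \<open>a\<close> but not \<open>b\<close>, and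
exactly one arrow leaves it.  A smallest set that exactly one arrow leaves then consists of one
vertex with a loop.  Choosing it so as to avoid the only loop that the exchange can create, one
finds a monogon in the diagram, which is therefore not reduced.

To speak about the diagram of \<open>L\<close> and the diagram with \<open>J\<close> at the same time, universal
colourings are transported along Reidemeister moves (\<open>universal_colouring_isotopic\<close>).\<close>

section \<open>Digraphs with two arrows into and two arrows out of every vertex\<close>

text \<open>Integrated against test functions, the condition on \<open>h\<close> says that exactly two of the arrows
\<open>i \<rightarrow> f i\<close> and \<open>i \<rightarrow> g i\<close> end in each vertex.  In this form it survives the passage to
closed subsets and is easily checked by reindexing a sum.\<close>

definition balanced :: "'v set \<Rightarrow> ('v \<Rightarrow> 'v) \<Rightarrow> ('v \<Rightarrow> 'v) \<Rightarrow> bool" where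
  "balanced V f g \<longleftrightarrow> finite V \<and> f ` V \<subseteq> V \<and> g ` V \<subseteq> V \<and>
     (\<forall>h :: 'v \<Rightarrow> int. (\<Sum>i\<in>V. h (f i) + h (g i)) = (\<Sum>i\<in>V. 2 * h i))"

lemma balancedD:
  assumes "balanced V f g"
  shows "finite V" "\<And>i. i \<in> V \<Longrightarrow> f i \<in> V" "\<And>i. i \<in> V \<Longrightarrow> g i \<in> V"
    "\<And>h :: 'v \<Rightarrow> int. (\<Sum>i\<in>V. h (f i) + h (g i)) = (\<Sum>i\<in>V. 2 * h i)"
  using assms unfolding balanced_def by blast+

definition out_closed :: "('v \<Rightarrow> 'v) \<Rightarrow> ('v \<Rightarrow> 'v) \<Rightarrow> 'v set \<Rightarrow> bool" where
  "out_closed f g T \<longleftrightarrow> (\<forall>i\<in>T. f i \<in> T \<and> g i \<in> T)"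

definition exits :: "'v set \<Rightarrow> ('v \<Rightarrow> 'v) \<Rightarrow> ('v \<Rightarrow> 'v) \<Rightarrow> 'v set \<Rightarrow> int" where
  "exits V f g T = (\<Sum>i\<in>V. of_bool (i \<in> T \<and> f i \<notin> T) + of_bool (i \<in> T \<and> g i \<notin> T))"

lemma exits_nonneg: "exits V f g T \<ge> 0"
  unfolding exits_def by (intro sum_nonneg) simp

lemma exits_eq_0_iff:
  assumes "finite V" "T \<subseteq> V"
  shows "exits V f g T = 0 \<longleftrightarrow> out_closed f g T"
proof -
  have "exits V f g T = 0 \<longleftrightarrow>
      (\<forall>i\<in>V. of_bool (i \<in> T \<and> f i \<notin> T) + of_bool (i \<in> T \<and> g i \<notin> T) = (0::int))"
    unfolding exits_def using assms(1) by (intro sum_nonneg_eq_0_iff) simp_all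
  also have "\<dots> \<longleftrightarrow> out_closed f g T"
    using assms(2) by (auto simp: out_closed_def of_bool_def add_nonneg_eq_0_iff)
  finally show ?thesis .
qed

text \<open>The numbers of arrows leaving and entering \<open>T\<close> agree, because as many arrows start in \<open>T\<close> as end
there.\<close>

lemma exits_complement:
  assumes "balanced V f g" "T \<subseteq> V"
  shows "exits V f g (V - T) = exits V f g T"
proof -
  note b = balancedD[OF assms(1)]
  have "exits V f g (V - T) - exits V f g T
      = (\<Sum>i\<in>V. of_bool (f i \<in> T) + of_bool (g i \<in> T)) - (\<Sum>i\<in>V. 2 * of_bool (i \<in> T))"
    unfolding exits_def sum_subtractf[symmetric]
    using assms(2) b(2,3) by (intro sum.cong) (auto simp: of_bool_def)
  also have "\<dots> = 0" using b(4)[of "\<lambda>i. of_bool (i \<in> T)"] by simp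
  finally show ?thesis by simp
qed

lemma exits_submodular:
  "exits V f g (S \<inter> T) + exits V f g (S \<union> T) \<le> exits V f g S + exits V f g T"
  unfolding exits_def sum.distrib[symmetric] by (intro sum_mono) (auto simp: of_bool_def)

lemma out_closed_complement:
  assumes "balanced V f g" "T \<subseteq> V" "out_closed f g T"
  shows "out_closed f g (V - T)"
  using exits_complement[OF assms(1,2)] exits_eq_0_iff[OF balancedD(1)[OF assms(1)]] assms
  by (metis Diff_subset)

lemma balanced_subset:
  assumes "balanced V f g" "T \<subseteq> V" "out_closed f g T"
  shows "balanced T f g"
  unfolding balanced_def
proof (intro conjI allI)
  note b = balancedD[OF assms(1)]
  have co: "out_closed f g (V - T)" by (rule out_closed_complement[OF assms])
  fix h :: "'a \<Rightarrow> int"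
  let ?h = "\<lambda>i. if i \<in> T then h i else 0"
  have "(\<Sum>i\<in>T. h (f i) + h (g i)) = (\<Sum>i\<in>V. ?h (f i) + ?h (g i))"
    using assms co b(1) by (intro sum.mono_neutral_cong_left) (auto simp: out_closed_def)
  also have "\<dots> = (\<Sum>i\<in>V. 2 * ?h i)" by (rule b(4))
  also have "\<dots> = (\<Sum>i\<in>T. 2 * h i)"
    using assms(2) b(1) by (intro sum.mono_neutral_cong_right) auto
  finally show "(\<Sum>i\<in>T. h (f i) + h (g i)) = (\<Sum>i\<in>T. 2 * h i)" .
qed (use assms balancedD(1)[OF assms(1)] in \<open>auto simp: out_closed_def intro: finite_subset\<close>)

text \<open>A vertex where \<open>p\<close> is minimal forces \<open>wf\<close> and \<open>wg\<close>, and hence \<open>p\<close> at its successors, to the same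
minimal value.  So the vertices with minimal value form a closed set; its complement is closed as
well, and induction applies to it.  The functions \<open>wf\<close> and \<open>wg\<close> are the colours at the start of
the two arrows.  Allowing them to exceed the colours at the end covers colours that jump down along
some arrows, which turns out to be impossible.\<close>

lemma rigidity:
  fixes p wf wg :: "'v \<Rightarrow> int"
  assumes "balanced V f g"
    and "\<And>i. i \<in> V \<Longrightarrow> p (f i) \<le> wf i" "\<And>i. i \<in> V \<Longrightarrow> p (g i) \<le> wg i"
    and "\<And>i. i \<in> V \<Longrightarrow> p i \<le> wf i \<Longrightarrow> p i \<le> wg i \<Longrightarrow> wf i = p i \<and> wg i = p i"
    and "i \<in> V"
  shows "wf i = p (f i) \<and> wg i = p (g i) \<and> p (f i) = p i \<and> p (g i) = p i"
  using assms
proof (induction "card V" arbitrary: V rule: less_induct)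
  case less
  note b = balancedD[OF less.prems(1)]
  define m where "m = Min (p ` V)"
  define T where "T = {i \<in> V. p i = m}"
  have m: "m \<le> p j" if "j \<in> V" for j using b(1) that by (simp add: m_def)
  have "m \<in> p ` V" unfolding m_def using b(1) less.prems(5) by (intro Min_in) auto
  then have "T \<noteq> {}" by (auto simp: T_def)
  have TV: "T \<subseteq> V" by (auto simp: T_def)
  have good: "wf j = m \<and> wg j = m \<and> p (f j) = m \<and> p (g j) = m" if "j \<in> T" for j
    using less.prems(2-4)[of j] m[OF b(2)[of j]] m[OF b(3)[of j]] that by (force simp: T_def)
  have cl: "out_closed f g T"
    unfolding out_closed_def using good b(2,3) by (auto simp: T_def)
  show ?case
  proof (cases "i \<in> T")
    case True
    then show ?thesis using good[OF True] by (auto simp: T_def)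
  next
    case False
    have "card (V - T) < card V"
      using \<open>T \<noteq> {}\<close> TV b(1) by (intro psubset_card_mono) auto
    moreover have "balanced (V - T) f g"
      using balanced_subset[OF less.prems(1)] out_closed_complement[OF less.prems(1) TV cl] by simp
    ultimately show ?thesis
      using less.hyps[of "V - T"] less.prems(2-5) False by blast
  qed
qed

text \<open>Fewer homogeneous equations than unknowns: Gaussian elimination by cross-multiplication, which
stays within the integers.\<close>

lemma homogeneous_system:
  fixes M :: "'a \<Rightarrow> 'b \<Rightarrow> int"
  assumes "finite A" "finite B" "card A < card B"
  shows "\<exists>z. (\<exists>j\<in>B. z j \<noteq> 0) \<and> (\<forall>i\<in>A. (\<Sum>j\<in>B. M i j * z j) = 0)"
  using assms
proof (induction A arbitrary: B M rule: finite_induct)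
  case empty
  then have "B \<noteq> {}" by auto
  then show ?case by (intro exI[of _ "\<lambda>_. 1"]) auto
next
  case (insert a A)
  show ?case
  proof (cases "\<forall>j\<in>B. M a j = 0")
    case True
    obtain z where "\<exists>j\<in>B. z j \<noteq> 0" "\<forall>i\<in>A. (\<Sum>j\<in>B. M i j * z j) = 0"
      using insert.IH[of B M] insert.prems insert.hyps by auto
    then show ?thesis using True by (intro exI[of _ z]) (auto intro: sum.neutral)
  next
    case False
    then obtain k where k: "k \<in> B" "M a k \<noteq> 0" by blast
    \<comment> \<open>Equation \<open>a\<close> is used to eliminate the unknown \<open>k\<close>.\<close>
    define B' where "B' = B - {k}"
    define M' where "M' = (\<lambda>i j. M a k * M i j - M i k * M a j)"
    have B: "B = insert k B'" "k \<notin> B'" "finite B'" using k insert.prems by (auto simp: B'_def)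
    have "card A < card B'" using insert.prems insert.hyps B by simp
    then obtain z where z: "\<exists>j\<in>B'. z j \<noteq> 0" "\<forall>i\<in>A. (\<Sum>j\<in>B'. M' i j * z j) = 0"
      using insert.IH[of B' M'] B by auto
    define z' where "z' = (\<lambda>j. if j = k then - (\<Sum>j\<in>B'. M a j * z j) else M a k * z j)"
    have eq: "(\<Sum>j\<in>B. M i j * z' j) = (\<Sum>j\<in>B'. M' i j * z j)" for i
    proof -
      have "(\<Sum>j\<in>B'. M i j * z' j) = (\<Sum>j\<in>B'. M a k * (M i j * z j))"
        using B by (intro sum.cong) (auto simp: z'_def)
      then show ?thesis
        using B by (simp add: z'_def M'_def left_diff_distrib sum_subtractf sum_distrib_left
            algebra_simps)
    qed
    have "(\<Sum>j\<in>B. M i j * z' j) = 0" if "i \<in> insert a A" for i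
      using that z(2) by (auto simp: eq) (simp add: M'_def)
    moreover have "\<exists>j\<in>B. z' j \<noteq> 0" using z(1) B k by (auto simp: z'_def)
    ultimately show ?thesis by blast
  qed
qed

definition strongly_connected :: "'v set \<Rightarrow> ('v \<Rightarrow> 'v) \<Rightarrow> ('v \<Rightarrow> 'v) \<Rightarrow> bool" where
  "strongly_connected V f g \<longleftrightarrow> (\<forall>T\<subseteq>V. T \<noteq> {} \<longrightarrow> out_closed f g T \<longrightarrow> T = V)"

text \<open>The equations at all vertices but \<open>b\<close> form a homogeneous system for the values of \<open>Y\<close> away from
\<open>b\<close>, normalised by \<open>Y b = 0\<close>, and for \<open>t\<close>; there is one unknown more than there are equations.
The equation at \<open>b\<close> follows by summing the others.  If \<open>t\<close> were \<open>0\<close>, then \<open>Y\<close> would be constant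
by \<open>rigidity\<close>, and the solution trivial.\<close>

lemma potential_exists:
  assumes bal: "balanced V f g" and conn: "strongly_connected V f g"
    and ab: "a \<in> V" "b \<in> V" "a \<noteq> b"
  shows "\<exists>Y t. t > 0 \<and>
    (\<forall>i\<in>V. 2 * Y i - Y (f i) - Y (g i) = (t :: int) * (of_bool (i = a) - of_bool (i = b)))"
proof -
  note b = balancedD[OF bal]
  \<comment> \<open>The column \<open>b\<close> is free because of \<open>Y b = 0\<close> and holds the unknown \<open>t\<close>.\<close>
  define M :: "'a \<Rightarrow> 'a \<Rightarrow> int" where
    "M = (\<lambda>i j. if j = b then - of_bool (i = a)
                else 2 * of_bool (j = i) - of_bool (j = f i) - of_bool (j = g i))"
  have "card (V - {b}) < card V" using ab b(1) by (intro psubset_card_mono) auto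
  then obtain z where z: "\<exists>j\<in>V. z j \<noteq> 0" "\<forall>i\<in>V - {b}. (\<Sum>j\<in>V. M i j * z j) = 0"
    using homogeneous_system[of "V - {b}" V M] b(1) by auto
  define Y where "Y = (\<lambda>i. if i = b then 0 else z i)"
  define t where "t = z b"
  have M_eq: "(\<Sum>j\<in>V. M i j * z j) = 2 * Y i - Y (f i) - Y (g i) - t * of_bool (i = a)"
    if i: "i \<in> V" "i \<noteq> b" for i
  proof -
    have "(\<Sum>j\<in>V. M i j * z j) = (\<Sum>j\<in>V. (if j = i then 2 * Y i else 0) -
        (if j = f i then Y (f i) else 0) - (if j = g i then Y (g i) else 0)
        - (if j = b then t * of_bool (i = a) else 0))"
      using i by (intro sum.cong) (auto simp: M_def Y_def t_def)
    also have "\<dots> = 2 * Y i - Y (f i) - Y (g i) - t * of_bool (i = a)"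
      using i ab b(1-3) by (simp add: sum_subtractf)
    finally show ?thesis .
  qed
  let ?L = "\<lambda>i. 2 * Y i - Y (f i) - Y (g i)"
  have L: "?L i = t * of_bool (i = a)" if "i \<in> V" "i \<noteq> b" for i
    using z(2) M_eq that by auto
  have "(\<Sum>i\<in>V. ?L i) = 0" using b(4)[of Y] by (simp add: sum_subtractf sum.distrib)
  moreover have "(\<Sum>i\<in>V. ?L i) = ?L b + (\<Sum>i\<in>V - {b}. t * of_bool (i = a))"
    using b(1) ab L by (subst sum.remove[of _ b]) auto
  moreover have "(\<Sum>i\<in>V - {b}. t * of_bool (i = a)) = (\<Sum>i\<in>V - {b}. if i = a then t else 0)"
    by (intro sum.cong) auto
  ultimately have Lb: "?L b = - t" using ab b(1) by simp
  have L': "?L i = t * (of_bool (i = a) - of_bool (i = b))" if "i \<in> V" for i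
    using L[of i] Lb that ab by (cases "i = b") auto
  have "t \<noteq> 0"
  proof
    assume t: "t = 0"
    have const: "Y (f i) = Y i \<and> Y (g i) = Y i" if "i \<in> V" for i
    proof -
      have "Y (f j) = Y j \<and> Y (g j) = Y j" if "j \<in> V" "Y j \<le> Y (f j)" "Y j \<le> Y (g j)" for j
        using L'[OF that(1)] t that(2,3) by simp
      then show ?thesis
        using rigidity[OF bal, of Y "\<lambda>i. Y (f i)" "\<lambda>i. Y (g i)" i] that by auto
    qed
    have "out_closed f g {i \<in> V. Y i = Y b}"
      using const b(2,3) by (simp add: out_closed_def)
    moreover have "{i \<in> V. Y i = Y b} \<subseteq> V" "{i \<in> V. Y i = Y b} \<noteq> {}" using ab by auto
    ultimately have "{i \<in> V. Y i = Y b} = V"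
      using conn unfolding strongly_connected_def by blast
    then have "Y i = Y b" if "i \<in> V" for i using that by blast
    then have "Y i = 0" if "i \<in> V" for i using that by (simp add: Y_def)
    then have "z i = 0" if "i \<in> V" for i
      using that t by (cases "i = b") (fastforce simp: Y_def t_def)+
    then show False using z(1) by blast
  qed
  show ?thesis
  proof (cases "t > 0")
    case True then show ?thesis using L' by blast
  next
    case False
    have "2 * (- Y i) - (- Y (f i)) - (- Y (g i)) = - t * (of_bool (i = a) - of_bool (i = b))"
      if "i \<in> V" for i using L'[OF that] by simp
    moreover have "- t > 0" using False \<open>t \<noteq> 0\<close> by simp
    ultimately show ?thesis by (intro exI[of _ "\<lambda>i. - Y i"] exI[of _ "- t"]) blast
  qed
qed

text \<open>The colourings modulo \<open>n\<close> of the digraph of an alternating diagram, where \<open>Y i\<close> colours the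
over-arc at crossing \<open>i\<close> (Fox \<open>n\<close>-colourings).\<close>

definition fox :: "int \<Rightarrow> 'v set \<Rightarrow> ('v \<Rightarrow> 'v) \<Rightarrow> ('v \<Rightarrow> 'v) \<Rightarrow> ('v \<Rightarrow> int) \<Rightarrow> bool" where
  "fox n V f g Y \<longleftrightarrow> (\<forall>i\<in>V. n dvd 2 * Y i - Y (f i) - Y (g i))"

text \<open>If all colourings modulo \<open>t\<close> are constant, the potential of \<open>potential_exists\<close> becomes an
integral one for \<open>t = 1\<close> after division by \<open>t\<close>.  It can only drop along an arrow from the set
where it is maximal by one, and only along one arrow, which starts in \<open>a\<close>.\<close>

lemma single_exit_cut:
  assumes bal: "balanced V f g" and conn: "strongly_connected V f g"
    and ab: "a \<in> V" "b \<in> V" "a \<noteq> b"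
    and const: "\<And>n Y i j. n > 0 \<Longrightarrow> fox n V f g Y \<Longrightarrow> i \<in> V \<Longrightarrow> j \<in> V \<Longrightarrow> n dvd Y i - Y j"
  shows "\<exists>T\<subseteq>V. a \<in> T \<and> b \<notin> T \<and> exits V f g T = 1"
proof -
  note b = balancedD[OF bal]
  obtain Y and t :: int where Y: "t > 0"
    "\<forall>i\<in>V. 2 * Y i - Y (f i) - Y (g i) = t * (of_bool (i = a) - of_bool (i = b))"
    using potential_exists[OF bal conn ab] by blast
  then have "fox t V f g Y" by (auto simp: fox_def)
  then have dvd: "t dvd Y i - Y b" if "i \<in> V" for i using const Y(1) that ab by blast
  define y where "y = (\<lambda>i. (Y i - Y b) div t)"
  have y: "Y i = Y b + t * y i" if "i \<in> V" for i using dvd[OF that] by (simp add: y_def)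
  have Ly: "2 * y i - y (f i) - y (g i) = of_bool (i = a) - of_bool (i = b)" if "i \<in> V" for i
  proof -
    have "t * (2 * y i - y (f i) - y (g i)) = 2 * Y i - Y (f i) - Y (g i)"
      using y[OF that] y[OF b(2)[OF that]] y[OF b(3)[OF that]] by (simp add: algebra_simps)
    also have "\<dots> = t * (of_bool (i = a) - of_bool (i = b))" using Y(2) that by blast
    finally show ?thesis using Y(1) by simp
  qed
  \<comment> \<open>No arrow leaves the top level set \<open>T\<close> except one starting in \<open>a\<close>: elsewhere the value
    at a vertex is at most the mean of the values at its successors.\<close>
  define m where "m = Max (y ` V)"
  define T where "T = {i \<in> V. y i = m}"
  have m: "y j \<le> m" if "j \<in> V" for j using b(1) that by (simp add: m_def)
  have "m \<in> y ` V" unfolding m_def using b(1) ab by (intro Max_in) auto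
  then have "T \<noteq> {}" by (auto simp: T_def)
  have TV: "T \<subseteq> V" by (auto simp: T_def)
  have stay: "f i \<in> T \<and> g i \<in> T" if "i \<in> T" "i \<noteq> a" for i
    using Ly[of i] m[OF b(2)[of i]] m[OF b(3)[of i]] b(2,3)[of i] that by (auto simp: T_def of_bool_def split: if_splits)
  have bT: "b \<notin> T"
    using Ly[of b] m[OF b(2)[of b]] m[OF b(3)[of b]] ab by (auto simp: T_def)
  have aT: "a \<in> T"
  proof (rule ccontr)
    assume "a \<notin> T"
    then have "out_closed f g T" using stay unfolding out_closed_def by metis
    then have "T = V" using conn TV \<open>T \<noteq> {}\<close> unfolding strongly_connected_def by blast
    then show False using \<open>a \<notin> T\<close> ab by blast
  qed
  have one: "(f a \<notin> T) = (g a \<in> T)"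
    using Ly[of a] m[OF b(2)[of a]] m[OF b(3)[of a]] b(2,3)[of a] aT ab by (auto simp: T_def)
  have "exits V f g T = (\<Sum>i\<in>V. if i = a then 1 else 0)"
    unfolding exits_def using stay one aT by (intro sum.cong) (auto simp: of_bool_def)
  also have "\<dots> = 1" using b(1) ab by simp
  finally show ?thesis using TV aT bT by blast
qed

text \<open>Otherwise \<open>single_exit_cut\<close> separates any two vertices.  Applied to two vertices \<open>a\<close>, \<open>d\<close> of a
smallest set \<open>T\<close> avoiding \<open>c0\<close> that exactly one arrow leaves, it yields a cut \<open>S\<close>, and by
submodularity either \<open>S \<inter> T\<close> or the complement of \<open>S\<close> is a smaller such set.  So \<open>T\<close> is a
single vertex, and one of its two arrows has to be a loop.  One vertex \<open>c0\<close> may carry a loop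
because exchanging the targets of two arrows can create one.\<close>

lemma nonconstant_fox:
  assumes bal: "balanced V f g" and conn: "strongly_connected V f g"
    and c0: "c0 \<in> V" and loops: "\<And>i. i \<in> V \<Longrightarrow> i \<noteq> c0 \<Longrightarrow> f i \<noteq> i \<and> g i \<noteq> i"
    and other: "c1 \<in> V" "c1 \<noteq> c0"
  shows "\<exists>n Y i. n > 0 \<and> fox n V f g Y \<and> i \<in> V \<and> \<not> n dvd Y i - Y c0"
proof (rule ccontr)
  assume "\<not> ?thesis"
  then have c: "n dvd Y i - Y c0" if "n > 0" "fox n V f g Y" "i \<in> V" for n Y i
    using that by blast
  have const: "n dvd Y i - Y j" if "n > 0" "fox n V f g Y" "i \<in> V" "j \<in> V" for n Y i j
    using dvd_diff[OF c[OF that(1-3)] c[OF that(1,2,4)]] by simp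
  note cut = single_exit_cut[OF bal conn _ _ _ const]
  note b = balancedD[OF bal]
  define P where "P = (\<lambda>T. T \<subseteq> V \<and> T \<noteq> {} \<and> c0 \<notin> T \<and> exits V f g T = 1)"
  have "\<exists>T. P T" using cut[OF other(1) c0 other(2)] by (auto simp: P_def)
  then obtain T where T: "P T" and minimal: "\<And>S. P S \<Longrightarrow> card T \<le> card S"
    using ex_has_least_nat[of P _ card] by blast
  have TV: "T \<subseteq> V" "T \<noteq> {}" "c0 \<notin> T" "exits V f g T = 1" using T by (auto simp: P_def)
  have finT: "finite T" using TV(1) b(1) by (rule finite_subset)
  have smaller: False if "P S" "S \<subset> T" for S
    using minimal[OF that(1)] psubset_card_mono[OF finT that(2)] by simp
  have pos: "exits V f g S \<ge> 1" if "S \<subseteq> V" "S \<noteq> {}" "S \<noteq> V" for S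
  proof -
    have "\<not> out_closed f g S" using conn that unfolding strongly_connected_def by blast
    then show ?thesis
      using exits_eq_0_iff[OF b(1) that(1), of f g] exits_nonneg[of V f g S] by linarith
  qed
  obtain a where a: "a \<in> T" using TV(2) by blast
  have "T = {a}"
  proof (rule ccontr)
    assume "T \<noteq> {a}"
    then obtain d where d: "d \<in> T" "d \<noteq> a" using a by blast
    obtain S where S: "S \<subseteq> V" "a \<in> S" "d \<notin> S" "exits V f g S = 1"
      using cut[of a d] a d TV(1) by blast
    \<comment> \<open>\<open>S\<close> contains \<open>a\<close> but not \<open>d\<close>, hence both \<open>T \<inter> S\<close> and \<open>T - S\<close> are smaller than \<open>T\<close>.\<close>
    have sub: "exits V f g (S \<inter> T) + exits V f g (S \<union> T) \<le> 2"
      using exits_submodular[of V f g S T] S(4) TV(4) by simp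
    have inter: "exits V f g (S \<inter> T) \<ge> 1" using S d a TV by (intro pos) auto
    show False
    proof (cases "S \<union> T = V")
      case False
      then have "exits V f g (S \<union> T) \<ge> 1" using S TV by (intro pos) auto
      then have "P (S \<inter> T)" using sub inter S TV a by (auto simp: P_def)
      then show False using smaller d S by blast
    next
      case True
      then have "P (V - S)" 
        using exits_complement[OF bal S(1)] S TV d unfolding P_def by auto
      then show False using smaller True a S by blast
    qed
  qed
  moreover have "f a \<noteq> a \<and> g a \<noteq> a" using loops[of a] a TV by blast
  ultimately have "exits V f g T = (\<Sum>i\<in>V. if i = a then 2 else 0)"
    unfolding exits_def by (intro sum.cong) (auto simp: of_bool_def)
  then show False using TV a b(1) by auto
qed

text \<open>The smallest closed set containing \<open>c\<close> is strongly connected, since complements of closed sets are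
closed.\<close>

lemma component_exists:
  assumes bal: "balanced V f g" and c: "c \<in> V"
  shows "\<exists>S\<subseteq>V. c \<in> S \<and> out_closed f g S \<and> balanced S f g \<and> strongly_connected S f g"
proof -
  define S where "S = \<Inter>{T. T \<subseteq> V \<and> c \<in> T \<and> out_closed f g T}"
  have "out_closed f g V" using balancedD(2,3)[OF bal] by (simp add: out_closed_def)
  then have S: "S \<subseteq> V" "c \<in> S" "out_closed f g S"
    using c by (auto simp: S_def out_closed_def)
  have least: "S \<subseteq> T" if "T \<subseteq> V" "c \<in> T" "out_closed f g T" for T
    using that by (auto simp: S_def)
  have balS: "balanced S f g" using balanced_subset[OF bal S(1,3)] .
  have "T = S" if T: "T \<subseteq> S" "T \<noteq> {}" "out_closed f g T" for T
  proof (cases "c \<in> T")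
    case True
    then show ?thesis using least[of T] T S(1) by blast
  next
    case False
    have "out_closed f g (S - T)" using out_closed_complement[OF balS T(1,3)] .
    then have "S \<subseteq> S - T" using least[of "S - T"] False S by blast
    then show ?thesis using T by blast
  qed
  then show ?thesis using S balS unfolding strongly_connected_def by blast
qed

section \<open>Colourings of diagrams by involutory quandles\<close>

lemma quandleD:
  assumes "involutory_quandle Q"
  shows "\<And>x y. x \<in> elems Q \<Longrightarrow> y \<in> elems Q \<Longrightarrow> act Q x y \<in> elems Q"
    "\<And>x. x \<in> elems Q \<Longrightarrow> act Q x x = x"
    "\<And>x y. x \<in> elems Q \<Longrightarrow> y \<in> elems Q \<Longrightarrow> act Q (act Q x y) y = x"
    "\<And>x y z. x \<in> elems Q \<Longrightarrow> y \<in> elems Q \<Longrightarrow> z \<in> elems Q \<Longrightarrow>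
       act Q (act Q x y) z = act Q (act Q x z) (act Q y z)"
  using assms unfolding involutory_quandle_def quandle_def by blast+

text \<open>The core quandle of \<open>\<int>/n\<close> on the representatives \<open>k = k mod n\<close>, whose colourings are the Fox
\<open>n\<close>-colourings.\<close>

definition dihedral :: "int \<Rightarrow> int magma_struct" where
  "dihedral n = \<lparr>elems = {k. k mod n = k}, act = (\<lambda>x y. (2 * y - x) mod n)\<rparr>"

lemma elems_dihedral: "x \<in> elems (dihedral n) \<longleftrightarrow> x mod n = x"
  by (simp add: dihedral_def)

lemma act_dihedral: "act (dihedral n) x y = (2 * y - x) mod n"
  by (simp add: dihedral_def)

lemma involutory_quandle_dihedral: "involutory_quandle (dihedral n)"
proof -
  have flip: "(2 * y - (2 * y - x) mod n) mod n = x mod n" for x y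
    by (metis diff_diff_eq2 add_diff_cancel_left' mod_diff_right_eq)
  have distrib: "(2 * z - (2 * y - x) mod n) mod n =
      (2 * ((2 * z - y) mod n) - (2 * z - x) mod n) mod n" for x y z
  proof -
    have eq: "2 * z - (2 * y - x) = 2 * (2 * z - y) - (2 * z - x)" by simp
    have "(2 * ((2 * z - y) mod n) - (2 * z - x) mod n) mod n
        = (2 * ((2 * z - y) mod n) mod n - (2 * z - x) mod n) mod n"
      by (rule mod_diff_left_eq[symmetric])
    also have "\<dots> = (2 * (2 * z - y) mod n - (2 * z - x) mod n) mod n"
      by (simp only: mod_mult_right_eq)
    also have "\<dots> = (2 * z - (2 * y - x)) mod n"
      unfolding eq by (rule mod_diff_eq)
    also have "\<dots> = (2 * z - (2 * y - x) mod n) mod n"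
      by (rule mod_diff_right_eq[symmetric])
    finally show ?thesis ..
  qed
  show ?thesis
    unfolding involutory_quandle_def quandle_def
  proof (intro conjI ballI)
    fix x y assume "x \<in> elems (dihedral n)" "y \<in> elems (dihedral n)"
    then have x: "x mod n = x" by (simp add: elems_dihedral)
    show *: "act (dihedral n) (act (dihedral n) x y) y = x"
      by (simp only: act_dihedral flip x)
    show "\<exists>!z. z \<in> elems (dihedral n) \<and> act (dihedral n) z y = x"
    proof (rule ex1I[of _ "act (dihedral n) x y"])
      show "act (dihedral n) x y \<in> elems (dihedral n) \<and>
          act (dihedral n) (act (dihedral n) x y) y = x"
        using * by (simp add: elems_dihedral act_dihedral)
      fix z assume "z \<in> elems (dihedral n) \<and> act (dihedral n) z y = x"
      then have "z mod n = z" "x = (2 * y - z) mod n"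
        by (auto simp: elems_dihedral act_dihedral)
      then show "z = act (dihedral n) x y"
        by (simp only: act_dihedral flip)
    qed
  next
    fix x y z
    show "act (dihedral n) (act (dihedral n) x y) z =
        act (dihedral n) (act (dihedral n) x z) (act (dihedral n) y z)"
      unfolding act_dihedral by (rule distrib)
  qed (simp_all add: elems_dihedral act_dihedral)
qed

fun piece_coloured :: "'x magma_struct \<Rightarrow> (nat \<Rightarrow> 'x) \<Rightarrow> piece \<Rightarrow> bool" where
  "piece_coloured Q q (Cross a b c d) \<longleftrightarrow> q b = q d \<and> q c = act Q (q a) (q b)"
| "piece_coloured Q q (Joint a b) \<longleftrightarrow> q a = q b"

definition colouring :: "'x magma_struct \<Rightarrow> pd \<Rightarrow> (nat \<Rightarrow> 'x) \<Rightarrow> bool" where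
  "colouring Q D q \<longleftrightarrow>
     (\<forall>p\<in>set D. (\<forall>e\<in>set (ends p). q e \<in> elems Q) \<and> piece_coloured Q q p)"

lemma colouring_simps [simp]:
  "colouring Q [] q"
  "colouring Q (p # D) q \<longleftrightarrow>
     (\<forall>e\<in>set (ends p). q e \<in> elems Q) \<and> piece_coloured Q q p \<and> colouring Q D q"
  by (auto simp: colouring_def)

lemma edges_eq: "edges D = (\<Union>p\<in>set D. set (ends p))"
proof (intro equalityI subsetI)
  fix e assume "e \<in> edges D"
  then obtain i k where "i < length D" "k < length (ends (D ! i))" "e = ends (D ! i) ! k"
    by (auto simp: edges_def darts_def label_def)
  then show "e \<in> (\<Union>p\<in>set D. set (ends p))"
    by (meson UN_I nth_mem)
next
  fix e assume "e \<in> (\<Union>p\<in>set D. set (ends p))"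
  then obtain p where "p \<in> set D" "e \<in> set (ends p)" by blast
  then obtain i k where "i < length D" "D ! i = p" "k < length (ends p)" "ends p ! k = e"
    by (metis in_set_conv_nth)
  then show "e \<in> edges D"
    unfolding edges_def darts_def label_def by (intro image_eqI[of _ _ "(i, k)"]) auto
qed

lemma edges_simps [simp]:
  "edges [] = {}" "edges (p # D) = set (ends p) \<union> edges D" "edges (D @ D') = edges D \<union> edges D'"
  by (auto simp: edges_eq)

lemma colouring_elems: "colouring Q D q \<Longrightarrow> e \<in> edges D \<Longrightarrow> q e \<in> elems Q"
  by (auto simp: colouring_def edges_eq)

lemma colouring_cong:
  assumes "\<And>e. e \<in> edges D \<Longrightarrow> q e = q' e"
  shows "colouring Q D q \<longleftrightarrow> colouring Q D q'"
proof -
  have eq: "q e = q' e" if "p \<in> set D" "e \<in> set (ends p)" for p e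
    using assms that by (auto simp: edges_eq)
  have "piece_coloured Q q p = piece_coloured Q q' p" if "p \<in> set D" for p
    using eq[OF that] by (cases p) simp_all
  then show ?thesis using eq unfolding colouring_def by simp
qed

lemma colouring_map_piece: "colouring Q (map (map_piece f) D) q \<longleftrightarrow> colouring Q D (q \<circ> f)"
proof -
  have "(\<forall>e\<in>set (ends (map_piece f p)). q e \<in> elems Q) \<longleftrightarrow> (\<forall>e\<in>set (ends p). (q \<circ> f) e \<in> elems Q)"
    "piece_coloured Q q (map_piece f p) \<longleftrightarrow> piece_coloured Q (q \<circ> f) p" for p
    by (cases p; simp)+
  then show ?thesis by (simp add: colouring_def)
qed

lemma edges_map_piece: "edges (map (map_piece f) D) = f ` edges D"
proof -
  have "set (ends (map_piece f p)) = f ` set (ends p)" for p by (cases p) auto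
  then show ?thesis by (auto simp: edges_eq)
qed

definition end_labels :: "pd \<Rightarrow> nat list" where
  "end_labels D = concat (map ends D)"

lemma end_labels_simps [simp]:
  "end_labels [] = []" "end_labels (p # D) = ends p @ end_labels D"
  by (simp_all add: end_labels_def)

lemma set_end_labels [simp]: "set (end_labels D) = edges D"
  by (induction D) auto

lemma count_end_labels: "count_list (end_labels D) e = card {d \<in> darts D. label D d = e}"
proof -
  have "{d \<in> darts D. label D d = e} =
      Sigma {..<length D} (\<lambda>i. {k. k < length (ends (D ! i)) \<and> ends (D ! i) ! k = e})"
    by (auto simp: darts_def label_def)
  then have "card {d \<in> darts D. label D d = e} =
      (\<Sum>i<length D. card {k. k < length (ends (D ! i)) \<and> ends (D ! i) ! k = e})"
    by (simp add: card_SigmaI)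
  also have "\<dots> = (\<Sum>i<length D. count_list (ends (D ! i)) e)"
    by (intro sum.cong refl)
      (auto simp: count_list_eq_length_filter length_filter_conv_card intro!: arg_cong[of _ _ card])
  also have "\<dots> = count_list (end_labels D) e"
  proof (induction D)
    case (Cons p D)
    then show ?case
      by (simp del: sum.lessThan_Suc add: sum.lessThan_Suc_shift)
  qed simp
  finally show ?thesis by simp
qed

lemma two_ends_count:
  assumes "edges_have_two_ends D"
  shows "count_list (end_labels D) e = (if e \<in> edges D then 2 else 0)"
proof (cases "e \<in> edges D")
  case True
  then show ?thesis using assms by (simp add: count_end_labels edges_have_two_ends_def)
next
  case False
  then show ?thesis by (simp add: count_list_0_iff)
qed

primrec qeval :: "'x magma_struct \<Rightarrow> ('g \<Rightarrow> 'x) \<Rightarrow> 'g qterm \<Rightarrow> 'x" where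
  "qeval Q q (Gen e) = q e"
| "qeval Q q (Op s t) = act Q (qeval Q q s) (qeval Q q t)"

lemma qeval_elems:
  assumes "involutory_quandle Q" "\<And>e. e \<in> set_qterm t \<Longrightarrow> q e \<in> elems Q"
  shows "qeval Q q t \<in> elems Q"
  using assms(2) by (induction t) (auto intro: quandleD(1)[OF assms(1)])

text \<open>\<open>T\<close> writes the colours of the edges of \<open>E\<close> as quandle terms in those of \<open>D\<close>, so that every
colouring of \<open>D\<close> yields one of \<open>E\<close>, from which \<open>T'\<close> recovers the colouring of \<open>D\<close>.  The type
argument is needed because a definition cannot quantify over the type of the quandle.\<close>

definition transfers ::
    "'x itself \<Rightarrow> (nat \<Rightarrow> nat qterm) \<Rightarrow> (nat \<Rightarrow> nat qterm) \<Rightarrow> pd \<Rightarrow> pd \<Rightarrow> bool" where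
  "transfers _ T T' D E \<longleftrightarrow>
     (\<forall>e\<in>edges E. set_qterm (T e) \<subseteq> edges D) \<and>
     (\<forall>(Q :: 'x magma_struct) q. involutory_quandle Q \<longrightarrow> colouring Q D q \<longrightarrow>
        colouring Q E (\<lambda>e. qeval Q q (T e)) \<and>
        (\<forall>e\<in>edges D. qeval Q (\<lambda>e'. qeval Q q (T e')) (T' e) = q e))"

text \<open>The existence half of the universal property of the involutory quandle presented by a diagram,
tested on quandles with elements of type \<open>'y\<close>.\<close>

definition universal_colouring ::
    "'y itself \<Rightarrow> 'x magma_struct \<Rightarrow> pd \<Rightarrow> (nat \<Rightarrow> 'x) \<Rightarrow> bool" where
  "universal_colouring _ Q D q \<longleftrightarrow> colouring Q D q \<and>
     (\<forall>(Y :: 'y magma_struct) y. involutory_quandle Y \<longrightarrow> colouring Y D y \<longrightarrow>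
       (\<exists>\<phi>. (\<forall>s\<in>elems Q. \<forall>t\<in>elems Q. \<phi> (act Q s t) = act Y (\<phi> s) (\<phi> t)) \<and>
            (\<forall>e\<in>edges D. \<phi> (q e) = y e)))"

text \<open>Homomorphisms commute with the evaluation of terms, so \<open>\<phi>\<close> for the colouring \<open>y \<circ> T'\<close> of \<open>D\<close>
also works for the colouring \<open>y\<close> of \<open>E\<close>.\<close>

lemma universal_colouring_transfer:
  fixes Q :: "'x magma_struct"
  assumes "involutory_quandle Q" "universal_colouring TYPE('y) Q D q"
    and "transfers TYPE('x) T T' D E" "transfers TYPE('y) T' T E D"
  shows "universal_colouring TYPE('y) Q E (\<lambda>e. qeval Q q (T e))"
  unfolding universal_colouring_def
proof (intro conjI allI impI)
  have q: "colouring Q D q" using assms(2) by (simp add: universal_colouring_def)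
  then show "colouring Q E (\<lambda>e. qeval Q q (T e))"
    using assms(1,3) by (auto simp: transfers_def)
  fix Y :: "'y magma_struct" and y
  assume Y: "involutory_quandle Y" "colouring Y E y"
  define y' where "y' = (\<lambda>e. qeval Y y (T' e))"
  have y': "colouring Y D y'" "\<And>e. e \<in> edges E \<Longrightarrow> qeval Y y' (T e) = y e"
    using assms(4) Y by (auto simp: transfers_def y'_def)
  obtain \<phi> where hom: "\<forall>s\<in>elems Q. \<forall>t\<in>elems Q. \<phi> (act Q s t) = act Y (\<phi> s) (\<phi> t)"
    and \<phi>: "\<forall>e\<in>edges D. \<phi> (q e) = y' e"
    using assms(2) Y(1) y'(1) unfolding universal_colouring_def by blast
  have "\<phi> (qeval Q q t) = qeval Y y' t" if "set_qterm t \<subseteq> edges D" for t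
    using that
  proof (induction t)
    case (Op s t)
    then have "qeval Q q s \<in> elems Q" "qeval Q q t \<in> elems Q"
      using colouring_elems[OF q] by (auto intro!: qeval_elems assms(1))
    then show ?case using Op hom by simp
  qed (use \<phi> in simp)
  then have "\<forall>e\<in>edges E. \<phi> (qeval Q q (T e)) = y e"
    using assms(3) y'(2) by (simp add: transfers_def)
  then show "\<exists>\<phi>. (\<forall>s\<in>elems Q. \<forall>t\<in>elems Q. \<phi> (act Q s t) = act Y (\<phi> s) (\<phi> t)) \<and>
      (\<forall>e\<in>edges E. \<phi> (qeval Q q (T e)) = y e)"
    using hom by blast
qed

text \<open>Both directions of an exchange of colourings, at the two types that occur in
\<open>universal_colouring\<close>: that of the universal quandle and that of the quandles it is tested on.\<close>

definition interchange :: "('x \<times> 'y) itself \<Rightarrow> pd \<Rightarrow> pd \<Rightarrow> bool" where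
  "interchange _ D E \<longleftrightarrow> (\<exists>T T'.
     transfers TYPE('x) T T' D E \<and> transfers TYPE('y) T T' D E \<and>
     transfers TYPE('x) T' T E D \<and> transfers TYPE('y) T' T E D)"

lemma interchangeI:
  assumes "transfers TYPE('x) T T' D E" "transfers TYPE('y) T T' D E"
    "transfers TYPE('x) T' T E D" "transfers TYPE('y) T' T E D"
  shows "interchange TYPE('x \<times> 'y) D E"
  using assms unfolding interchange_def by blast

lemma interchange_sym: "interchange TYPE('x \<times> 'y) D E \<Longrightarrow> interchange TYPE('x \<times> 'y) E D"
  unfolding interchange_def by blast

text \<open>The relation of a crossing is symmetric in its two under-strands.\<close>

lemma act_swap:
  assumes "involutory_quandle Q" "x \<in> elems Q" "y \<in> elems Q" "z = act Q x y"
  shows "act Q z y = x"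
  using quandleD(3)[OF assms(1-3)] assms(4) by simp

lemma transfers_rename:
  assumes "inj_on f (edges D)"
  defines "h \<equiv> the_inv_into (edges D) f"
  shows "transfers TYPE('x) (Gen \<circ> h) (Gen \<circ> f) D (map (map_piece f) D)"
    "transfers TYPE('x) (Gen \<circ> f) (Gen \<circ> h) (map (map_piece f) D) D"
proof -
  have h: "h (f e) = e" if "e \<in> edges D" for e
    using the_inv_into_f_f[OF assms(1) that] by (simp add: h_def)
  have "colouring Q D ((\<lambda>e. q (h e)) \<circ> f) \<longleftrightarrow> colouring Q D q" for Q :: "'x magma_struct" and q
    by (intro colouring_cong) (simp add: h)
  then show "transfers TYPE('x) (Gen \<circ> h) (Gen \<circ> f) D (map (map_piece f) D)"
    using h by (auto simp: transfers_def edges_map_piece colouring_map_piece)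
  show "transfers TYPE('x) (Gen \<circ> f) (Gen \<circ> h) (map (map_piece f) D) D"
    using h by (auto simp: transfers_def edges_map_piece colouring_map_piece o_def)
qed

lemma transfers_remove_Joint:
  fixes D :: pd
  assumes "a \<noteq> b"
  defines "D' \<equiv> map (map_piece (\<lambda>x. if x = b then a else x)) D"
  assumes "a \<in> edges D'"
  shows "transfers TYPE('x) Gen (Gen(b := Gen a)) (Joint a b # D) D'"
    "transfers TYPE('x) (Gen(b := Gen a)) Gen D' (Joint a b # D)"
proof -
  define f where "f = (\<lambda>x. if x = b then a else x)"
  have D': "D' = map (map_piece f) D" by (simp add: D'_def f_def)
  have same: "q \<circ> f = q" if "q a = q b" for q :: "nat \<Rightarrow> 'x"
    using that by (auto simp: f_def)
  have T: "(\<lambda>e. qeval Q q ((Gen(b := Gen a)) e)) = q \<circ> f" for Q :: "'x magma_struct" and q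
    by (auto simp: f_def)
  have T': "qeval Q (\<lambda>e. q e) ((Gen(b := Gen a)) e) = q (f e)"
    for Q :: "'x magma_struct" and q e
    by (simp add: f_def)
  have sub: "edges D' \<subseteq> edges (Joint a b # D)"
    by (auto simp: D' edges_map_piece f_def)
  show "transfers TYPE('x) Gen (Gen(b := Gen a)) (Joint a b # D) D'"
    unfolding transfers_def
  proof (intro conjI ballI allI impI)
    fix Q :: "'x magma_struct" and q
    assume q: "colouring Q (Joint a b # D) q"
    then have eq: "q \<circ> f = q" by (intro same) simp
    show "colouring Q D' (\<lambda>e. qeval Q q (Gen e))"
      using q eq by (simp add: D' colouring_map_piece)
    show "qeval Q (\<lambda>e. qeval Q q (Gen e)) ((Gen(b := Gen a)) e) = q e" for e
      using fun_cong[OF eq, of e] T'[of Q q e] by simp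
  qed (use sub in auto)
  have b: "b \<notin> edges D'" using assms(1) by (auto simp: D' edges_map_piece f_def)
  show "transfers TYPE('x) (Gen(b := Gen a)) Gen D' (Joint a b # D)"
    unfolding transfers_def T
  proof (intro conjI ballI allI impI)
    fix Q :: "'x magma_struct" and q
    assume q: "colouring Q D' q"
    have "q a \<in> elems Q" using q assms(3) by (rule colouring_elems)
    then show "colouring Q (Joint a b # D) (q \<circ> f)"
      using q by (simp add: D' colouring_map_piece) (simp add: f_def)
    show "qeval Q (q \<circ> f) (Gen e) = q e" if "e \<in> edges D'" for e
      using that b by (auto simp: f_def)
  next
    fix e assume "e \<in> edges (Joint a b # D)"
    then show "set_qterm ((Gen(b := Gen a)) e) \<subseteq> edges D'"
      using assms(3) by (auto simp: D' edges_map_piece f_def)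
  qed
qed

section \<open>Invariance of universal colourings under isotopy\<close>

lemma colouring_subst:
  assumes "\<And>e. e \<in> edges D \<Longrightarrow> T e = Gen e"
  shows "colouring Q D (\<lambda>e. qeval Q q (T e)) \<longleftrightarrow> colouring Q D q"
  using assms by (intro colouring_cong) simp

lemma transfersI:
  assumes "\<And>e. e \<in> edges E \<Longrightarrow> set_qterm (T e) \<subseteq> edges D"
    and "\<And>(Q :: 'x magma_struct) q. involutory_quandle Q \<Longrightarrow> colouring Q D q \<Longrightarrow>
      colouring Q E (\<lambda>e. qeval Q q (T e))"
    and "\<And>(Q :: 'x magma_struct) q e. involutory_quandle Q \<Longrightarrow> colouring Q D q \<Longrightarrow>
      e \<in> edges D \<Longrightarrow> qeval Q (\<lambda>e'. qeval Q q (T e')) (T' e) = q e"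
  shows "transfers TYPE('x) T T' D E"
  using assms unfolding transfers_def by blast

lemma transfers_R1:
  assumes "e \<notin> {a, b}" "e \<notin> edges D"
  defines "T \<equiv> Gen(e := Gen b)"
  shows "transfers TYPE('x) Gen T (Cross e e a b # D) (Joint a b # D)"
    "transfers TYPE('x) T Gen (Joint a b # D) (Cross e e a b # D)"
proof -
  have T: "T e = Gen b" "\<And>x. x \<noteq> e \<Longrightarrow> T x = Gen x" by (simp_all add: T_def)
  have D: "colouring Q D (\<lambda>e. qeval Q q (T e)) \<longleftrightarrow> colouring Q D q"
    for Q :: "'x magma_struct" and q
    using assms(2) T(2) by (intro colouring_subst) metis
  show "transfers TYPE('x) Gen T (Cross e e a b # D) (Joint a b # D)"
  proof (rule transfersI)
    fix Q :: "'x magma_struct" and q x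
    assume Q: "involutory_quandle Q" and q: "colouring Q (Cross e e a b # D) q"
    then have "q a = q b" "q b = q e" using quandleD(2)[OF Q] by auto
    then show "colouring Q (Joint a b # D) (\<lambda>e. qeval Q q (Gen e))"
      "qeval Q (\<lambda>e'. qeval Q q (Gen e')) (T x) = q x"
      using q T by (simp, cases "x = e") simp_all
  qed auto
  show "transfers TYPE('x) T Gen (Joint a b # D) (Cross e e a b # D)"
  proof (rule transfersI)
    fix x assume "x \<in> edges (Cross e e a b # D)"
    then show "set_qterm (T x) \<subseteq> edges (Joint a b # D)"
      using T by (cases "x = e") auto
  next
    fix Q :: "'x magma_struct" and q
    assume Q: "involutory_quandle Q" and q: "colouring Q (Joint a b # D) q"
    then show "colouring Q (Cross e e a b # D) (\<lambda>e. qeval Q q (T e))"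
      using assms(1) T D by (simp add: quandleD(2))
    fix x assume "x \<in> edges (Joint a b # D)"
    then have "x \<noteq> e" using assms(1,2) by auto
    then show "qeval Q (\<lambda>e'. qeval Q q (T e')) (Gen x) = q x" using T by simp
  qed
qed

lemma transfers_R1':
  assumes "e \<notin> {a, b}" "e \<notin> edges D"
  defines "T \<equiv> Gen(e := Gen a)"
  shows "transfers TYPE('x) Gen T (Cross a e e b # D) (Joint a b # D)"
    "transfers TYPE('x) T Gen (Joint a b # D) (Cross a e e b # D)"
proof -
  have T: "T e = Gen a" "\<And>x. x \<noteq> e \<Longrightarrow> T x = Gen x" by (simp_all add: T_def)
  have D: "colouring Q D (\<lambda>e. qeval Q q (T e)) \<longleftrightarrow> colouring Q D q"
    for Q :: "'x magma_struct" and q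
    using assms(2) T(2) by (intro colouring_subst) metis
  show "transfers TYPE('x) Gen T (Cross a e e b # D) (Joint a b # D)"
  proof (rule transfersI)
    fix Q :: "'x magma_struct" and q x
    assume Q: "involutory_quandle Q" and q: "colouring Q (Cross a e e b # D) q"
    then have "act Q (q e) (q e) = q a" using act_swap[OF Q, of "q a" "q e" "q e"] by auto
    then have "q a = q e" "q b = q e" using q quandleD(2)[OF Q] by auto
    then show "colouring Q (Joint a b # D) (\<lambda>e. qeval Q q (Gen e))"
      "qeval Q (\<lambda>e'. qeval Q q (Gen e')) (T x) = q x"
      using q T by (simp, cases "x = e") simp_all
  qed auto
  show "transfers TYPE('x) T Gen (Joint a b # D) (Cross a e e b # D)"
  proof (rule transfersI)
    fix x assume "x \<in> edges (Cross a e e b # D)"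
    then show "set_qterm (T x) \<subseteq> edges (Joint a b # D)"
      using T by (cases "x = e") auto
  next
    fix Q :: "'x magma_struct" and q
    assume Q: "involutory_quandle Q" and q: "colouring Q (Joint a b # D) q"
    then show "colouring Q (Cross a e e b # D) (\<lambda>e. qeval Q q (T e))"
      using assms(1) T D by (simp add: quandleD(2))
    fix x assume "x \<in> edges (Joint a b # D)"
    then have "x \<noteq> e" using assms(1,2) by auto
    then show "qeval Q (\<lambda>e'. qeval Q q (T e')) (Gen x) = q x" using T by simp
  qed
qed

text \<open>Inside the bigon the strand below has been acted on once by the strand above; acting twice is the
identity, so the colours before and after the bigon agree.\<close>

lemma transfers_R2:
  assumes "n \<noteq> m" "n \<notin> {p, q, r, s}" "m \<notin> {p, q, r, s}" "n \<notin> edges D" "m \<notin> edges D"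
  defines "T \<equiv> Gen(n := Op (Gen r) (Gen p), m := Gen p)"
    and "D1 \<equiv> Cross n p r m # Cross s q n m # D" and "D2 \<equiv> Joint p q # Joint r s # D"
  shows "transfers TYPE('x) Gen T D1 D2" "transfers TYPE('x) T Gen D2 D1"
proof -
  have T: "T n = Op (Gen r) (Gen p)" "T m = Gen p" "\<And>x. x \<noteq> n \<Longrightarrow> x \<noteq> m \<Longrightarrow> T x = Gen x"
    using assms(1) by (simp_all add: T_def)
  have Tp: "T p = Gen p" "T q = Gen q" "T r = Gen r" "T s = Gen s"
    using assms(2,3) by (auto intro!: T(3))
  have D: "colouring Q D (\<lambda>e. qeval Q q (T e)) \<longleftrightarrow> colouring Q D q"
    for Q :: "'x magma_struct" and q
    using assms(4,5) T(3) by (intro colouring_subst) metis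
  show "transfers TYPE('x) Gen T D1 D2"
  proof (rule transfersI)
    fix Q :: "'x magma_struct" and c x
    assume Q: "involutory_quandle Q" and c: "colouring Q D1 c"
    then have "c p = c m" "c q = c m" "c r = act Q (c n) (c m)" "c n = act Q (c s) (c m)"
      and el: "c n \<in> elems Q" "c m \<in> elems Q" "c s \<in> elems Q" by (auto simp: D1_def)
    then have *: "c p = c m" "c q = c m" "act Q (c r) (c m) = c n" "c s = c r"
      using quandleD(3)[OF Q] by auto
    then show "colouring Q D2 (\<lambda>e. qeval Q c (Gen e))"
      using c by (auto simp: D1_def D2_def)
    show "qeval Q (\<lambda>e'. qeval Q c (Gen e')) (T x) = c x"
      using * T by (cases "x = n"; cases "x = m") auto
  qed (auto simp: D1_def D2_def)
  show "transfers TYPE('x) T Gen D2 D1"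
  proof (rule transfersI)
    fix x assume "x \<in> edges D1"
    then show "set_qterm (T x) \<subseteq> edges D2"
      using T by (cases "x = n"; cases "x = m") (auto simp: D1_def D2_def)
  next
    fix Q :: "'x magma_struct" and c
    assume Q: "involutory_quandle Q" and c: "colouring Q D2 c"
    then show "colouring Q D1 (\<lambda>e. qeval Q c (T e))"
      using T Tp D by (simp add: D1_def D2_def quandleD(1,3))
    fix x assume "x \<in> edges D2"
    then have "x \<noteq> n" "x \<noteq> m" using assms(2-5) by (auto simp: D2_def)
    then show "qeval Q (\<lambda>e'. qeval Q c (T e')) (Gen x) = c x" using T by simp
  qed
qed

text \<open>Self-distributivity.  With the colour \<open>t\<close> of the top strand, the bottom strand is coloured
\<open>(p3 * t) * (p2 * t)\<close> or \<open>(p3 * p2) * t\<close>, depending on the side of the move.  The two sides are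
exchanged by the rotation \<open>p1 \<leftrightarrow> p4\<close>, \<open>p2 \<leftrightarrow> p5\<close>, \<open>p3 \<leftrightarrow> p6\<close>, which also exchanges
the substitutions, so that one direction suffices.\<close>

lemma transfers_R3_aux:
  assumes "distinct [a, b, c]" "{a, b, c} \<inter> {p1, p2, p3, p4, p5, p6} = {}"
    "{a, b, c} \<inter> edges D = {}"
  shows "transfers TYPE('x)
    (Gen(a := Gen p1, b := Gen p2, c := Op (Gen p6) (Gen p1)))
    (Gen(a := Gen p4, b := Gen p5, c := Op (Gen p3) (Gen p4)))
    (Cross p2 a b p1 # Cross p3 p4 c a # Cross p6 b c p5 # D)
    (Cross p5 a b p4 # Cross p6 p1 c a # Cross p3 b c p2 # D)"
    (is "transfers _ ?T ?T' ?D ?E")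
proof -
  define T where "T = ?T"
  define T' where "T' = ?T'"
  have T: "T a = Gen p1" "T b = Gen p2" "T c = Op (Gen p6) (Gen p1)"
    "\<And>x. x \<noteq> a \<Longrightarrow> x \<noteq> b \<Longrightarrow> x \<noteq> c \<Longrightarrow> T x = Gen x"
    and T': "T' a = Gen p4" "T' b = Gen p5" "T' c = Op (Gen p3) (Gen p4)"
    "\<And>x. x \<noteq> a \<Longrightarrow> x \<noteq> b \<Longrightarrow> x \<noteq> c \<Longrightarrow> T' x = Gen x"
    using assms(1) by (simp_all add: T_def T'_def)
  have Tp: "T p1 = Gen p1" "T p2 = Gen p2" "T p3 = Gen p3"
    "T p4 = Gen p4" "T p5 = Gen p5" "T p6 = Gen p6"
    using assms(2) by (auto intro!: T(4))
  have "transfers TYPE('x) T T' ?D ?E"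
    unfolding transfers_def
  proof (intro conjI allI impI)
    fix Q :: "'x magma_struct" and q
    assume Q: "involutory_quandle Q" and q: "colouring Q ?D q"
    have el: "q p1 \<in> elems Q" "q p2 \<in> elems Q" "q p3 \<in> elems Q" "q p4 \<in> elems Q"
      "q p5 \<in> elems Q" "q p6 \<in> elems Q"
      and eq: "q a = q p1" "q p4 = q p1" "q b = act Q (q p2) (q p1)" "q p5 = q b"
      "q c = act Q (q p3) (q p1)" "q c = act Q (q p6) (q b)"
      using q by auto
    note Q1 = quandleD(1)[OF Q] and Q3 = quandleD(3)[OF Q] and Q4 = quandleD(4)[OF Q]
    have "q p6 = act Q (q c) (q b)" using Q3[of "q p6" "q b"] eq el Q1 by simp
    also have "\<dots> = act Q (act Q (q p3) (q p2)) (q p1)" using eq el Q4 by simp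
    finally have p6: "act Q (q p6) (q p1) = act Q (q p3) (q p2)" using Q3 Q1 el by simp
    have D: "colouring Q D (\<lambda>e. qeval Q q (T e))"
      using q assms(3) by (subst colouring_subst) (auto intro!: T(4))
    show "colouring Q ?E (\<lambda>e. qeval Q q (T e))"
      using el eq D p6 Q1 Q3 by (simp add: T Tp)
    show "\<forall>x\<in>edges ?D. qeval Q (\<lambda>e'. qeval Q q (T e')) (T' x) = q x"
    proof
      fix x
      consider "x = a" | "x = b" | "x = c" | "x \<noteq> a" "x \<noteq> b" "x \<noteq> c" by blast
      then show "qeval Q (\<lambda>e'. qeval Q q (T e')) (T' x) = q x"
        by cases (simp_all add: el eq T T' Tp)
    qed
  next
    show "\<forall>e\<in>edges ?E. set_qterm (T e) \<subseteq> edges ?D"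
    proof
      fix x assume x: "x \<in> edges ?E"
      consider "x = a" | "x = b" | "x = c" | "x \<noteq> a" "x \<noteq> b" "x \<noteq> c" by blast
      then show "set_qterm (T x) \<subseteq> edges ?D"
        by cases (use x T Tp in auto)
    qed
  qed
  then show ?thesis by (simp only: T_def T'_def)
qed

lemma transfers_R3'_aux:
  assumes "distinct [a, b, c]" "{a, b, c} \<inter> {p1, p2, p3, p4, p5, p6} = {}"
    "{a, b, c} \<inter> edges D = {}"
  shows "transfers TYPE('x)
    (Gen(a := Gen p1, b := Op (Gen p5) (Gen p1), c := Gen p3))
    (Gen(a := Gen p4, b := Op (Gen p2) (Gen p4), c := Gen p6))
    (Cross p2 a b p1 # Cross p3 p4 c a # Cross p5 p6 b c # D)
    (Cross p5 a b p4 # Cross p6 p1 c a # Cross p2 p3 b c # D)"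
    (is "transfers _ ?T ?T' ?D ?E")
proof -
  define T where "T = ?T"
  define T' where "T' = ?T'"
  have T: "T a = Gen p1" "T b = Op (Gen p5) (Gen p1)" "T c = Gen p3"
    "\<And>x. x \<noteq> a \<Longrightarrow> x \<noteq> b \<Longrightarrow> x \<noteq> c \<Longrightarrow> T x = Gen x"
    and T': "T' a = Gen p4" "T' b = Op (Gen p2) (Gen p4)" "T' c = Gen p6"
    "\<And>x. x \<noteq> a \<Longrightarrow> x \<noteq> b \<Longrightarrow> x \<noteq> c \<Longrightarrow> T' x = Gen x"
    using assms(1) by (simp_all add: T_def T'_def)
  have Tp: "T p1 = Gen p1" "T p2 = Gen p2" "T p3 = Gen p3"
    "T p4 = Gen p4" "T p5 = Gen p5" "T p6 = Gen p6"
    using assms(2) by (auto intro!: T(4))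
  have "transfers TYPE('x) T T' ?D ?E"
    unfolding transfers_def
  proof (intro conjI allI impI)
    fix Q :: "'x magma_struct" and q
    assume Q: "involutory_quandle Q" and q: "colouring Q ?D q"
    have el: "q p1 \<in> elems Q" "q p2 \<in> elems Q" "q p3 \<in> elems Q" "q p4 \<in> elems Q"
      "q p5 \<in> elems Q" "q p6 \<in> elems Q"
      and eq: "q a = q p1" "q p4 = q p1" "q b = act Q (q p2) (q p1)"
      "q c = act Q (q p3) (q p1)" "q p6 = q c" "q b = act Q (q p5) (q c)"
      using q by auto
    note Q1 = quandleD(1)[OF Q] and Q3 = quandleD(3)[OF Q] and Q4 = quandleD(4)[OF Q]
    have "q p5 = act Q (q b) (q c)" using Q3[of "q p5" "q c"] eq el Q1 by simp
    also have "\<dots> = act Q (act Q (q p2) (q p3)) (q p1)" using eq el Q4 by simp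
    finally have p5: "act Q (q p5) (q p1) = act Q (q p2) (q p3)" using Q3 Q1 el by simp
    have D: "colouring Q D (\<lambda>e. qeval Q q (T e))"
      using q assms(3) by (subst colouring_subst) (auto intro!: T(4))
    show "colouring Q ?E (\<lambda>e. qeval Q q (T e))"
      using el eq D p5 Q1 Q3 by (simp add: T Tp)
    show "\<forall>x\<in>edges ?D. qeval Q (\<lambda>e'. qeval Q q (T e')) (T' x) = q x"
    proof
      fix x
      consider "x = a" | "x = b" | "x = c" | "x \<noteq> a" "x \<noteq> b" "x \<noteq> c" by blast
      then show "qeval Q (\<lambda>e'. qeval Q q (T e')) (T' x) = q x"
        by cases (simp_all add: el eq T T' Tp)
    qed
  next
    show "\<forall>e\<in>edges ?E. set_qterm (T e) \<subseteq> edges ?D"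
    proof
      fix x assume x: "x \<in> edges ?E"
      consider "x = a" | "x = b" | "x = c" | "x \<noteq> a" "x \<noteq> b" "x \<noteq> c" by blast
      then show "set_qterm (T x) \<subseteq> edges ?D"
        by cases (use x T Tp in auto)
    qed
  qed
  then show ?thesis by (simp only: T_def T'_def)
qed

lemma interchange_same_edges:
  assumes "edges D = edges E"
    and "\<And>(Q :: 'x magma_struct) q. involutory_quandle Q \<Longrightarrow> colouring Q D q \<longleftrightarrow> colouring Q E q"
    and "\<And>(Q :: 'y magma_struct) q. involutory_quandle Q \<Longrightarrow> colouring Q D q \<longleftrightarrow> colouring Q E q"
  shows "interchange TYPE('x \<times> 'y) D E"
  by (rule interchangeI[of Gen Gen]; rule transfersI) (use assms in auto)

lemma interchange_planar_move:
  assumes "planar_move D E" "edges_have_two_ends D"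
  shows "interchange TYPE('x \<times> 'y) D E"
  using assms
proof (induction rule: planar_move.induct)
  case (permute D E)
  then have "set D = set E" by (metis set_mset_mset)
  then show ?case
    by (intro interchange_same_edges) (simp_all add: edges_eq colouring_def)
next
  case (rename f D)
  then show ?case by (intro interchangeI[OF transfers_rename(1) transfers_rename(1) transfers_rename(2) transfers_rename(2)])
next
  case (turn_Cross a b c d D)
  have turn: "colouring Q (Cross c d a b # D) q"
    if Q: "involutory_quandle Q" and q: "colouring Q (Cross a b c d # D) q"
    for Q :: "'z magma_struct" and q a b c d
  proof -
    have "act Q (q c) (q d) = q a"
      using act_swap[OF Q, of "q a" "q b" "q c"] q by simp
    then show ?thesis using q by (simp add: quandleD(1)[OF Q])
  qed
  show ?case
    by (rule interchange_same_edges; (intro iffI; erule turn[rotated])?) auto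
next
  case (turn_Joint a b D)
  show ?case by (intro interchange_same_edges) auto
next
  case (remove_Joint a b D)
  have "count_list (end_labels (Joint a b # D)) a = 2"
    by (subst two_ends_count[OF remove_Joint(2)]) simp
  then have "a \<in> edges D"
    using remove_Joint(1) count_list_0_iff[of "end_labels D" a] by (auto split: if_splits)
  then have "a \<in> edges (map (map_piece (\<lambda>x. if x = b then a else x)) D)"
    using remove_Joint(1) by (force simp: edges_map_piece)
  then show ?case
    using remove_Joint(1)
    by (intro interchangeI[OF transfers_remove_Joint(1) transfers_remove_Joint(1)
          transfers_remove_Joint(2) transfers_remove_Joint(2)])
qed

text \<open>An edge that has two of its ends inside a tangle has none elsewhere, so its colour may be chosen
freely when a colouring is extended to the tangle.\<close>

lemma two_ends_fresh:
  assumes "edges_have_two_ends D" "mset (end_labels D) = {#e, e#} + mset es"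
  shows "e \<notin> set es"
proof -
  have "e \<in> set (end_labels D)" using assms(2) by (metis set_mset_mset union_iff set_mset_add_mset_insert insertI1)
  then have "count (mset (end_labels D)) e = 2"
    using two_ends_count[OF assms(1), of e] by (simp add: count_mset)
  then have "count (mset es) e = 0" unfolding assms(2) by simp
  then show ?thesis by (simp add: count_eq_zero_iff)
qed

lemma interchange_reidemeister_move:
  assumes "reidemeister_move D E" "edges_have_two_ends D"
  shows "interchange TYPE('x \<times> 'y) D E"
  using assms
proof (induction rule: reidemeister_move.induct)
  case (R1 e a b D)
  have "e \<notin> set ([a, b] @ end_labels D)"
    by (rule two_ends_fresh[OF R1]) (simp add: add_mset_commute)
  then show ?case
    by (intro interchangeI[OF transfers_R1(1) transfers_R1(1) transfers_R1(2) transfers_R1(2)]) auto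
next
  case (R1' a e b D)
  have "e \<notin> set ([a, b] @ end_labels D)"
    by (rule two_ends_fresh[OF R1']) (simp add: add_mset_commute)
  then show ?case
    by (intro interchangeI[OF transfers_R1'(1) transfers_R1'(1) transfers_R1'(2) transfers_R1'(2)]) auto
next
  case (R2 n p r m s q D)
  have "n \<notin> set ([m, m, p, q, r, s] @ end_labels D)"
    by (rule two_ends_fresh[OF R2]) (simp add: add_mset_commute)
  moreover have "m \<notin> set ([n, n, p, q, r, s] @ end_labels D)"
    by (rule two_ends_fresh[OF R2]) (simp add: add_mset_commute)
  ultimately show ?case
    by (intro interchangeI[OF transfers_R2(1) transfers_R2(1) transfers_R2(2) transfers_R2(2)]) auto
next
  case (R3 p2 a b p1 p3 p4 c p6 p5 D)
  have "a \<notin> set ([b, b, c, c, p1, p2, p3, p4, p5, p6] @ end_labels D)"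
    by (rule two_ends_fresh[OF R3]) (simp add: add_mset_commute)
  moreover have "b \<notin> set ([a, a, c, c, p1, p2, p3, p4, p5, p6] @ end_labels D)"
    by (rule two_ends_fresh[OF R3]) (simp add: add_mset_commute)
  moreover have "c \<notin> set ([a, a, b, b, p1, p2, p3, p4, p5, p6] @ end_labels D)"
    by (rule two_ends_fresh[OF R3]) (simp add: add_mset_commute)
  ultimately show ?case
    by (intro interchangeI[OF transfers_R3_aux transfers_R3_aux transfers_R3_aux transfers_R3_aux])
      auto
next
  case (R3' p2 a b p1 p3 p4 c p5 p6 D)
  have "a \<notin> set ([b, b, c, c, p1, p2, p3, p4, p5, p6] @ end_labels D)"
    by (rule two_ends_fresh[OF R3']) (simp add: add_mset_commute)
  moreover have "b \<notin> set ([a, a, c, c, p1, p2, p3, p4, p5, p6] @ end_labels D)"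
    by (rule two_ends_fresh[OF R3']) (simp add: add_mset_commute)
  moreover have "c \<notin> set ([a, a, b, b, p1, p2, p3, p4, p5, p6] @ end_labels D)"
    by (rule two_ends_fresh[OF R3']) (simp add: add_mset_commute)
  ultimately show ?case
    by (intro interchangeI[OF transfers_R3'_aux transfers_R3'_aux transfers_R3'_aux transfers_R3'_aux])
      auto
qed

lemma universal_colouring_isotopic:
  fixes Q :: "'x magma_struct"
  assumes "isotopic D E" "involutory_quandle Q" "universal_colouring TYPE('y) Q D q"
  shows "\<exists>q. universal_colouring TYPE('y) Q E q"
  using assms(1) unfolding isotopic_def
proof (induction rule: rtranclp_induct)
  case base
  then show ?case using assms(3) by blast
next
  case (step D E)
  then obtain q where q: "universal_colouring TYPE('y) Q D q" by blast
  have "interchange TYPE('x \<times> 'y) D E"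
    using step(2) interchange_planar_move interchange_reidemeister_move interchange_sym
    unfolding between_diagrams_def link_diagram_def by meson
  then obtain T T' where "transfers TYPE('x) T T' D E" "transfers TYPE('y) T' T E D"
    unfolding interchange_def by blast
  then show ?case using universal_colouring_transfer[OF assms(2) q] by blast
qed

section \<open>The universal colouring by arcs\<close>

definition crossing_relations :: "pd \<Rightarrow> (nat set \<times> nat set \<times> nat set) set" where
  "crossing_relations D =
     {(arc_of D a, arc_of D b, arc_of D c) | a b c d. Cross a b c d \<in> set D}"

definition arc_colouring :: "pd \<Rightarrow> nat \<Rightarrow> nat set qterm set" where
  "arc_colouring D e = iq_class (arcs D) (crossing_relations D) (Gen (arc_of D e))"

lemma IQ_eq: "IQ D = presented_iq (arcs D) (crossing_relations D)"
  by (simp add: IQ_def crossing_relations_def)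

lemma involutory_quandle_IQ: "involutory_quandle (IQ D)"
  unfolding IQ_eq by (rule involutory_quandle_presented_iq)

lemma arc_of_step:
  assumes "(a, b) \<in> arc_steps D"
  shows "arc_of D a = arc_of D b"
proof -
  let ?r = "arc_steps D \<union> (arc_steps D)\<inverse>"
  have "(a, b) \<in> ?r" "(b, a) \<in> ?r" using assms by auto
  then show ?thesis
    unfolding arc_of_def by (blast intro: converse_rtrancl_into_rtrancl)
qed

lemma piece_edges: "p \<in> set D \<Longrightarrow> e \<in> set (ends p) \<Longrightarrow> e \<in> edges D"
  by (auto simp: edges_eq)

lemma colouring_arc_colouring: "colouring (IQ D) D (arc_colouring D)"
  unfolding colouring_def
proof (intro ballI conjI)
  fix p assume p: "p \<in> set D"
  have G: "Gen (arc_of D e) \<in> terms_over (arcs D)" if "e \<in> set (ends p)" for e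
    using piece_edges[OF p that] by (auto simp: terms_over_def arcs_def)
  then show "arc_colouring D e \<in> elems (IQ D)" if "e \<in> set (ends p)" for e
    using that by (auto simp: IQ_eq presented_iq_def arc_colouring_def)
  show "piece_coloured (IQ D) (arc_colouring D) p"
  proof (cases p)
    case (Cross a b c d)
    have "arc_of D b = arc_of D d"
      using p Cross by (intro arc_of_step) (auto simp: arc_steps_def)
    moreover have "iq_eq (arcs D) (crossing_relations D) (Gen (arc_of D c))
        (Op (Gen (arc_of D a)) (Gen (arc_of D b)))"
      using p Cross piece_edges[OF p]
      by (intro iq_eq.relation) (auto simp: crossing_relations_def arcs_def)
    ultimately show ?thesis
      using G Cross by (simp add: arc_colouring_def IQ_eq act_iq_class iq_class_eq_iff)
  next
    case (Joint a b)
    have "arc_of D a = arc_of D b"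
      using p Joint by (intro arc_of_step) (auto simp: arc_steps_def)
    then show ?thesis using Joint by (simp add: arc_colouring_def)
  qed
qed

lemma iq_eq_qeval:
  assumes "iq_eq G R s t" "involutory_quandle Y"
    and "\<And>x. x \<in> G \<Longrightarrow> v x \<in> elems Y"
    and "\<And>x y z. (x, y, z) \<in> R \<Longrightarrow> x \<in> G \<Longrightarrow> y \<in> G \<Longrightarrow> z \<in> G \<Longrightarrow> v z = act Y (v x) (v y)"
  shows "qeval Y v s = qeval Y v t"
proof -
  have el: "qeval Y v t \<in> elems Y" if "t \<in> terms_over G" for t
    using that assms(3) by (intro qeval_elems[OF assms(2)]) (auto simp: terms_over_def)
  show ?thesis
    using assms(1)
  proof (induction rule: iq_eq.induct)
    case (distrib s t u)
    then show ?case
      unfolding qeval.simps by (intro quandleD(4)[OF assms(2)] el)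
  next
    case (relation x y z)
    then show ?case unfolding qeval.simps by (rule assms(4))
  qed (simp_all add: el quandleD(2,3)[OF assms(2)])
qed

text \<open>A colouring is constant on arcs and respects the defining relations, so evaluating terms on it
gives a well-defined map on the presented quandle.\<close>

lemma universal_colouring_IQ: "universal_colouring TYPE('y) (IQ D) D (arc_colouring D)"
  unfolding universal_colouring_def
proof (intro conjI allI impI)
  show "colouring (IQ D) D (arc_colouring D)" by (rule colouring_arc_colouring)
  fix Y :: "'y magma_struct" and y
  assume Y: "involutory_quandle Y" and y: "colouring Y D y"
  let ?G = "arcs D" and ?R = "crossing_relations D"
  have step: "y a = y b" if "(a, b) \<in> arc_steps D" for a b
    using that y unfolding arc_steps_def colouring_def by fastforce
  have arc: "y e' = y e" if "e' \<in> arc_of D e" for e e'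
    using that unfolding arc_of_def mem_Collect_eq
    by (induction rule: rtrancl_induct) (auto dest: step)
  define v where "v = (\<lambda>A. y (SOME e. e \<in> A))"
  have v: "v (arc_of D e) = y e" for e
    unfolding v_def by (rule arc, rule someI[of _ e]) (simp add: arc_of_def)
  have v_elems: "v x \<in> elems Y" if "x \<in> ?G" for x
    using that colouring_elems[OF y] by (auto simp: arcs_def v)
  have rel: "v z = act Y (v x) (v w)" if "(x, w, z) \<in> ?R" for x w z
    using that y by (fastforce simp: crossing_relations_def colouring_def v)
  note ev = iq_eq_qeval[OF _ Y v_elems rel]
  define \<phi> where "\<phi> = (\<lambda>A. qeval Y v (SOME t. t \<in> A))"
  have \<phi>: "\<phi> (iq_class ?G ?R t) = qeval Y v t" if "t \<in> terms_over ?G" for t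
  proof -
    have "(SOME s. s \<in> iq_class ?G ?R t) \<in> iq_class ?G ?R t"
      by (rule someI[of _ t]) (simp add: iq_class_def iq_eq.refl that)
    then show ?thesis unfolding \<phi>_def iq_class_def by (intro ev[symmetric]) simp_all
  qed
  have "\<phi> (act (IQ D) A B) = act Y (\<phi> A) (\<phi> B)"
    if "A \<in> elems (IQ D)" "B \<in> elems (IQ D)" for A B
  proof -
    obtain s t where "s \<in> terms_over ?G" "t \<in> terms_over ?G"
      "A = iq_class ?G ?R s" "B = iq_class ?G ?R t"
      using \<open>A \<in> _\<close> \<open>B \<in> _\<close> by (auto simp: IQ_eq presented_iq_def)
    then show ?thesis by (simp add: IQ_eq act_iq_class \<phi> terms_over_Op)
  qed
  moreover have "\<phi> (arc_colouring D e) = y e" if "e \<in> edges D" for e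
  proof -
    have "Gen (arc_of D e) \<in> terms_over ?G" using that by (simp add: terms_over_def arcs_def)
    then show ?thesis by (simp add: arc_colouring_def \<phi> v)
  qed
  ultimately show "\<exists>\<phi>. (\<forall>s\<in>elems (IQ D). \<forall>t\<in>elems (IQ D).
      \<phi> (act (IQ D) s t) = act Y (\<phi> s) (\<phi> t)) \<and> (\<forall>e\<in>edges D. \<phi> (arc_colouring D e) = y e)"
    by blast
qed

section \<open>Left-orders at a crossing\<close>

text \<open>From \<open>x < y\<close> follows \<open>x = x * x < x * y = z\<close>, and from \<open>z < y\<close> follows \<open>z = z * z < z * y = x\<close>;
likewise with the order reversed.  So \<open>y\<close> is not on the same side of both \<open>x\<close> and \<open>z\<close>.\<close>

lemma left_order_between:
  assumes Q: "involutory_quandle Q" and lt: "left_order Q lt"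
    and x: "x \<in> elems Q" and y: "y \<in> elems Q" and z: "z = act Q x y"
  shows "(x = y \<and> z = y) \<or> (lt x y \<and> lt y z) \<or> (lt y x \<and> lt z y)"
proof -
  have zQ: "z \<in> elems Q" and zy: "act Q z y = x" 
    using quandleD(1,3)[OF Q x y] z by simp_all
  have irrefl: "\<not> lt a a" if "a \<in> elems Q" for a
    using lt that unfolding left_order_def by blast
  have trans: "lt a c" if "lt a b" "lt b c" "a \<in> elems Q" "b \<in> elems Q" "c \<in> elems Q" for a b c
    using lt that unfolding left_order_def by blast
  have total: "a = b \<or> lt a b \<or> lt b a" if "a \<in> elems Q" "b \<in> elems Q" for a b
    using lt that unfolding left_order_def by blast
  have mono: "lt (act Q c a) (act Q c b)" if "lt a b" "a \<in> elems Q" "b \<in> elems Q" "c \<in> elems Q" for a b c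
    using lt that unfolding left_order_def by blast
  have xx: "act Q x x = x" "act Q z z = z" using quandleD(2)[OF Q] x zQ by auto
  have up: "lt x y \<Longrightarrow> lt x z" "lt y x \<Longrightarrow> lt z x"
    using mono[of x y x] mono[of y x x] x y xx z by auto
  have down: "lt z y \<Longrightarrow> lt z x" "lt y z \<Longrightarrow> lt x z"
    using mono[of z y z] mono[of y z z] zQ y xx zy by auto
  have zyx: "z = y \<Longrightarrow> x = y" using zy quandleD(2)[OF Q y] by simp
  have yy: "x = y \<Longrightarrow> z = y" using z quandleD(2)[OF Q y] by simp
  have asym: "\<not> (lt x z \<and> lt z x)" using trans irrefl x zQ by blast
  consider "x = y" | "x \<noteq> y" "lt x y" | "x \<noteq> y" "lt y x" using total[OF x y] by blast
  then show ?thesis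
  proof cases
    case 1
    then show ?thesis using yy by simp
  next
    case 2
    then have "z \<noteq> y" "\<not> lt z y" using zyx up(1) down(1) asym by auto
    then show ?thesis using 2 total[OF zQ y] by blast
  next
    case 3
    then have "z \<noteq> y" "\<not> lt y z" using zyx up(2) down(2) asym by auto
    then show ?thesis using 3 total[OF zQ y] by blast
  qed
qed

lemma left_order_cancel:
  assumes "left_order Q lt" "x \<in> elems Q" "y \<in> elems Q" "z \<in> elems Q"
    and "act Q z x = act Q z y" "act Q z x \<in> elems Q"
  shows "x = y"
  using assms unfolding left_order_def by metis

lemma left_order_moves:
  assumes "involutory_quandle Q" "left_order Q lt" "x \<in> elems Q" "y \<in> elems Q" "x \<noteq> y"
  shows "act Q x y \<noteq> x"
proof
  assume "act Q x y = x"
  then have "lt x y \<and> lt y x" using left_order_between[OF assms(1-4), of x] assms(5) by auto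
  then show False using assms(2-4) unfolding left_order_def by blast
qed

text \<open>Only finitely many colours occur in a diagram, so the order may be replaced by that of the
integers.\<close>

lemma left_order_rank:
  assumes lt: "left_order Q lt" and C: "finite C" "C \<subseteq> elems Q"
  shows "\<exists>\<kappa> :: 'x \<Rightarrow> int. \<forall>x\<in>C. \<forall>y\<in>C. lt x y \<longrightarrow> \<kappa> x < \<kappa> y"
proof -
  have irrefl: "\<not> lt a a" if "a \<in> elems Q" for a
    using lt that unfolding left_order_def by blast
  have trans: "lt a c" if "lt a b" "lt b c" "a \<in> elems Q" "b \<in> elems Q" "c \<in> elems Q" for a b c
    using lt that unfolding left_order_def by blast
  have "card {z \<in> C. lt z x} < card {z \<in> C. lt z y}" if "x \<in> C" "y \<in> C" "lt x y" for x y
  proof (rule psubset_card_mono)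
    show "finite {z \<in> C. lt z y}" using C(1) by simp
    have "{z \<in> C. lt z x} \<subseteq> {z \<in> C. lt z y}"
    proof
      fix z assume "z \<in> {z \<in> C. lt z x}"
      then have "z \<in> C" "lt z x" by auto
      then have "lt z y" using trans[of z x y] that C(2) by blast
      then show "z \<in> {z \<in> C. lt z y}" using \<open>z \<in> C\<close> by simp
    qed
    moreover have "x \<notin> {z \<in> C. lt z x}" "x \<in> {z \<in> C. lt z y}"
      using irrefl that C(2) by auto
    ultimately show "{z \<in> C. lt z x} \<subset> {z \<in> C. lt z y}" by blast
  qed
  then have "\<forall>x\<in>C. \<forall>y\<in>C. lt x y \<longrightarrow>
      int (card {z \<in> C. lt z x}) < int (card {z \<in> C. lt z y})" by simp
  then show ?thesis by (intro exI[of _ "\<lambda>x. int (card {z \<in> C. lt z x})"])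
qed

section \<open>Alternating strands\<close>

lemma under_ends_simps [simp]:
  "under_ends [] = []" "under_ends (Cross a b c d # D) = a # c # under_ends D"
  "under_ends (Joint a b # D) = under_ends D"
  by (simp_all add: under_ends_def)

lemma over_ends_simps [simp]:
  "over_ends [] = []" "over_ends (Cross a b c d # D) = b # d # over_ends D"
  "over_ends (Joint a b # D) = over_ends D"
  by (simp_all add: over_ends_def)

lemma ends_map_piece:
  "under_ends (map (map_piece f) D) = map f (under_ends D)"
  "over_ends (map (map_piece f) D) = map f (over_ends D)"
proof (induction D)
  case (Cons p D)
  { case 1 then show ?case using Cons by (cases p) auto }
  { case 2 then show ?case using Cons by (cases p) auto }
qed simp_all

lemma ends_subset: "set (under_ends D) \<subseteq> edges D" "set (over_ends D) \<subseteq> edges D"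
proof (induction D)
  case (Cons p D)
  { case 1 then show ?case using Cons by (cases p) auto }
  { case 2 then show ?case using Cons by (cases p) auto }
qed simp_all

lemma mset_concat_map: "mset (concat (map f D)) = \<Sum>\<^sub># (image_mset (mset \<circ> f) (mset D))"
  by (induction D) simp_all

lemma mset_ends_eq:
  assumes "mset D = mset E"
  shows "mset (under_ends D) = mset (under_ends E)" "mset (over_ends D) = mset (over_ends E)"
  unfolding under_ends_def over_ends_def mset_concat_map assms by simp_all

fun piece_stranded :: "(nat \<Rightarrow> nat) \<Rightarrow> piece \<Rightarrow> bool" where
  "piece_stranded s (Cross a b c d) \<longleftrightarrow> {s a, s c} \<inter> {s b, s d} = {}"
| "piece_stranded s (Joint a b) \<longleftrightarrow> s a = s b"

text \<open>A code with joints cuts the strand between two crossings into several edges.  The function \<open>s\<close>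
gives each such strand one name, and the strand has exactly one under- and one over-end, which lie
at different crossings.  Closed curves without crossings may share their name with anything else.
The existence of such an \<open>s\<close> does not depend on the code chosen for the diagram.\<close>

definition alternating_strands :: "pd \<Rightarrow> (nat \<Rightarrow> nat) \<Rightarrow> bool" where
  "alternating_strands D s \<longleftrightarrow>
     (\<forall>p\<in>set D. piece_stranded s p) \<and>
     distinct (map s (under_ends D)) \<and> distinct (map s (over_ends D)) \<and>
     set (map s (under_ends D)) = set (map s (over_ends D)) \<and> over_ends D \<noteq> []"

lemma alternating_strands_cong:
  assumes "\<And>e. e \<in> edges D \<Longrightarrow> s e = s' e" "alternating_strands D s"
  shows "alternating_strands D s'"
proof -
  have m: "map s (under_ends D) = map s' (under_ends D)" "map s (over_ends D) = map s' (over_ends D)"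
    using assms(1) ends_subset[of D] by auto
  have "piece_stranded s' p" if p: "p \<in> set D" for p
  proof -
    have "s e = s' e" if "e \<in> set (ends p)" for e
      using piece_edges[OF p that] assms(1) by blast
    then have "piece_stranded s p = piece_stranded s' p" by (cases p) simp_all
    then show ?thesis using assms(2) p by (simp add: alternating_strands_def)
  qed
  then show ?thesis using assms(2) unfolding alternating_strands_def m by blast
qed

lemma alternating_strands_map_piece:
  "alternating_strands (map (map_piece f) D) s \<longleftrightarrow> alternating_strands D (s \<circ> f)"
proof -
  have "piece_stranded s (map_piece f p) \<longleftrightarrow> piece_stranded (s \<circ> f) p" for p
    by (cases p) simp_all
  then show ?thesis
    unfolding alternating_strands_def ends_map_piece map_map by simp
qed

lemma alternating_strands_planar_move:
  assumes "planar_move D E"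
  shows "(\<exists>s. alternating_strands D s) \<longleftrightarrow> (\<exists>s. alternating_strands E s)"
  using assms
proof (induction rule: planar_move.induct)
  case (permute D E)
  have "set D = set E" using permute by (metis set_mset_mset)
  moreover have "set (under_ends D) = set (under_ends E)" "set (over_ends D) = set (over_ends E)"
    using mset_ends_eq[OF permute] by (metis set_mset_mset)+
  moreover have "over_ends D = [] \<longleftrightarrow> over_ends E = []"
    using mset_ends_eq(2)[OF permute] by (metis mset_zero_iff)
  moreover have "distinct (map s (under_ends D)) = distinct (map s (under_ends E))"
    "distinct (map s (over_ends D)) = distinct (map s (over_ends E))" for s :: "nat \<Rightarrow> nat"
    using mset_ends_eq[OF permute] by (metis mset_map mset_eq_imp_distinct_iff)+
  ultimately show ?case by (simp only: alternating_strands_def list.set_map)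
next
  case (rename f D)
  have "alternating_strands D ((s \<circ> the_inv_into (edges D) f) \<circ> f)" if "alternating_strands D s" for s
    by (rule alternating_strands_cong[OF _ that]) (simp add: the_inv_into_f_f[OF rename])
  then show ?case unfolding alternating_strands_map_piece by blast
next
  case (turn_Cross a b c d D)
  have "alternating_strands (Cross a b c d # D) s \<longleftrightarrow> alternating_strands (Cross c d a b # D) s" for s
    unfolding alternating_strands_def by (auto simp: insert_commute)
  then show ?case by simp
next
  case (turn_Joint a b D)
  have "alternating_strands (Joint a b # D) s \<longleftrightarrow> alternating_strands (Joint b a # D) s" for s
    unfolding alternating_strands_def by auto
  then show ?case by simp
next
  case (remove_Joint a b D)
  let ?f = "\<lambda>x. if x = b then a else x"
  have J: "alternating_strands (Joint a b # D) s \<longleftrightarrow> s a = s b \<and> alternating_strands D s" for s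
    unfolding alternating_strands_def by auto
  have "s \<circ> ?f = s" if "s a = s b" for s :: "nat \<Rightarrow> nat" using that by auto
  moreover have "(s \<circ> ?f) a = (s \<circ> ?f) b" for s :: "nat \<Rightarrow> nat" by simp
  ultimately show ?case unfolding J alternating_strands_map_piece by metis
qed

lemma alternating_strands_same_diagram:
  assumes "same_diagram D E" "alternating_strands D s"
  shows "\<exists>s. alternating_strands E s"
  using assms(1) unfolding same_diagram_def
proof (induction rule: rtranclp_induct)
  case (step E F)
  then show ?case
    using alternating_strands_planar_move unfolding between_diagrams_def by blast
qed (use assms(2) in blast)

lemma link_diagram_same_diagram:
  assumes "same_diagram D E" "link_diagram D"
  shows "link_diagram E"
  using assms(1) unfolding same_diagram_def
  by (induction rule: rtranclp_induct) (auto simp: assms(2) between_diagrams_def)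

lemma alternating_strands_tail:
  "alternating_strands (Joint a b # D) s \<Longrightarrow> s a = s b \<and> alternating_strands D s"
  by (simp add: alternating_strands_def)

section \<open>Reduced alternating diagrams\<close>

lemma mate_props:
  assumes "edges_have_two_ends D" "d \<in> darts D"
  shows "mate D d \<in> darts D" "mate D d \<noteq> d" "label D (mate D d) = label D d"
    and "\<And>d'. d' \<in> darts D \<Longrightarrow> d' \<noteq> d \<Longrightarrow> label D d' = label D d \<Longrightarrow> mate D d = d'"
proof -
  let ?S = "{d' \<in> darts D. label D d' = label D d}"
  have "label D d \<in> edges D" using assms(2) by (simp add: edges_def)
  then have "card ?S = 2" using assms(1) by (simp add: edges_have_two_ends_def)
  then obtain x y where xy: "?S = {x, y}" "x \<noteq> y" by (auto simp: card_2_iff)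
  moreover have "d \<in> ?S" using assms(2) by simp
  ultimately consider "d = x" | "d = y" by blast
  then obtain z where z: "?S = {d, z}" "z \<noteq> d"
  proof cases
    case 1 then show ?thesis using that[of y] xy by simp
  next
    case 2 then show ?thesis using that[of x] xy insert_commute[of x y "{}"] by simp
  qed
  have uniq: "\<exists>!d'. d' \<in> darts D \<and> d' \<noteq> d \<and> label D d' = label D d"
    using z by (intro ex1I[of _ z]) auto
  then have m: "mate D d \<in> darts D \<and> mate D d \<noteq> d \<and> label D (mate D d) = label D d"
    unfolding mate_def by (rule theI')
  then show "mate D d \<in> darts D" "mate D d \<noteq> d" "label D (mate D d) = label D d" by auto
  show "mate D d = d'" if "d' \<in> darts D" "d' \<noteq> d" "label D d' = label D d" for d'
    using uniq m that by blast
qed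

lemma mate_mate:
  assumes "edges_have_two_ends D" "d \<in> darts D"
  shows "mate D (mate D d) = d"
proof (rule mate_props(4)[OF assms(1) _ assms(2)])
  show "mate D d \<in> darts D" "d \<noteq> mate D d" "label D d = label D (mate D d)"
    using mate_props(1-3)[OF assms] by auto
qed

lemma rot_in_darts: "d \<in> darts D \<Longrightarrow> rot D d \<in> darts D"
  by (auto simp: rot_def darts_def intro: mod_less_divisor)

lemma inj_on_rot: "inj_on (rot D) (darts D)"
proof (rule inj_onI)
  fix d d' assume d: "d \<in> darts D" "d' \<in> darts D" "rot D d = rot D d'"
  have "k = k'" if "k < n" "k' < n" "Suc k mod n = Suc k' mod n" for k k' n :: nat
    using that by (simp add: mod_Suc split: if_splits)
  from this[of "snd d" "length (ends (D ! fst d))" "snd d'"] show "d = d'"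
    using d by (auto simp: rot_def darts_def case_prod_beta prod_eq_iff)
qed

lemma finite_darts: "finite (darts D)"
proof -
  have "darts D = Sigma {..<length D} (\<lambda>i. {..<length (ends (D ! i))})"
    by (auto simp: darts_def)
  then show ?thesis by simp
qed

lemma orbit_step:
  assumes "finite S" "\<And>x. x \<in> S \<Longrightarrow> f x \<in> S" "inj_on f S" "x \<in> S"
  shows "{(f ^^ n) (f x) | n. True} = {(f ^^ n) x | n. True}"
proof -
  have S: "(f ^^ n) x \<in> S" for n using assms(2,4) by (induction n) auto
  have "finite (range (\<lambda>n. (f ^^ n) x))"
    by (rule finite_subset[OF _ assms(1)]) (use S in blast)
  then have "\<not> inj (\<lambda>n. (f ^^ n) x)" using finite_imageD infinite_UNIV_nat by blast
  then obtain i' j' where "i' \<noteq> j'" "(f ^^ i') x = (f ^^ j') x" unfolding inj_def by blast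
  then obtain i j where "i < j" "(f ^^ i) x = (f ^^ j) x"
    by (cases i' j' rule: linorder_cases) auto
  then have "\<exists>m. (f ^^ Suc m) x = x"
  proof (induction i arbitrary: j)
    case 0
    then show ?case by (metis funpow_0 gr0_implies_Suc)
  next
    case (Suc i)
    then obtain j' where j': "j = Suc j'" "i < j'" by (cases j) auto
    then have "f ((f ^^ i) x) = f ((f ^^ j') x)" using Suc.prems by simp
    then have "(f ^^ i) x = (f ^^ j') x" by (rule inj_onD[OF assms(3) _ S S])
    then show ?case using Suc.IH j' by blast
  qed
  then obtain m where m: "(f ^^ m) (f x) = x" by (auto simp: funpow_swap1)
  show ?thesis
  proof (intro equalityI subsetI)
    fix y assume "y \<in> {(f ^^ n) (f x) | n. True}"
    then obtain n where "y = (f ^^ Suc n) x" by (auto simp: funpow_swap1)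
    then show "y \<in> {(f ^^ n) x | n. True}" by blast
  next
    fix y assume "y \<in> {(f ^^ n) x | n. True}"
    then obtain n where "y = (f ^^ n) x" by blast
    then have "y = (f ^^ (n + m)) (f x)" unfolding funpow_add comp_apply m .
    then show "y \<in> {(f ^^ n) (f x) | n. True}" by blast
  qed
qed

text \<open>The faces are the orbits of a permutation of a finite set, so the next dart generates the same
orbit.\<close>

lemma face_step:
  assumes "edges_have_two_ends D" "d \<in> darts D"
  shows "face D (rot D (mate D d)) = face D d"
proof -
  let ?f = "rot D \<circ> mate D"
  have "inj_on (mate D) (darts D)"
    using mate_mate[OF assms(1)] by (metis inj_onI)
  moreover have "mate D ` darts D \<subseteq> darts D" using mate_props(1)[OF assms(1)] by blast
  ultimately have "inj_on ?f (darts D)" using inj_on_rot by (metis comp_inj_on inj_on_subset)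
  then show ?thesis
    unfolding face_def
    using orbit_step[of "darts D" ?f d] assms finite_darts mate_props(1) rot_in_darts by auto
qed

text \<open>A loop at a crossing joins neighbouring ends and encloses a monogon.  The two corners next to
that of the monogon then belong to the same face, which runs around the loop.\<close>

lemma reduced_no_loop:
  assumes D: "edges_have_two_ends D" and red: "reduced_diagram D"
    and p: "Cross a b c d \<in> set D"
  shows "{a, c} \<inter> {b, d} = {}"
proof -
  obtain i where i: "i < length D" "D ! i = Cross a b c d" using p by (metis in_set_conv_nth)
  have inj: "inj_on (\<lambda>k. face D (i, k)) {..<4}"
    using red i unfolding reduced_diagram_def by blast
  have darts: "(i, k) \<in> darts D \<longleftrightarrow> k < 4" for k using i by (auto simp: darts_def)
  have neq: "[a, b, c, d] ! k \<noteq> [a, b, c, d] ! (Suc k mod 4)" if k: "k < 4" for k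
  proof
    assume eq: "[a, b, c, d] ! k = [a, b, c, d] ! (Suc k mod 4)"
    have k': "Suc k mod 4 \<noteq> k" "Suc (Suc k mod 4) mod 4 \<noteq> k"
      "Suc k mod 4 < 4" "Suc (Suc k mod 4) mod 4 < 4"
      using k by presburger+
    have label: "label D (i, m) = [a, b, c, d] ! m" for m by (simp add: label_def i)
    have "mate D (i, k) = (i, Suc k mod 4)"
      by (rule mate_props(4)[OF D]) (use k k' eq in \<open>simp_all only: darts label prod.inject simp_thms\<close>)
    moreover have "rot D (i, m) = (i, Suc m mod 4)" for m by (simp add: rot_def i)
    ultimately have "face D (i, Suc (Suc k mod 4) mod 4) = face D (i, k)"
      using face_step[OF D, of "(i, k)"] k darts by (simp only: simp_thms)
    then have "Suc (Suc k mod 4) mod 4 = k"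
      using inj_onD[OF inj, of "Suc (Suc k mod 4) mod 4" k] k k'(4) by simp
    then show False using k'(2) by simp
  qed
  have "a \<noteq> b" "b \<noteq> c" "c \<noteq> d" "d \<noteq> a"
    using neq[of 0] neq[of 1] neq[of 2] neq[of 3] by simp_all
  then show ?thesis by blast
qed

lemma link_diagram_unlink: "link_diagram (unlink n)"
proof -
  let ?D = "unlink n"
  have len: "length ?D = n" and nth: "\<And>i. i < n \<Longrightarrow> ?D ! i = Joint i i"
    by (simp_all add: unlink_def)
  have darts: "darts ?D = {..<n} \<times> {0, 1}" by (auto simp: darts_def len nth)
  have label: "label ?D (i, k) = i" if "(i, k) \<in> darts ?D" for i k
    using that by (auto simp: label_def darts nth)
  have edges: "edges ?D = {..<n}" unfolding edges_eq by (auto simp: unlink_def)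
  have "{d \<in> darts ?D. label ?D d = e} = {(e, 0), (e, 1)}" if "e < n" for e
    using that label by (force simp: darts)
  then have two: "edges_have_two_ends ?D"
    unfolding edges_have_two_ends_def edges by auto
  have step: "rot ?D (mate ?D d) = d" if d: "d \<in> darts ?D" for d
  proof -
    obtain i k where ik: "d = (i, k)" "i < n" "k = 0 \<or> k = 1" using d by (auto simp: darts)
    have "mate ?D d = (i, 1 - k)"
      using ik d label by (intro mate_props(4)[OF two]) (auto simp: darts)
    then show ?thesis using ik by (auto simp: rot_def nth)
  qed
  have "((rot ?D \<circ> mate ?D) ^^ m) d = d" if "d \<in> darts ?D" for d m
    using step[OF that] by (induction m) auto
  then have "face ?D d = {d}" if "d \<in> darts ?D" for d using that by (auto simp: face_def)
  then have "faces ?D = (\<lambda>d. {d}) ` darts ?D" unfolding faces_def by (rule image_cong[OF HOL.refl])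
  then have "card (faces ?D) = card (darts ?D)" by (simp add: card_image)
  then have faces: "card (faces ?D) = 2 * n" by (simp add: darts card_cartesian_product)
  have adj: "(d, d') \<in> adjacent_darts ?D \<longleftrightarrow> d \<in> darts ?D \<and> d' \<in> darts ?D \<and> fst d = fst d'" for d d'
    using label by (cases d; cases d') (auto simp: adjacent_darts_def)
  have "fst d' = fst d \<and> d' \<in> darts ?D" if "(d, d') \<in> (adjacent_darts ?D)\<^sup>*" "d \<in> darts ?D" for d d'
    using that by (induction rule: rtrancl_induct) (auto simp: adj)
  then have comp: "{d'. (d, d') \<in> (adjacent_darts ?D)\<^sup>*} = {fst d} \<times> {0, 1}" if "d \<in> darts ?D" for d
    using that adj by (fastforce simp: darts)
  have "graph_components ?D = (\<lambda>d. {fst d} \<times> {0, 1}) ` darts ?D"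
    unfolding graph_components_def using comp by (rule image_cong[OF HOL.refl])
  also have "\<dots> = (\<lambda>i. {i} \<times> {0, 1}) ` {..<n}" by (force simp: darts)
  also have "card \<dots> = n"
  proof -
    have "inj_on (\<lambda>i. {i} \<times> {0, 1 :: nat}) {..<n}" by (rule inj_onI) blast
    then show ?thesis by (simp only: card_image card_lessThan)
  qed
  finally have "card (graph_components ?D) = n" .
  then show ?thesis
    using two faces by (simp add: link_diagram_def planar_def len edges)
qed

lemma sum_list_two:
  fixes f :: "'a \<Rightarrow> nat"
  assumes "p \<in> set D" "p' \<in> set D" "p \<noteq> p'"
  shows "f p + f p' \<le> sum_list (map f D)"
  using assms
proof (induction D)
  case (Cons x D)
  have "f y \<le> sum_list (map f D)" if "y \<in> set D" for y
    using that by (intro member_le_sum_list) auto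
  then show ?case using Cons by fastforce
qed simp

lemma count_ends_split:
  "count_list (end_labels D) e = count_list (under_ends D) e + count_list (over_ends D) e +
     sum_list (map (\<lambda>p. case p of Joint a b \<Rightarrow> count_list [a, b] e | Cross a b c d \<Rightarrow> 0) D)"
proof (induction D)
  case (Cons p D)
  then show ?case by (cases p) auto
qed simp

text \<open>An edge of an alternating diagram has an under-end and an over-end, which are already its two
ends, unless it is a circle without crossings.\<close>

lemma alternating_no_joints:
  assumes "edges_have_two_ends D" "alternating_diagram D"
  shows "Joint a b \<in> set D \<Longrightarrow> a = b"
    and "e \<in> edges D \<Longrightarrow> Joint e e \<notin> set D \<Longrightarrow>
      count_list (under_ends D) e = 1 \<and> count_list (over_ends D) e = 1"
    and "Joint e e \<in> set D \<Longrightarrow>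
      count_list (under_ends D) e = 0 \<and> count_list (over_ends D) e = 0"
proof -
  define J where "J e p = (case p of Joint a b \<Rightarrow> count_list [a, b] e | Cross a b c d \<Rightarrow> 0)" for e p
  have J_Joint: "J e (Joint a b) = (if a = e then 1 else 0) + (if b = e then 1 else 0)" for e a b
    by (simp add: J_def)
  have two: "count_list (under_ends D) e + count_list (over_ends D) e + sum_list (map (J e) D) = 2"
    if "e \<in> edges D" for e
    using two_ends_count[OF assms(1), of e] that
    by (simp only: count_ends_split J_def[abs_def] if_True)
  show one: "count_list (under_ends D) e = 1 \<and> count_list (over_ends D) e = 1"
    if "e \<in> edges D" "Joint e e \<notin> set D" for e
    using assms(2) that unfolding alternating_diagram_def by blast
  have le: "J e p \<le> sum_list (map (J e) D)" if "p \<in> set D" for e p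
    using that by (intro member_le_sum_list) auto
  show "count_list (under_ends D) e = 0 \<and> count_list (over_ends D) e = 0"
    if "Joint e e \<in> set D" for e
    using le[OF that, of e] two[of e] piece_edges[OF that, of e] by (simp add: J_Joint)
  show "a = b" if ab: "Joint a b \<in> set D"
  proof (rule ccontr)
    assume neq: "a \<noteq> b"
    have a: "a \<in> edges D" using piece_edges[OF ab] by simp
    show False
    proof (cases "Joint a a \<in> set D")
      case True
      then show ?thesis using sum_list_two[OF True ab, of "J a"] two[OF a] neq by (simp add: J_Joint)
    next
      case False
      then show ?thesis using one[OF a False] le[OF ab, of a] two[OF a] neq by (simp add: J_Joint)
    qed
  qed
qed

text \<open>Without crossings an alternating diagram consists of circles \<open>Joint e e\<close>, so renaming its edges
gives the standard diagram of an unlink.\<close>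

lemma no_crossing_trivial:
  assumes D: "link_diagram D" and alt: "alternating_diagram D" and "over_ends D = []"
  shows "trivial_link D"
proof -
  have two: "edges_have_two_ends D" using D by (simp add: link_diagram_def)
  define f where "f = (\<lambda>i. fst (case D ! i of Joint a b \<Rightarrow> (a, b) | Cross a b c d \<Rightarrow> (a, b)))"
  have piece: "\<exists>a. p = Joint a a" if p: "p \<in> set D" for p
  proof (cases p)
    case (Cross a b c d)
    then have "b \<in> set (over_ends D)" using p by (force simp: over_ends_def)
    then show ?thesis using assms(3) by simp
  next
    case (Joint a b)
    then show ?thesis using alternating_no_joints(1)[OF two alt] p by blast
  qed
  have nth: "D ! i = Joint (f i) (f i)" if "i < length D" for i
    using piece[OF nth_mem[OF that]] by (auto simp: f_def)
  have "map (map_piece f) (unlink (length D)) = D"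
    by (rule nth_equalityI) (auto simp: unlink_def nth)
  moreover have "inj_on f (edges (unlink (length D)))"
  proof (rule inj_onI)
    fix i j assume "i \<in> edges (unlink (length D))" "j \<in> edges (unlink (length D))" and eq: "f i = f j"
    then have ij: "i < length D" "j < length D" by (auto simp: edges_eq unlink_def)
    have "{(i, 0), (i, 1), (j, 0)} \<subseteq> {d \<in> darts D. label D d = f i}"
      using ij eq by (auto simp: darts_def label_def nth)
    moreover have "card {d \<in> darts D. label D d = f i} = 2"
      using two piece_edges[OF nth_mem[OF ij(1)], of "f i"] nth[OF ij(1)]
      unfolding edges_have_two_ends_def by simp
    ultimately have "card {(i, 0), (i, 1), (j, 0 :: nat)} \<le> 2"
      by (metis (lifting) card_mono card.infinite zero_neq_numeral)
    then show "i = j" by (auto simp: card_insert_if split: if_splits)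
  qed
  ultimately have "planar_move (unlink (length D)) D"
    using planar_move.rename[of f "unlink (length D)"] by simp
  then have "isotopic D (unlink (length D))"
    unfolding isotopic_def between_diagrams_def using D link_diagram_unlink by blast
  then show ?thesis unfolding trivial_link_def by blast
qed

lemma alternating_strands_id:
  assumes "link_diagram D" "reduced_diagram D" "alternating_diagram D" "\<not> trivial_link D"
  shows "alternating_strands D id"
proof -
  have two: "edges_have_two_ends D" using assms(1) by (simp add: link_diagram_def)
  note joints = alternating_no_joints[OF two assms(3)]
  have one: "e \<in> set (under_ends D) \<union> set (over_ends D) \<Longrightarrow>
      count_list (under_ends D) e = 1 \<and> count_list (over_ends D) e = 1" for e
  proof -
    assume e: "e \<in> set (under_ends D) \<union> set (over_ends D)"
    then have "e \<in> edges D" using ends_subset[of D] by blast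
    moreover have "Joint e e \<notin> set D" using joints(3)[of e] e by (auto simp: count_list_0_iff)
    ultimately show ?thesis by (rule joints(2))
  qed
  have dist: "distinct xs" if "\<And>e. e \<in> set xs \<Longrightarrow> count_list xs e = 1" for xs :: "nat list"
    unfolding distinct_count_atmost_1 count_mset using that by (simp add: count_list_0_iff)
  have "piece_stranded id p" if "p \<in> set D" for p
    using reduced_no_loop[OF two assms(2)] joints(1) that by (cases p) auto
  moreover have "distinct (under_ends D)" "distinct (over_ends D)" using one by (auto intro!: dist)
  moreover have "set (under_ends D) = set (over_ends D)"
  proof -
    have "e \<in> set (under_ends D) \<longleftrightarrow> e \<in> set (over_ends D)" for e
      using one[of e] count_list_0_iff[of "under_ends D" e] count_list_0_iff[of "over_ends D" e]
      by auto
    then show ?thesis by blast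
  qed
  moreover have "over_ends D \<noteq> []"
    using no_crossing_trivial assms by blast
  ultimately show ?thesis by (simp add: alternating_strands_def)
qed

section \<open>Counting ends\<close>

text \<open>The positions \<open>2 * i\<close> and \<open>2 * i + 1\<close> in the lists of under-ends and over-ends belong to the
\<open>i\<close>-th crossing.\<close>

lemma sum_pairs: "(\<Sum>k<2 * n. F k) = (\<Sum>i<n. F (2 * i) + F (2 * i + 1))" for F :: "nat \<Rightarrow> int"
  by (induction n) simp_all

lemma ends_at_crossings:
  "\<exists>n. length (under_ends D) = 2 * n \<and> length (over_ends D) = 2 * n \<and>
     (\<forall>i<n. Cross (under_ends D ! (2 * i)) (over_ends D ! (2 * i))
                  (under_ends D ! (2 * i + 1)) (over_ends D ! (2 * i + 1)) \<in> set D) \<and>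
     (\<forall>a b c d. Cross a b c d \<in> set D \<longrightarrow> (\<exists>i<n.
        under_ends D ! (2 * i) = a \<and> over_ends D ! (2 * i) = b \<and>
        under_ends D ! (2 * i + 1) = c \<and> over_ends D ! (2 * i + 1) = d))"
    (is "\<exists>n. ?P D n")
proof (induction D)
  case (Cons p D)
  then obtain n where n: "?P D n" by blast
  show ?case
  proof (cases p)
    case (Cross a b c d)
    have "Cross (under_ends (p # D) ! (2 * i)) (over_ends (p # D) ! (2 * i))
                (under_ends (p # D) ! (2 * i + 1)) (over_ends (p # D) ! (2 * i + 1)) \<in> set (p # D)"
      if "i < Suc n" for i
      using n that by (cases i) (auto simp: Cross)
    moreover have "\<exists>i<Suc n.
        under_ends (p # D) ! (2 * i) = a' \<and> over_ends (p # D) ! (2 * i) = b' \<and>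
        under_ends (p # D) ! (2 * i + 1) = c' \<and> over_ends (p # D) ! (2 * i + 1) = d'"
      if "Cross a' b' c' d' \<in> set (p # D)" for a' b' c' d'
    proof (cases "Cross a' b' c' d' = p")
      case True
      then show ?thesis by (intro exI[of _ 0]) (simp add: Cross)
    next
      case False
      then have "Cross a' b' c' d' \<in> set D" using that by auto
      then obtain i where "i < n" "under_ends D ! (2 * i) = a'" "over_ends D ! (2 * i) = b'"
        "under_ends D ! (2 * i + 1) = c'" "over_ends D ! (2 * i + 1) = d'"
        using n by blast
      then show ?thesis by (intro exI[of _ "Suc i"]) (simp add: Cross)
    qed
    ultimately have "?P (p # D) (Suc n)" using n by (simp add: Cross)
    then show ?thesis by blast
  next
    case (Joint a b)
    then have "?P (p # D) n" using n by simp
    then show ?thesis by blast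
  qed
qed simp

lemma even_ends:
  assumes "edges_have_two_ends D"
  shows "even (length (filter P (end_labels D)))"
proof -
  have "length (filter P (end_labels D)) =
      (\<Sum>e\<in>set (end_labels D). count_list (filter P (end_labels D)) e)"
    by (rule sum_count_set[symmetric]) (auto simp del: set_end_labels)
  moreover have "count_list (filter P xs) e = (if P e then count_list xs e else 0)" for xs e
    by (induction xs) auto
  ultimately show ?thesis
    by (auto intro!: dvd_sum simp: two_ends_count[OF assms])
qed

text \<open>A joint contributes both or none of its ends.\<close>

lemma even_ends_crossings:
  assumes "\<And>a b. Joint a b \<in> set D \<Longrightarrow> P a = P b"
  shows "even (length (filter P (end_labels D))) \<longleftrightarrow>
    even (length (filter P (under_ends D)) + length (filter P (over_ends D)))"
  using assms
proof (induction D)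
  case (Cons p D)
  then have IH: "even (length (filter P (end_labels D))) \<longleftrightarrow>
    even (length (filter P (under_ends D)) + length (filter P (over_ends D)))" by simp
  show ?case
  proof (cases p)
    case (Cross a b c d)
    then show ?thesis using IH by (cases "P a"; cases "P b"; cases "P c"; cases "P d") simp_all
  next
    case (Joint a b)
    then have "P a = P b" using Cons.prems by simp
    then show ?thesis using IH Joint by simp
  qed
qed simp

lemma filter_strand:
  assumes "distinct (map s xs)"
  shows "a \<in> set xs \<Longrightarrow> length (filter (\<lambda>e. s e = s a \<and> R e) xs) = of_bool (R a)"
  using assms
proof (induction xs)
  case (Cons y xs)
  have none: "filter (\<lambda>e. s e = s y \<and> R e) xs = []"
  proof -
    have "s e \<noteq> s y" if "e \<in> set xs" for e 
    proof
      assume "s e = s y"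
      then have "s y \<in> s ` set xs" using that by (metis imageI)
      then show False using Cons.prems(2) by simp
    qed
    then show ?thesis by (simp add: filter_empty_conv)
  qed
  show ?case
  proof (cases "a = y")
    case True
    then show ?thesis using none by simp
  next
    case False
    then have "s y \<noteq> s a" "a \<in> set xs" using Cons.prems by auto
    then show ?thesis using Cons by simp
  qed
qed simp

section \<open>The digraph of an alternating code\<close>

locale alternating_code =
  fixes E :: pd and s :: "nat \<Rightarrow> nat"
  assumes alternating: "alternating_strands E s"
begin

definition crossing_number :: nat where
  "crossing_number = length (over_ends E) div 2"

definition strands :: "nat set" where
  "strands = s ` set (under_ends E)"

text \<open>The strands at the \<open>k\<close>-th under-end and over-end; \<open>k div 2\<close> is the number of the crossing.\<close>

definition under_strand :: "nat \<Rightarrow> nat" where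
  "under_strand k = s (under_ends E ! k)"

definition over_strand :: "nat \<Rightarrow> nat" where
  "over_strand k = s (over_ends E ! k)"

text \<open>The crossing at which the strand \<open>x\<close> ends as an over-strand.\<close>

definition head :: "nat \<Rightarrow> nat" where
  "head x = inv_into {..<2 * crossing_number} over_strand x div 2"

text \<open>The target of the arrow along the strand that leaves the \<open>k\<close>-th under-end.  The permutation
\<open>\<pi>\<close> of the strands, the identity or a transposition, allows the targets of two arrows to be
exchanged.\<close>

definition next_crossing :: "(nat \<Rightarrow> nat) \<Rightarrow> nat \<Rightarrow> nat" where
  "next_crossing \<pi> k = head (\<pi> (under_strand k))"

lemma ends_at:
  "length (under_ends E) = 2 * crossing_number" "length (over_ends E) = 2 * crossing_number"
  "i < crossing_number \<Longrightarrow>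
    Cross (under_ends E ! (2 * i)) (over_ends E ! (2 * i))
          (under_ends E ! (2 * i + 1)) (over_ends E ! (2 * i + 1)) \<in> set E"
  "Cross a b c d \<in> set E \<Longrightarrow> \<exists>i<crossing_number.
     under_ends E ! (2 * i) = a \<and> over_ends E ! (2 * i) = b \<and>
     under_ends E ! (2 * i + 1) = c \<and> over_ends E ! (2 * i + 1) = d"
  using ends_at_crossings[of E] by (auto simp: crossing_number_def)

lemma bij_under: "bij_betw under_strand {..<2 * crossing_number} strands"
  and bij_over: "bij_betw over_strand {..<2 * crossing_number} strands"
proof -
  have "distinct (map s (under_ends E))" "distinct (map s (over_ends E))"
    "set (map s (under_ends E)) = set (map s (over_ends E))"
    using alternating by (simp_all add: alternating_strands_def)
  note d = this
  have "bij_betw (\<lambda>k. map s (under_ends E) ! k) {..<2 * crossing_number} strands"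
    using bij_betw_nth[OF d(1)] ends_at(1) by (simp add: strands_def)
  then show "bij_betw under_strand {..<2 * crossing_number} strands"
    by (rule bij_betw_cong[THEN iffD1, rotated]) (simp add: under_strand_def ends_at)
  have "bij_betw (\<lambda>k. map s (over_ends E) ! k) {..<2 * crossing_number} strands"
    using bij_betw_nth[OF d(2)] ends_at(2) d(3) by (simp add: strands_def)
  then show "bij_betw over_strand {..<2 * crossing_number} strands"
    by (rule bij_betw_cong[THEN iffD1, rotated]) (simp add: over_strand_def ends_at)
qed

lemma head_over_strand: "k < 2 * crossing_number \<Longrightarrow> head (over_strand k) = k div 2"
  using bij_over by (simp add: head_def bij_betw_def inv_into_f_f)

lemma strand_cases:
  assumes "x \<in> strands"
  obtains k where "k < 2 * crossing_number" "x = over_strand k" "head x = k div 2"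
proof -
  have "x \<in> over_strand ` {..<2 * crossing_number}"
    using assms bij_betw_imp_surj_on[OF bij_over] by simp
  then obtain k where "k < 2 * crossing_number" "x = over_strand k" by auto
  then show ?thesis using that head_over_strand by blast
qed

lemma head_less:
  assumes "x \<in> strands"
  shows "head x < crossing_number"
proof -
  obtain k where "k < 2 * crossing_number" "head x = k div 2"
    using assms by (rule strand_cases)
  then show ?thesis by simp
qed

lemma under_strand_in: "k < 2 * crossing_number \<Longrightarrow> under_strand k \<in> strands"
  using bij_betw_apply[OF bij_under] by simp

text \<open>Each strand has one under-end and one over-end, so that sums over under-ends may be reindexed over
over-ends.\<close>

lemma balanced_next_crossing:
  assumes "bij_betw \<pi> strands strands"
  shows "balanced {..<crossing_number}
    (\<lambda>i. next_crossing \<pi> (2 * i)) (\<lambda>i. next_crossing \<pi> (2 * i + 1))"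
proof -
  have less: "next_crossing \<pi> k < crossing_number" if "k < 2 * crossing_number" for k
    unfolding next_crossing_def
    by (rule head_less[OF bij_betw_apply[OF assms under_strand_in[OF that]]])
  have sums: "(\<Sum>i<crossing_number. h (next_crossing \<pi> (2 * i)) + h (next_crossing \<pi> (2 * i + 1)))
      = (\<Sum>i<crossing_number. 2 * h i)" for h :: "nat \<Rightarrow> int"
  proof -
    let ?K = "{..<2 * crossing_number}"
    have "(\<Sum>i<crossing_number. h (next_crossing \<pi> (2 * i)) + h (next_crossing \<pi> (2 * i + 1)))
        = (\<Sum>k\<in>?K. h (next_crossing \<pi> k))"
      by (rule sum_pairs[of "\<lambda>k. h (next_crossing \<pi> k)", symmetric])
    also have "\<dots> = (\<Sum>x\<in>strands. h (head (\<pi> x)))"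
      unfolding next_crossing_def
      by (rule sum.reindex_bij_betw[OF bij_under, of "\<lambda>x. h (head (\<pi> x))"])
    also have "\<dots> = (\<Sum>x\<in>strands. h (head x))"
      by (rule sum.reindex_bij_betw[OF assms, of "\<lambda>x. h (head x)"])
    also have "\<dots> = (\<Sum>k\<in>?K. h (head (over_strand k)))"
      by (rule sum.reindex_bij_betw[OF bij_over, of "\<lambda>x. h (head x)", symmetric])
    also have "\<dots> = (\<Sum>k\<in>?K. h (k div 2))"
      by (rule sum.cong[OF HOL.refl]) (simp only: lessThan_iff head_over_strand)
    also have "\<dots> = (\<Sum>i<crossing_number. 2 * h i)"
      unfolding sum_pairs[of "\<lambda>k. h (k div 2)"] by (rule sum.cong) simp_all
    finally show ?thesis .
  qed
  have "2 * i < 2 * crossing_number" "2 * i + 1 < 2 * crossing_number" if "i < crossing_number" for i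
    using that by simp_all
  then show ?thesis
    unfolding balanced_def using sums less by (simp only: image_subset_iff lessThan_iff) blast
qed

lemma no_loops:
  assumes "k < 2 * crossing_number"
  shows "head (under_strand k) \<noteq> k div 2"
proof
  assume eq: "head (under_strand k) = k div 2"
  define i where "i = k div 2"
  have half: "m = 2 * i \<or> m = 2 * i + 1" if "m div 2 = i" for m :: nat using that by presburger
  have "i < crossing_number" using assms by (simp add: i_def)
  then have "piece_stranded s (Cross (under_ends E ! (2 * i)) (over_ends E ! (2 * i))
      (under_ends E ! (2 * i + 1)) (over_ends E ! (2 * i + 1)))"
    using ends_at(3)[of i] alternating unfolding alternating_strands_def by blast
  then have disjoint: "{under_strand (2 * i), under_strand (2 * i + 1)} \<inter>
      {over_strand (2 * i), over_strand (2 * i + 1)} = {}"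
    by (simp only: piece_stranded.simps under_strand_def over_strand_def)
  obtain m where m: "under_strand k = over_strand m" "head (under_strand k) = m div 2"
    using under_strand_in[OF assms] by (rule strand_cases)
  have "k = 2 * i \<or> k = 2 * i + 1" "m = 2 * i \<or> m = 2 * i + 1"
    using half[of k] half[of m] eq m(2) by (simp_all only: i_def)
  then show False using disjoint m(1) by blast
qed

definition over_colour :: "(nat \<Rightarrow> 'x) \<Rightarrow> nat \<Rightarrow> 'x" where
  "over_colour q i = q (over_ends E ! (2 * i))"

lemma over_colour_head:
  assumes "colouring Q E q" "b \<in> set (over_ends E)"
  shows "q b = over_colour q (head (s b))"
proof -
  obtain k where "k < length (over_ends E)" "over_ends E ! k = b"
    using assms(2) unfolding in_set_conv_nth by blast
  then have k: "k < 2 * crossing_number" "over_ends E ! k = b" by (simp_all only: ends_at(2))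
  define i where "i = k div 2"
  have i: "i < crossing_number" using k(1) by (simp add: i_def)
  have head: "head (s b) = i"
    using head_over_strand[OF k(1)] by (simp only: over_strand_def k(2) i_def)
  have "piece_coloured Q q (Cross (under_ends E ! (2 * i)) (over_ends E ! (2 * i))
      (under_ends E ! (2 * i + 1)) (over_ends E ! (2 * i + 1)))"
    using ends_at(3)[OF i] assms(1) unfolding colouring_def by blast
  then have eq: "q (over_ends E ! (2 * i)) = q (over_ends E ! (2 * i + 1))" by simp
  have "k = 2 * i \<or> k = 2 * i + 1" unfolding i_def by presburger
  then have "q b = q (over_ends E ! (2 * i))"
  proof
    assume "k = 2 * i"
    then show ?thesis using k(2) by simp
  next
    assume "k = 2 * i + 1"
    then show ?thesis using k(2) eq by simp
  qed
  then show ?thesis by (simp only: over_colour_def head)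
qed

definition under_colour :: "(nat \<Rightarrow> 'x) \<Rightarrow> nat \<Rightarrow> 'x" where
  "under_colour q k = q (under_ends E ! k)"

lemma crossing_colours:
  assumes "colouring Q E q" "i < crossing_number"
  shows "over_colour q i \<in> elems Q" "under_colour q (2 * i) \<in> elems Q"
    "under_colour q (2 * i + 1) = act Q (under_colour q (2 * i)) (over_colour q i)"
proof -
  let ?p = "Cross (under_ends E ! (2 * i)) (over_ends E ! (2 * i))
    (under_ends E ! (2 * i + 1)) (over_ends E ! (2 * i + 1))"
  have "\<forall>e\<in>set (ends ?p). q e \<in> elems Q" "piece_coloured Q q ?p"
    using ends_at(3)[OF assms(2)] assms(1) unfolding colouring_def by blast+
  then show "over_colour q i \<in> elems Q" "under_colour q (2 * i) \<in> elems Q"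
    "under_colour q (2 * i + 1) = act Q (under_colour q (2 * i)) (over_colour q i)"
    by (simp_all add: over_colour_def under_colour_def)
qed

lemma over_colour_in: "i < crossing_number \<Longrightarrow> over_colour q i \<in> q ` edges E"
  and under_colour_in: "k < 2 * crossing_number \<Longrightarrow> under_colour q k \<in> q ` edges E"
  using ends_subset[of E] ends_at(1,2)
  by (auto simp: over_colour_def under_colour_def intro!: imageI subsetD[OF _ nth_mem])

lemma swap_bij:
  assumes "x1 = x2 \<or> x1 \<in> strands \<and> x2 \<in> strands"
  shows "bij_betw (id(x1 := x2, x2 := x1)) strands strands"
  by (rule bij_betw_byWitness[of _ "id(x1 := x2, x2 := x1)"]) (use assms in auto)

lemma slot_cases:
  assumes "k < 2 * crossing_number"
  obtains i where "i < crossing_number" "k div 2 = i" "k = 2 * i \<or> k = 2 * i + 1"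
proof
  show "k div 2 < crossing_number" using assms by simp
  show "k = 2 * (k div 2) \<or> k = 2 * (k div 2) + 1" by presburger
qed simp

text \<open>With the rank of the colours in a left-order or its negative for \<open>\<kappa>\<close>, this excludes jumps that all
go down as well as jumps that all go up.\<close>

lemma rigid_strands:
  fixes \<kappa> :: "'x \<Rightarrow> int"
  assumes "bij_betw \<pi> strands strands"
    and between: "\<And>i. i < crossing_number \<Longrightarrow> \<kappa> (over_colour q i) \<le> \<kappa> (under_colour q (2 * i)) \<Longrightarrow>
      \<kappa> (over_colour q i) \<le> \<kappa> (under_colour q (2 * i + 1)) \<Longrightarrow>
      \<kappa> (under_colour q (2 * i)) = \<kappa> (over_colour q i) \<and>
      \<kappa> (under_colour q (2 * i + 1)) = \<kappa> (over_colour q i)"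
    and le: "\<And>k. k < 2 * crossing_number \<Longrightarrow>
      \<kappa> (over_colour q (next_crossing \<pi> k)) \<le> \<kappa> (under_colour q k)"
    and k: "k < 2 * crossing_number"
  shows "\<kappa> (under_colour q k) = \<kappa> (over_colour q (next_crossing \<pi> k))"
    "\<kappa> (over_colour q (next_crossing \<pi> k)) = \<kappa> (over_colour q (k div 2))"
proof -
  obtain i where i: "i < crossing_number" "k div 2 = i" "k = 2 * i \<or> k = 2 * i + 1"
    using k by (rule slot_cases)
  have r: "\<kappa> (under_colour q (2 * i)) = \<kappa> (over_colour q (next_crossing \<pi> (2 * i))) \<and>
    \<kappa> (under_colour q (2 * i + 1)) = \<kappa> (over_colour q (next_crossing \<pi> (2 * i + 1))) \<and>
    \<kappa> (over_colour q (next_crossing \<pi> (2 * i))) = \<kappa> (over_colour q i) \<and>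
    \<kappa> (over_colour q (next_crossing \<pi> (2 * i + 1))) = \<kappa> (over_colour q i)"
  proof (rule rigidity[OF balanced_next_crossing[OF assms(1)],
        of "\<lambda>i. \<kappa> (over_colour q i)" "\<lambda>i. \<kappa> (under_colour q (2 * i))"
           "\<lambda>i. \<kappa> (under_colour q (2 * i + 1))"])
    fix j assume "j \<in> {..<crossing_number}"
    then have j: "j < crossing_number" "2 * j < 2 * crossing_number" "2 * j + 1 < 2 * crossing_number"
      by auto
    show "\<kappa> (over_colour q (next_crossing \<pi> (2 * j))) \<le> \<kappa> (under_colour q (2 * j))"
      "\<kappa> (over_colour q (next_crossing \<pi> (2 * j + 1))) \<le> \<kappa> (under_colour q (2 * j + 1))"
      by (rule le[OF j(2)], rule le[OF j(3)])
    show "\<kappa> (under_colour q (2 * j)) = \<kappa> (over_colour q j) \<and>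
        \<kappa> (under_colour q (2 * j + 1)) = \<kappa> (over_colour q j)"
      if "\<kappa> (over_colour q j) \<le> \<kappa> (under_colour q (2 * j))"
        "\<kappa> (over_colour q j) \<le> \<kappa> (under_colour q (2 * j + 1))"
      using between[OF j(1) that] .
  qed (use i(1) in simp)
  from i(3) show "\<kappa> (under_colour q k) = \<kappa> (over_colour q (next_crossing \<pi> k))"
    using r by (elim disjE) simp_all
  from i(3) show "\<kappa> (over_colour q (next_crossing \<pi> k)) = \<kappa> (over_colour q (k div 2))"
    using r unfolding i(2) by (elim disjE) simp_all
qed

text \<open>A strand gets the colour of the crossing that it passes over; the default value \<open>z\<close> is for closed
curves without crossings.\<close>

lemma fox_colouring:
  assumes "\<And>i. i < crossing_number \<Longrightarrow>
    n dvd 2 * Z i - Z (head (under_strand (2 * i))) - Z (head (under_strand (2 * i + 1)))"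
  shows "colouring (dihedral n) E (\<lambda>e. if s e \<in> strands then Z (head (s e)) mod n else z mod n)"
    (is "colouring _ E ?y")
  unfolding colouring_def
proof (intro ballI conjI)
  fix p assume p: "p \<in> set E"
  show "?y e \<in> elems (dihedral n)" for e by (simp add: elems_dihedral)
  show "piece_coloured (dihedral n) ?y p"
  proof (cases p)
    case (Joint a b)
    then have "s a = s b" using p alternating unfolding alternating_strands_def by fastforce
    then show ?thesis using Joint by simp
  next
    case (Cross a b c d)
    then obtain i where i: "i < crossing_number"
      "under_ends E ! (2 * i) = a" "over_ends E ! (2 * i) = b"
      "under_ends E ! (2 * i + 1) = c" "over_ends E ! (2 * i + 1) = d"
      using ends_at(4) p by metis
    have k: "2 * i < 2 * crossing_number" "2 * i + 1 < 2 * crossing_number" using i(1) by auto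
    have over: "s b = over_strand (2 * i)" "s d = over_strand (2 * i + 1)"
      and under: "s a = under_strand (2 * i)" "s c = under_strand (2 * i + 1)"
      using i by (simp_all add: over_strand_def under_strand_def)
    have "s a \<in> strands" "s c \<in> strands" unfolding under by (intro under_strand_in k)+
    moreover have "s b \<in> strands" "s d \<in> strands"
      unfolding over using k bij_betw_apply[OF bij_over] by blast+
    moreover have "head (s b) = i" "head (s d) = i"
      unfolding over head_over_strand[OF k(1)] head_over_strand[OF k(2)] by simp_all
    moreover have "Z (head (s c)) mod n = (2 * (Z i mod n) - Z (head (s a)) mod n) mod n"
    proof -
      have "(2 * (Z i mod n) - Z (head (s a)) mod n) mod n =
          (2 * (Z i mod n) mod n - Z (head (s a)) mod n) mod n"
        by (rule mod_diff_left_eq[symmetric])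
      also have "\<dots> = (2 * Z i - Z (head (s a))) mod n"
        unfolding mod_mult_right_eq by (rule mod_diff_eq)
      also have "\<dots> = Z (head (s c)) mod n"
        using assms[OF i(1)] unfolding under[symmetric] mod_eq_dvd_iff .
      finally show ?thesis ..
    qed
    ultimately show ?thesis using Cross by (simp add: act_dihedral)
  qed
qed

text \<open>After the targets of the strands \<open>x1\<close> and \<open>x2\<close> have been exchanged, the component of \<open>c0\<close> lies in
the set of crossings coloured like \<open>c0\<close>.  A colouring modulo \<open>n\<close> of this component that is not
constant, continued by the value at \<open>c0\<close>, is also a colouring before the exchange: the two
strands then both end in crossings with the value at \<open>c0\<close>.  The target \<open>c0\<close> of \<open>x2\<close> is the only
crossing of the component where the exchange can create a loop.\<close>

lemma nonconstant_on_class: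
  fixes q :: "nat \<Rightarrow> 'x"
  defines "p \<equiv> over_colour q"
  assumes c0: "c0 < crossing_number"
    and swap: "x1 = x2 \<or> x1 \<in> strands \<and> x2 \<in> strands \<and> p (head x1) \<noteq> p c0 \<and> head x2 = c0"
    and const: "\<And>k. k < 2 * crossing_number \<Longrightarrow>
      p (next_crossing (id(x1 := x2, x2 := x1)) k) = p (k div 2)"
  shows "\<exists>(n :: int) Z i. n > 0 \<and> i < crossing_number \<and> p i = p c0 \<and> \<not> n dvd Z i - Z c0 \<and>
    (x1 = x2 \<or> Z (head x1) = Z (head x2)) \<and>
    (\<forall>i<crossing_number.
      n dvd 2 * Z i - Z (head (under_strand (2 * i))) - Z (head (under_strand (2 * i + 1))))"
proof -
  define \<pi> where "\<pi> = id(x1 := x2, x2 := x1)"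
  have \<pi>: "\<pi> x1 = x2" "\<pi> x2 = x1" "\<And>x. x \<noteq> x1 \<Longrightarrow> x \<noteq> x2 \<Longrightarrow> \<pi> x = x"
    by (simp_all add: \<pi>_def)
  let ?V = "{..<crossing_number}"
  define f where "f = (\<lambda>i. next_crossing \<pi> (2 * i))"
  define g where "g = (\<lambda>i. next_crossing \<pi> (2 * i + 1))"
  have bij: "bij_betw \<pi> strands strands" unfolding \<pi>_def using swap by (intro swap_bij) blast
  have bal: "balanced ?V f g" unfolding f_def g_def by (rule balanced_next_crossing[OF bij])
  have c0V: "c0 \<in> ?V" using c0 by simp
  obtain S where S: "S \<subseteq> ?V" "c0 \<in> S" "out_closed f g S" "balanced S f g" "strongly_connected S f g"
    using component_exists[OF bal c0V] by blast
  have pfg: "p (f i) = p i" "p (g i) = p i" if i: "i < crossing_number" for i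
  proof -
    have "2 * i < 2 * crossing_number" "2 * i + 1 < 2 * crossing_number" using i by simp_all
    note c = this[THEN const, folded \<pi>_def]
    have d: "(2 * i) div 2 = i" "(2 * i + 1) div 2 = i" by simp_all
    show "p (f i) = p i" unfolding f_def using c(1) unfolding d .
    show "p (g i) = p i" unfolding g_def using c(2) unfolding d .
  qed
  have pS: "p i = p c0" if "i \<in> S" for i
  proof -
    have "out_closed f g {i \<in> S. p i = p c0}"
      using S(1,3) pfg by (auto simp: out_closed_def)
    moreover have "{i \<in> S. p i = p c0} \<subseteq> S" "{i \<in> S. p i = p c0} \<noteq> {}" using S(2) by auto
    ultimately have "{i \<in> S. p i = p c0} = S"
      using S(5) unfolding strongly_connected_def by blast
    then show ?thesis using that by blast
  qed
  have fixed: "head (\<pi> (under_strand k)) \<noteq> k div 2"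
    if "k < 2 * crossing_number" "under_strand k \<notin> {x1, x2} \<or> x1 = x2" for k
  proof -
    have "\<pi> (under_strand k) = under_strand k" using that(2) \<pi>(1) \<pi>(3)[of "under_strand k"]
      by (cases "under_strand k = x1") auto
    then show ?thesis using no_loops[OF that(1)] by (simp only: simp_thms)
  qed
  have loop: "next_crossing \<pi> k \<noteq> i"
    if i: "i \<in> S" "i \<noteq> c0" "k div 2 = i" "k < 2 * crossing_number" for i k
  proof
    assume "next_crossing \<pi> k = i"
    then have eq: "head (\<pi> (under_strand k)) = i" by (simp only: next_crossing_def)
    then have ne: "x1 \<noteq> x2" "under_strand k \<in> {x1, x2}"
      using fixed[OF i(4)] i(3) by auto
    then have "\<pi> (under_strand k) = x2 \<or> \<pi> (under_strand k) = x1" using \<pi>(1,2) by blast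
    then have "head x2 = i \<or> head x1 = i" using eq by (elim disjE) (simp_all only: simp_thms)
    moreover have "head x2 = c0" "p (head x1) \<noteq> p c0" using swap ne(1) by blast+
    ultimately show False using i(2) pS[OF i(1)] by (elim disjE) simp_all
  qed
  have "\<exists>c1\<in>S. c1 \<noteq> c0"
  proof (rule ccontr)
    assume "\<not> ?thesis"
    then have "f c0 = c0" "g c0 = c0" using S(2,3) unfolding out_closed_def by blast+
    then have eq: "head (\<pi> (under_strand (2 * c0))) = c0" "head (\<pi> (under_strand (2 * c0 + 1))) = c0"
      unfolding f_def g_def next_crossing_def .
    have k: "2 * c0 < 2 * crossing_number" "2 * c0 + 1 < 2 * crossing_number" using c0 by auto
    have d: "(2 * c0) div 2 = c0" "(2 * c0 + 1) div 2 = c0" by simp_all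
    have moved: "under_strand (2 * c0) \<in> {x1, x2}" "under_strand (2 * c0 + 1) \<in> {x1, x2}" "x1 \<noteq> x2"
      using fixed[OF k(1)] fixed[OF k(2)] eq unfolding d by blast+
    have "under_strand (2 * c0) \<noteq> under_strand (2 * c0 + 1)"
      using inj_onD[OF bij_betw_imp_inj_on[OF bij_under], of "2 * c0" "2 * c0 + 1"] k by auto
    then have "x2 = under_strand (2 * c0) \<or> x2 = under_strand (2 * c0 + 1)"
      using moved by (metis insertE singletonD)
    then have "head (\<pi> x2) = c0"
    proof
      assume "x2 = under_strand (2 * c0)"
      then show ?thesis using eq(1) by (simp only:)
    next
      assume "x2 = under_strand (2 * c0 + 1)"
      then show ?thesis using eq(2) by (simp only:)
    qed
    then have "head x1 = c0" by (simp only: \<pi>(2))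
    then show False using swap moved(3) by simp
  qed
  then obtain c1 where c1: "c1 \<in> S" "c1 \<noteq> c0" by blast
  have noloop: "f i \<noteq> i \<and> g i \<noteq> i" if "i \<in> S" "i \<noteq> c0" for i
  proof -
    have "i < crossing_number" using that(1) S(1) by auto
    then have "2 * i < 2 * crossing_number" "2 * i + 1 < 2 * crossing_number"
      "(2 * i) div 2 = i" "(2 * i + 1) div 2 = i" by simp_all
    then show ?thesis using loop[OF that] unfolding f_def g_def by blast
  qed
  obtain n Y j where Y: "n > 0" "fox n S f g Y" "j \<in> S" "\<not> n dvd Y j - Y c0"
    using nonconstant_fox[OF S(4,5,2) noloop c1] by blast
  define Z where "Z = (\<lambda>i. if i \<in> S then Y i else Y c0)"
  have co: "out_closed f g (?V - S)" by (rule out_closed_complement[OF bal S(1,3)])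
  have foxZ: "n dvd 2 * Z i - Z (f i) - Z (g i)" if "i < crossing_number" for i
  proof (cases "i \<in> S")
    case True
    then show ?thesis using Y(2) S(3) by (simp add: fox_def out_closed_def Z_def)
  next
    case False
    then have "f i \<notin> S" "g i \<notin> S" using co that by (auto simp: out_closed_def)
    then show ?thesis using False by (simp add: Z_def)
  qed
  have Zx: "Z (head x1) = Z (head x2)" if "x1 \<noteq> x2"
  proof -
    have "head x1 \<notin> S" using swap that pS by blast
    then show ?thesis using swap that by (simp add: Z_def)
  qed
  have same: "Z (next_crossing \<pi> k) = Z (head (under_strand k))" for k
  proof -
    have "Z (head (\<pi> x)) = Z (head x)" for x
      using Zx \<pi>(1,2) \<pi>(3)[of x] by (cases "x = x1"; cases "x = x2"; cases "x1 = x2") simp_all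
    then show ?thesis by (simp only: next_crossing_def)
  qed
  have "n dvd 2 * Z i - Z (head (under_strand (2 * i))) - Z (head (under_strand (2 * i + 1)))"
    if "i < crossing_number" for i
    using foxZ[OF that] unfolding f_def g_def same .
  moreover have "\<not> n dvd Z j - Z c0" using Y(3,4) S(2) by (simp add: Z_def)
  moreover have "j < crossing_number" using S(1) Y(3) by auto
  ultimately show ?thesis using Y(1) pS[OF Y(3)] Zx by blast
qed

text \<open>The edges of colour \<open>z\<close> on the strand named \<open>x\<close> have an even number of ends altogether, and joints
other than the two where the colour jumps connect edges of equal colour.\<close>

lemma strand_parity:
  fixes q :: "nat \<Rightarrow> 'x"
  assumes two: "edges_have_two_ends (Joint u1 v1 # Joint u2 v2 # E)"
    and q: "colouring Q E q" and s: "s u1 = s v1" "s u2 = s v2"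
  shows "even (length (filter (\<lambda>e. s e = x \<and> q e = z) (under_ends E)) +
    length (filter (\<lambda>e. s e = x \<and> q e = z) (over_ends E)) +
    ((if s u1 = x then of_bool (q u1 = z) + of_bool (q v1 = z) else 0) +
     (if s u2 = x then of_bool (q u2 = z) + of_bool (q v2 = z) else 0)))"
proof -
  define P where "P = (\<lambda>e. s e = x \<and> q e = z)"
  have "P a = P b" if "Joint a b \<in> set E" for a b
  proof -
    have "s a = s b" using that alternating unfolding alternating_strands_def by fastforce
    moreover have "q a = q b" using that q unfolding colouring_def by fastforce
    ultimately show ?thesis by (simp add: P_def)
  qed
  then have "even (length (filter P (end_labels E))) \<longleftrightarrow>
      even (length (filter P (under_ends E)) + length (filter P (over_ends E)))"
    by (rule even_ends_crossings)
  moreover have "length (filter P (end_labels (Joint u1 v1 # Joint u2 v2 # E))) =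
      length (filter P (end_labels E)) +
      ((if s u1 = x then of_bool (q u1 = z) + of_bool (q v1 = z) else 0) +
       (if s u2 = x then of_bool (q u2 = z) + of_bool (q v2 = z) else 0))"
    using s by (simp add: P_def)
  moreover have "even (length (filter P (end_labels (Joint u1 v1 # Joint u2 v2 # E))))"
    by (rule even_ends[OF two])
  ultimately show ?thesis unfolding P_def by simp
qed

lemma strand_colours:
  fixes q :: "nat \<Rightarrow> 'x"
  assumes two: "edges_have_two_ends (Joint u1 v1 # Joint u2 v2 # E)"
    and q: "colouring Q E q" and s: "s u1 = s v1" "s u2 = s v2"
    and k: "k < 2 * crossing_number"
  shows "even (of_bool (under_colour q k = z) + of_bool (over_colour q (head (under_strand k)) = z) +
    ((if s u1 = under_strand k then of_bool (q u1 = z) + of_bool (q v1 = z) else 0) +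
     (if s u2 = under_strand k then of_bool (q u2 = z) + of_bool (q v2 = z) else 0) :: nat))"
proof -
  let ?x = "under_strand k"
  have d: "distinct (map s (under_ends E))" "distinct (map s (over_ends E))"
    using alternating by (simp_all add: alternating_strands_def)
  have a: "under_ends E ! k \<in> set (under_ends E)" using k ends_at(1) by simp
  have u: "length (filter (\<lambda>e. s e = ?x \<and> q e = z) (under_ends E)) = of_bool (under_colour q k = z)"
    using filter_strand[OF d(1) a, of "\<lambda>e. q e = z"] unfolding under_strand_def under_colour_def .
  obtain m where m: "m < 2 * crossing_number" "?x = over_strand m"
    using under_strand_in[OF k] by (rule strand_cases)
  then have b: "over_ends E ! m \<in> set (over_ends E)" using ends_at(2) by simp
  have x: "s (over_ends E ! m) = ?x" using m(2) by (simp add: over_strand_def)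
  note o = filter_strand[OF d(2) b, of "\<lambda>e. q e = z", unfolded x over_colour_head[OF q b]]
  show ?thesis using strand_parity[OF two q s, of ?x z] unfolding u o .
qed

lemma strands_of_cut:
  fixes q :: "nat \<Rightarrow> 'x"
  assumes two: "edges_have_two_ends (Joint u1 v1 # Joint u2 v2 # E)"
    and q: "colouring Q E q" and s: "s u1 = s v1" "s u2 = s v2" "s u1 \<noteq> s u2"
    and ne: "q u1 \<noteq> q v1" "q u2 \<noteq> q v2"
  shows "s u1 \<in> strands" "s u2 \<in> strands"
proof -
  have "set (map s (under_ends E)) = set (map s (over_ends E))"
    using alternating by (simp add: alternating_strands_def)
  then have o: "strands = s ` set (over_ends E)" by (simp add: strands_def)
  have none: "filter (\<lambda>e. s e = x \<and> R e) (under_ends E) = []"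
    "filter (\<lambda>e. s e = x \<and> R e) (over_ends E) = []" if "x \<notin> strands" for x R
    using that unfolding filter_empty_conv by (auto simp: strands_def) (auto simp: o strands_def[symmetric])
  show "s u1 \<in> strands"
  proof (rule ccontr)
    assume n: "s u1 \<notin> strands"
    show False
      using strand_parity[OF two q s(1,2), of "s u1" "q u1"] s(3) ne(1)
      unfolding none[OF n] by simp
  qed
  show "s u2 \<in> strands"
  proof (rule ccontr)
    assume n: "s u2 \<notin> strands"
    show False
      using strand_parity[OF two q s(1,2), of "s u2" "q u2"] s(3) ne(2)
      unfolding none[OF n] by simp
  qed
qed

text \<open>A colouring modulo \<open>n\<close> that factors through \<open>q\<close> has equal values at crossings with equal colours,
unlike the colouring of \<open>nonconstant_on_class\<close>.\<close>

lemma constant_class_not_universal: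
  fixes q :: "nat \<Rightarrow> 'x"
  assumes "c0 < crossing_number"
    and swap: "s u1 = s u2 \<or> s u1 \<in> strands \<and> s u2 \<in> strands \<and>
      over_colour q (head (s u1)) \<noteq> over_colour q c0 \<and> head (s u2) = c0"
    and const: "\<And>k. k < 2 * crossing_number \<Longrightarrow>
      over_colour q (next_crossing (id(s u1 := s u2, s u2 := s u1)) k) = over_colour q (k div 2)"
    and s: "s u1 = s v1" "s u2 = s v2"
    and universal: "\<And>n y. colouring (dihedral n) (Joint u1 v1 # Joint u2 v2 # E) y \<Longrightarrow> y u1 = y u2 \<Longrightarrow>
      \<exists>\<phi>. \<forall>e\<in>edges E. \<phi> (q e) = y e"
  shows False
proof -
  obtain n :: int and Z i where n: "n > 0" and i: "i < crossing_number"
    and same: "over_colour q i = over_colour q c0" and ne: "\<not> n dvd Z i - Z c0"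
    and Zx: "s u1 = s u2 \<or> Z (head (s u1)) = Z (head (s u2))"
    and fox: "\<forall>i<crossing_number.
      n dvd 2 * Z i - Z (head (under_strand (2 * i))) - Z (head (under_strand (2 * i + 1)))"
    using nonconstant_on_class[OF assms(1) swap const] by blast
  define y where "y = (\<lambda>e. if s e \<in> strands then Z (head (s e)) mod n else 0 mod n)"
  have y: "colouring (dihedral n) E y"
    unfolding y_def using fox by (intro fox_colouring) blast
  have "y u1 = y v1" "y u2 = y v2" using s by (simp_all add: y_def)
  moreover have "y e \<in> elems (dihedral n)" for e by (simp add: y_def elems_dihedral)
  ultimately have "colouring (dihedral n) (Joint u1 v1 # Joint u2 v2 # E) y" using y by simp
  moreover have "y u1 = y u2"
  proof (cases "s u1 = s u2")
    case True
    then show ?thesis by (simp add: y_def)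
  next
    case False
    then show ?thesis using swap Zx by (simp add: y_def)
  qed
  ultimately obtain \<phi> where \<phi>: "\<forall>e\<in>edges E. \<phi> (q e) = y e"
    using universal by blast
  have "\<phi> (over_colour q j) = Z j mod n" if j: "j < crossing_number" for j
  proof -
    have k: "2 * j < 2 * crossing_number" using j by simp
    then have "over_ends E ! (2 * j) \<in> set (over_ends E)" using ends_at(2) by simp
    then have "over_ends E ! (2 * j) \<in> edges E" using ends_subset by blast
    then have "\<phi> (over_colour q j) = y (over_ends E ! (2 * j))" using \<phi> by (simp add: over_colour_def)
    moreover have "s (over_ends E ! (2 * j)) = over_strand (2 * j)" by (simp add: over_strand_def)
    moreover have "over_strand (2 * j) \<in> strands" using bij_betw_apply[OF bij_over] k by simp
    moreover have "head (over_strand (2 * j)) = j" using head_over_strand[OF k] by simp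
    ultimately show ?thesis by (simp add: y_def)
  qed
  then have "Z i mod n = Z c0 mod n" using same i assms(1) by metis
  then show False using ne by (simp add: mod_eq_dvd_iff)
qed

lemma opposite_colours:
  assumes "u \<noteq> v"
    and "even (of_bool (a = u) + of_bool (b = u) + 1 :: nat)"
    and "even (of_bool (a = v) + of_bool (b = v) + 1 :: nat)"
  shows "(a = u \<and> b = v) \<or> (a = v \<and> b = u)"
  using assms by (cases "a = u"; cases "b = u"; cases "a = v"; cases "b = v") simp_all

text \<open>The colouring \<open>q\<close> respects all crossings but jumps between \<open>q u1\<close> and \<open>q v1\<close> at the two joints.
Depending on their positions and directions, the jumps cancel, contradict rigidity, or disappear
when the targets of the two strands are exchanged; without jumps the colour is constant on
components, which \<open>constant_class_not_universal\<close> excludes.\<close>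

lemma cut_colouring_not_universal:
  fixes q :: "nat \<Rightarrow> 'x"
  assumes two: "edges_have_two_ends (Joint u1 v1 # Joint u2 v2 # E)"
    and s: "s u1 = s v1" "s u2 = s v2"
    and Q: "involutory_quandle Q" and lt: "left_order Q lt" and q: "colouring Q E q"
    and uv: "q u1 = q u2" "q v1 = q v2" "q u1 \<noteq> q v1"
    and universal: "\<And>n y. colouring (dihedral n) (Joint u1 v1 # Joint u2 v2 # E) y \<Longrightarrow> y u1 = y u2 \<Longrightarrow>
      \<exists>\<phi>. \<forall>e\<in>edges E. \<phi> (q e) = y e"
  shows False
proof -
  let ?C = "q ` edges E"
  let ?\<pi> = "id(s u1 := s u2, s u2 := s u1)"
  have C: "finite ?C" "?C \<subseteq> elems Q"
    using colouring_elems[OF q] finite_set[of "end_labels E"] by auto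
  obtain \<kappa> :: "'x \<Rightarrow> int" where \<kappa>: "\<forall>x\<in>?C. \<forall>y\<in>?C. lt x y \<longrightarrow> \<kappa> x < \<kappa> y"
    using left_order_rank[OF lt C] by blast
  have inj: "x = y" if "x \<in> ?C" "y \<in> ?C" "\<kappa> x = \<kappa> y" for x y
  proof -
    have "x = y \<or> lt x y \<or> lt y x" using lt C(2) that unfolding left_order_def by blast
    then show ?thesis using \<kappa> that by force
  qed
  have between: "(\<kappa> (under_colour q (2 * i)) = \<kappa> (over_colour q i) \<and>
        \<kappa> (under_colour q (2 * i + 1)) = \<kappa> (over_colour q i)) \<or>
      (\<kappa> (under_colour q (2 * i)) < \<kappa> (over_colour q i) \<and>
        \<kappa> (over_colour q i) < \<kappa> (under_colour q (2 * i + 1))) \<or>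
      (\<kappa> (over_colour q i) < \<kappa> (under_colour q (2 * i)) \<and>
        \<kappa> (under_colour q (2 * i + 1)) < \<kappa> (over_colour q i))"
    if i: "i < crossing_number" for i
  proof -
    have k: "2 * i < 2 * crossing_number" "2 * i + 1 < 2 * crossing_number" using i by auto
    note c = crossing_colours[OF q i]
    have "over_colour q i \<in> ?C" "under_colour q (2 * i) \<in> ?C" "under_colour q (2 * i + 1) \<in> ?C"
      by (intro over_colour_in i, intro under_colour_in k(1), intro under_colour_in k(2))
    then show ?thesis using left_order_between[OF Q lt c(2,1,3)] \<kappa> by auto
  qed
  have rigid: "over_colour q (next_crossing \<pi> k) = under_colour q k \<and>
      over_colour q (next_crossing \<pi> k) = over_colour q (k div 2)"
    if \<pi>: "bij_betw \<pi> strands strands" and k: "k < 2 * crossing_number"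
      and le: "(\<forall>k<2 * crossing_number. \<kappa> (over_colour q (next_crossing \<pi> k)) \<le> \<kappa> (under_colour q k)) \<or>
        (\<forall>k<2 * crossing_number. \<kappa> (over_colour q (next_crossing \<pi> k)) \<ge> \<kappa> (under_colour q k))"
    for \<pi> k
  proof -
    have "\<kappa> (under_colour q k) = \<kappa> (over_colour q (next_crossing \<pi> k)) \<and>
        \<kappa> (over_colour q (next_crossing \<pi> k)) = \<kappa> (over_colour q (k div 2))"
      using le
    proof
      assume le: "\<forall>k<2 * crossing_number. \<kappa> (over_colour q (next_crossing \<pi> k)) \<le> \<kappa> (under_colour q k)"
      show ?thesis
        by (intro conjI; rule rigid_strands[OF \<pi> _ _ k, of \<kappa>]) (use between le in force)+
    next
      assume le: "\<forall>k<2 * crossing_number. \<kappa> (over_colour q (next_crossing \<pi> k)) \<ge> \<kappa> (under_colour q k)"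
      have "- \<kappa> (under_colour q k) = - \<kappa> (over_colour q (next_crossing \<pi> k)) \<and>
          - \<kappa> (over_colour q (next_crossing \<pi> k)) = - \<kappa> (over_colour q (k div 2))"
        by (intro conjI; rule rigid_strands[OF \<pi> _ _ k, of "\<lambda>x. - \<kappa> x"]) (use between le in force)+
      then show ?thesis by simp
    qed
    moreover have "next_crossing \<pi> k < crossing_number"
      unfolding next_crossing_def
      by (rule head_less[OF bij_betw_apply[OF \<pi> under_strand_in[OF k]]])
    moreover have "k div 2 < crossing_number" using k by simp
    ultimately show ?thesis
      using inj over_colour_in under_colour_in k by metis
  qed
  have pos: "crossing_number > 0"
  proof -
    have "length (over_ends E) > 0" using alternating by (simp add: alternating_strands_def)
    then show ?thesis by (simp add: ends_at(2))
  qed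
  note col = strand_colours[OF two q s]
  show False
  proof (cases "s u1 = s u2")
    case True
    \<comment> \<open>Both points lie on one strand: the jumps cancel, and \<open>?\<pi>\<close> is the identity.\<close>
    have eq: "under_colour q k = over_colour q (next_crossing ?\<pi> k)" if "k < 2 * crossing_number" for k
    proof -
      have "even (of_bool (under_colour q k = under_colour q k) +
          of_bool (over_colour q (head (under_strand k)) = under_colour q k) :: nat)"
        using col[OF that, of "under_colour q k"] True uv(1,2) by (auto split: if_splits)
      then have "over_colour q (head (under_strand k)) = under_colour q k" by (simp split: if_splits)
      moreover have "?\<pi> x = x" for x using True by simp
      ultimately show ?thesis by (simp add: next_crossing_def)
    qed
    have bij: "bij_betw ?\<pi> strands strands" using True by (intro swap_bij) simp
    show False
      by (rule constant_class_not_universal[OF pos _ _ s universal]) (use True rigid[OF bij] eq in auto)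
  next
    case False
    \<comment> \<open>Neither point lies on a closed curve without crossings, where one jump cannot be undone.\<close>
    have st: "s u1 \<in> strands" "s u2 \<in> strands"
      using strands_of_cut[OF two q s False] uv by metis+
    have bij: "bij_betw ?\<pi> strands strands" using st by (intro swap_bij) blast
    have other: "under_colour q k = over_colour q (head (under_strand k))"
      if "k < 2 * crossing_number" "under_strand k \<noteq> s u1" "under_strand k \<noteq> s u2" for k
      using col[OF that(1), of "under_colour q k"] that(2,3) by (simp split: if_splits)
    have types: "(under_colour q k = q u1 \<and> over_colour q (head (under_strand k)) = q v1) \<or>
        (under_colour q k = q v1 \<and> over_colour q (head (under_strand k)) = q u1)"
      if "k < 2 * crossing_number" "under_strand k = s u1 \<or> under_strand k = s u2" for k
    proof -
      have "(if s u1 = under_strand k then of_bool (q u1 = z) + of_bool (q v1 = z) else 0) +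
          (if s u2 = under_strand k then of_bool (q u2 = z) + of_bool (q v2 = z) else 0) = (1 :: nat)"
        if z: "z = q u1 \<or> z = q v1" for z
        using \<open>under_strand k = s u1 \<or> under_strand k = s u2\<close>
      proof
        assume "under_strand k = s u1"
        then show ?thesis using z uv(3) False by (elim disjE) simp_all
      next
        assume "under_strand k = s u2"
        then show ?thesis using z uv False by (elim disjE) simp_all
      qed
      note tail = this
      show ?thesis
        using opposite_colours[OF uv(3)] col[OF that(1), of "q u1"] col[OF that(1), of "q v1"]
        unfolding tail[OF disjI1[OF HOL.refl]] tail[OF disjI2[OF HOL.refl]] by blast
    qed
    obtain k1 k2 where k: "k1 < 2 * crossing_number" "under_strand k1 = s u1"
      "k2 < 2 * crossing_number" "under_strand k2 = s u2"
    proof -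
      have "s u1 \<in> under_strand ` {..<2 * crossing_number}"
        "s u2 \<in> under_strand ` {..<2 * crossing_number}"
        using st unfolding bij_betw_imp_surj_on[OF bij_under] .
      then show ?thesis using that by auto
    qed
    have k_unique: "k = k1" if "k < 2 * crossing_number" "under_strand k = s u1" for k
      using inj_onD[OF bij_betw_imp_inj_on[OF bij_under], of k k1] that k by simp
    have k_unique2: "k = k2" if "k < 2 * crossing_number" "under_strand k = s u2" for k
      using inj_onD[OF bij_betw_imp_inj_on[OF bij_under], of k k2] that k by simp
    have t1: "(under_colour q k1 = q u1 \<and> over_colour q (head (s u1)) = q v1) \<or>
        (under_colour q k1 = q v1 \<and> over_colour q (head (s u1)) = q u1)"
      and t2: "(under_colour q k2 = q u1 \<and> over_colour q (head (s u2)) = q v1) \<or>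
        (under_colour q k2 = q v1 \<and> over_colour q (head (s u2)) = q u1)"
      using types[of k1] types[of k2] k by simp_all
    show False
    proof (cases "under_colour q k1 = under_colour q k2")
      case True
      \<comment> \<open>Jumps in the same direction, which contradict rigidity for the order or its reverse.\<close>
      then have heads: "over_colour q (head (s u1)) = over_colour q (head (s u2))"
        using t1 t2 uv(3) by auto
      have jump: "over_colour q (next_crossing id k) = over_colour q (head (s u1)) \<and>
          under_colour q k = under_colour q k1 \<or>
          over_colour q (next_crossing id k) = under_colour q k" if kn: "k < 2 * crossing_number" for k
      proof -
        consider "under_strand k = s u1" | "under_strand k = s u2"
          | "under_strand k \<noteq> s u1" "under_strand k \<noteq> s u2" by blast
        then show ?thesis
        proof cases
          case 1
          then show ?thesis using k_unique[OF kn 1] by (simp add: next_crossing_def)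
        next
          case 2
          then show ?thesis using k_unique2[OF kn 2] heads True by (simp add: next_crossing_def)
        next
          case 3
          then show ?thesis using other[OF kn 3] by (simp add: next_crossing_def)
        qed
      qed
      have "over_colour q (next_crossing id k1) = under_colour q k1"
      proof (rule rigid[OF bij_betw_id k(1), THEN conjunct1])
        show "(\<forall>k<2 * crossing_number.
              \<kappa> (over_colour q (next_crossing id k)) \<le> \<kappa> (under_colour q k)) \<or>
            (\<forall>k<2 * crossing_number.
              \<kappa> (under_colour q k) \<le> \<kappa> (over_colour q (next_crossing id k)))"
        proof (cases "\<kappa> (over_colour q (head (s u1))) \<le> \<kappa> (under_colour q k1)")
          case True
          then have "\<kappa> (over_colour q (next_crossing id k)) \<le> \<kappa> (under_colour q k)"
            if "k < 2 * crossing_number" for k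
            using jump[OF that] by (elim disjE) simp_all
          then show ?thesis by blast
        next
          case False
          then have "\<kappa> (under_colour q k) \<le> \<kappa> (over_colour q (next_crossing id k))"
            if "k < 2 * crossing_number" for k
            using jump[OF that] by (elim disjE) simp_all
          then show ?thesis by blast
        qed
      qed
      moreover have "next_crossing id k1 = head (s u1)" by (simp add: next_crossing_def k(2))
      ultimately show False using t1 uv(3) by auto
    next
      case opposite: False
      \<comment> \<open>Jumps in opposite directions, which disappear when the targets are exchanged.\<close>
      have nx: "over_colour q (next_crossing ?\<pi> k) = under_colour q k" if "k < 2 * crossing_number" for k
      proof -
        have cross: "over_colour q (head (s u2)) = under_colour q k1"
          "over_colour q (head (s u1)) = under_colour q k2"
          using opposite t1 t2 by auto
        consider "under_strand k = s u1" | "under_strand k = s u2"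
          | "under_strand k \<noteq> s u1" "under_strand k \<noteq> s u2" by blast
        then show ?thesis
        proof cases
          case 1
          then show ?thesis using k_unique[OF that 1] cross False by (simp add: next_crossing_def)
        next
          case 2
          then show ?thesis using k_unique2[OF that 2] cross by (simp add: next_crossing_def)
        next
          case 3
          then show ?thesis using other[OF that 3] by (simp add: next_crossing_def)
        qed
      qed
      have const: "over_colour q (next_crossing ?\<pi> k) = over_colour q (k div 2)"
        if "k < 2 * crossing_number" for k
        by (rule rigid[OF bij that, THEN conjunct2]) (simp add: nx)
      have "over_colour q (head (s u1)) \<noteq> over_colour q (head (s u2))"
        using opposite t1 t2 by auto
      then have "s u1 = s u2 \<or> s u1 \<in> strands \<and> s u2 \<in> strands \<and>
          over_colour q (head (s u1)) \<noteq> over_colour q (head (s u2)) \<and> head (s u2) = head (s u2)"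
        using st by blast
      then show False
        by (rule constant_class_not_universal[OF head_less[OF st(2)] _ const s universal])
    qed
  qed
qed

end

section \<open>Augmented diagrams\<close>

text \<open>The code of an augmented diagram: \<open>l\<close>, \<open>f\<close>, \<open>r\<close>, \<open>g\<close> are the edges of the circle \<open>J\<close>, and
\<open>m1\<close>, \<open>m2\<close> the pieces of the two strands seen inside of it.\<close>

locale augmented_code =
  fixes u1 v1 u2 v2 m1 m2 l f r g :: nat and E :: pd
  assumes two_ends: "edges_have_two_ends
    (Cross u1 l m1 f # Cross u2 f m2 r # Cross g m1 l v1 # Cross r m2 g v2 # E)"
begin

abbreviation augmented :: pd where
  "augmented \<equiv> Cross u1 l m1 f # Cross u2 f m2 r # Cross g m1 l v1 # Cross r m2 g v2 # E"

lemma fresh: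
  "l \<notin> {u1, v1, u2, v2, m1, m2} \<union> edges E" "f \<notin> {u1, v1, u2, v2, m1, m2} \<union> edges E"
  "r \<notin> {u1, v1, u2, v2, m1, m2} \<union> edges E" "g \<notin> {u1, v1, u2, v2, m1, m2} \<union> edges E"
  "m1 \<notin> {u1, v1, u2, v2} \<union> edges E" "m2 \<notin> {u1, v1, u2, v2} \<union> edges E"
proof -
  have "l \<notin> set ([u1, v1, u2, v2, m1, m1, m2, m2, f, f, r, r, g, g] @ end_labels E)"
    by (rule two_ends_fresh[OF two_ends]) (simp add: add_mset_commute)
  then show "l \<notin> {u1, v1, u2, v2, m1, m2} \<union> edges E" by simp
  have "f \<notin> set ([u1, v1, u2, v2, m1, m1, m2, m2, l, l, r, r, g, g] @ end_labels E)"
    by (rule two_ends_fresh[OF two_ends]) (simp add: add_mset_commute)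
  then show "f \<notin> {u1, v1, u2, v2, m1, m2} \<union> edges E" by simp
  have "r \<notin> set ([u1, v1, u2, v2, m1, m1, m2, m2, l, l, f, f, g, g] @ end_labels E)"
    by (rule two_ends_fresh[OF two_ends]) (simp add: add_mset_commute)
  then show "r \<notin> {u1, v1, u2, v2, m1, m2} \<union> edges E" by simp
  have "g \<notin> set ([u1, v1, u2, v2, m1, m1, m2, m2, l, l, f, f, r, r] @ end_labels E)"
    by (rule two_ends_fresh[OF two_ends]) (simp add: add_mset_commute)
  then show "g \<notin> {u1, v1, u2, v2, m1, m2} \<union> edges E" by simp
  have "m1 \<notin> set ([u1, v1, u2, v2, m2, m2, l, l, f, f, r, r, g, g] @ end_labels E)"
    by (rule two_ends_fresh[OF two_ends]) (simp add: add_mset_commute)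
  then show "m1 \<notin> {u1, v1, u2, v2} \<union> edges E" by simp
  have "m2 \<notin> set ([u1, v1, u2, v2, m1, m1, l, l, f, f, r, r, g, g] @ end_labels E)"
    by (rule two_ends_fresh[OF two_ends]) (simp add: add_mset_commute)
  then show "m2 \<notin> {u1, v1, u2, v2} \<union> edges E" by simp
qed

text \<open>If the strands through \<open>J\<close> have the same colour, \<open>J\<close> may be given that colour, too.\<close>

lemma extend_colouring:
  assumes Q: "involutory_quandle Q" and y: "colouring Q (Joint u1 v1 # Joint u2 v2 # E) y"
    and eq: "y u1 = y u2"
  shows "\<exists>y'. colouring Q augmented y' \<and> (\<forall>e\<in>edges E. y' e = y e)"
proof (intro exI conjI)
  let ?y = "\<lambda>e. if e \<in> {l, f, r, g, m1, m2} then y u1 else y e"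
  have old: "?y e = y e" if "e \<in> {u1, v1, u2, v2} \<union> edges E" for e
    using fresh that by auto
  then show "\<forall>e\<in>edges E. ?y e = y e" by blast
  have new: "?y l = y u1" "?y f = y u1" "?y r = y u1" "?y g = y u1" "?y m1 = y u1" "?y m2 = y u1"
    by simp_all
  have outer: "?y u1 = y u1" "?y v1 = y u1" "?y u2 = y u1" "?y v2 = y u1"
  proof -
    have "y v1 = y u1" "y v2 = y u1" using y eq by auto
    then show "?y u1 = y u1" "?y v1 = y u1" "?y u2 = y u1" "?y v2 = y u1"
      using old[of u1] old[of v1] old[of u2] old[of v2] eq by simp_all
  qed
  have "colouring Q E ?y"
    using y old by (subst colouring_cong[of E ?y y]) simp_all
  moreover have "y u1 \<in> elems Q" using y by simp
  ultimately show "colouring Q augmented ?y"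
    unfolding colouring_simps piece_coloured.simps ends.simps
    using new outer quandleD(2)[OF Q] by simp
qed

text \<open>The dihedral quandle of order 2 is trivial, so a component may be coloured differently from the
others.\<close>

lemma component_colouring:
  "colouring (dihedral 2) augmented (\<lambda>e. if e \<in> {l, f, r, g} then 1 else 0)"
  (is "colouring _ _ ?y")
proof -
  have old: "?y e = 0" if "e \<in> {u1, v1, u2, v2, m1, m2} \<union> edges E" for e
    using fresh that by auto
  have 0: "colouring (dihedral 2) D (\<lambda>_. 0)" for D
    unfolding colouring_def
  proof (intro ballI conjI)
    fix p assume "p \<in> set D"
    show "piece_coloured (dihedral 2) (\<lambda>_. 0) p" by (cases p) (simp_all add: act_dihedral)
  qed (simp add: elems_dihedral)
  have "colouring (dihedral 2) E ?y"
    using 0[of E] old by (subst colouring_cong[of E ?y "\<lambda>_. 0"]) simp_all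
  moreover have "?y l = 1" "?y f = 1" "?y r = 1" "?y g = 1" by simp_all
  moreover have "?y u1 = 0" "?y v1 = 0" "?y u2 = 0" "?y v2 = 0" "?y m1 = 0" "?y m2 = 0"
    by (intro old; simp)+
  ultimately show ?thesis
    unfolding colouring_simps piece_coloured.simps ends.simps
    by (simp add: elems_dihedral act_dihedral del: if_True)
qed

text \<open>The four crossings of \<open>J\<close> give \<open>m1 = u1 * l\<close>, \<open>m2 = u2 * l\<close> and \<open>g = l * m1 = l * m2\<close>.  Left
cancellation yields \<open>m1 = m2\<close>, so the colour jumps by the same amount on both strands.\<close>

lemma no_left_order:
  fixes Q :: "'x magma_struct"
  assumes two: "edges_have_two_ends (Joint u1 v1 # Joint u2 v2 # E)"
    and alt: "alternating_strands (Joint u1 v1 # Joint u2 v2 # E) s"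
    and Q: "involutory_quandle Q" and univ: "universal_colouring TYPE(int) Q augmented q"
  shows "\<not> left_order Q lt"
proof
  assume lt: "left_order Q lt"
  have s: "s u1 = s v1" "s u2 = s v2" and "alternating_strands E s"
    using alt alternating_strands_tail by blast+
  then interpret alternating_code E s by unfold_locales
  have q: "colouring Q augmented q" using univ unfolding universal_colouring_def by blast
  have hom: "\<exists>\<phi>. \<forall>e\<in>edges augmented. \<phi> (q e) = y e" if "colouring (dihedral n) augmented y" for n y
    using univ that involutory_quandle_dihedral unfolding universal_colouring_def by blast
  have el: "q l \<in> elems Q" "q u1 \<in> elems Q" "q u2 \<in> elems Q" "q m1 \<in> elems Q" "q m2 \<in> elems Q"
    "q g \<in> elems Q"
    by (rule colouring_elems[OF q]; simp)+
  have crossings: "q l = q f" "q m1 = act Q (q u1) (q l)" "q f = q r" "q m2 = act Q (q u2) (q f)"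
    "q m1 = q v1" "q l = act Q (q g) (q m1)" "q m2 = q v2" "q g = act Q (q r) (q m2)"
    and qE: "colouring Q E q"
    using q unfolding colouring_simps piece_coloured.simps by blast+
  have r: "q f = q l" "q r = q l" using crossings(1,3) by simp_all
  note J = crossings(2) crossings(4)[unfolded r] crossings(6) crossings(8)[unfolded r]
  have gm: "act Q (q l) (q m1) = q g" using act_swap[OF Q el(6,4) J(3)] .
  then have m: "q m1 = q m2"
    using left_order_cancel[OF lt el(4,5,1)] gm J(4) el(6) by (simp only:)
  have "act Q (q m1) (q l) = q u1" "act Q (q m2) (q l) = q u2"
    using act_swap[OF Q el(2,1) J(1)] act_swap[OF Q el(3,1) J(2)] .
  then have u: "q u1 = q u2" unfolding m by (rule HOL.trans[OF HOL.sym])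
  have "q u1 \<noteq> q l"
  proof
    assume eq: "q u1 = q l"
    obtain \<phi> where "\<forall>e\<in>edges augmented. \<phi> (q e) = (if e \<in> {l, f, r, g} then 1 else 0 :: int)"
      using hom[OF component_colouring] by blast
    then have "\<phi> (q u1) = 0" "\<phi> (q l) = 1" using fresh by auto
    then show False using eq by simp
  qed
  then have uv: "q u1 \<noteq> q v1"
    using left_order_moves[OF Q lt el(2,1)] unfolding crossings(5)[symmetric] J(1) by (metis (no_types))
  have "\<exists>\<phi>. \<forall>e\<in>edges E. \<phi> (q e) = y e"
    if y: "colouring (dihedral n) (Joint u1 v1 # Joint u2 v2 # E) y" "y u1 = y u2" for n y
  proof -
    obtain y' where y': "colouring (dihedral n) augmented y'" "\<forall>e\<in>edges E. y' e = y e"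
      using extend_colouring[OF involutory_quandle_dihedral y] by blast
    obtain \<phi> where "\<forall>e\<in>edges augmented. \<phi> (q e) = y' e" using hom[OF y'(1)] by blast
    then have "\<forall>e\<in>edges E. \<phi> (q e) = y e" using y'(2) by simp
    then show ?thesis by blast
  qed
  moreover have "q v1 = q v2" using m unfolding crossings(5,7) .
  ultimately show False
    using cut_colouring_not_universal[OF two s Q lt qE u _ uv] by blast
qed

end

theorem theorem4p2:
  fixes L :: pd
  assumes "augmented_alternating_link L"
  shows "\<not> left_orderable (IQ L)"
proof -
  obtain D L' where D: "link_diagram D" "reduced_diagram D" "alternating_diagram D" "\<not> trivial_link D"
    and aug: "augmentation D L'" and iso: "isotopic L L'"
    using assms unfolding augmented_alternating_link_def by blast
  obtain u1 v1 u2 v2 m1 m2 l f r g E where L': "link_diagram L'"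
    and same: "same_diagram D (Joint u1 v1 # Joint u2 v2 # E)"
    and L'_eq: "L' = Cross u1 l m1 f # Cross u2 f m2 r # Cross g m1 l v1 # Cross r m2 g v2 # E"
    using aug unfolding augmentation_def by blast
  interpret augmented_code u1 v1 u2 v2 m1 m2 l f r g E
    using L' unfolding L'_eq link_diagram_def by unfold_locales blast
  have two: "edges_have_two_ends (Joint u1 v1 # Joint u2 v2 # E)"
    using link_diagram_same_diagram[OF same D(1)] by (simp only: link_diagram_def)
  obtain s where s: "alternating_strands (Joint u1 v1 # Joint u2 v2 # E) s"
    using alternating_strands_same_diagram[OF same alternating_strands_id[OF D]] by blast
  obtain q where "universal_colouring TYPE(int) (IQ L) augmented q"
    using universal_colouring_isotopic[OF iso involutory_quandle_IQ universal_colouring_IQ]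
    unfolding L'_eq by blast
  then have "\<not> left_order (IQ L) lt" for lt
    by (rule no_left_order[OF two s involutory_quandle_IQ])
  then show ?thesis unfolding left_orderable_def by blast
qed

end
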